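(* Let $[x]\in l_{2q+1}(\Lambda)$ be represented by a quasi-formation $x=(H_\epsilon(F);F,W)$ and suppose that an isometry $\alpha\in\mathrm{Aut}(H_\epsilon(F))$ restricts to an isometry of $W$. Then $[z(\alpha)]:=[H_\epsilon(F);F,\alpha(F)]\in L^s_{2q+1}(\Lambda)$ acts trivially on $[x]$, i.e. $[z(\alpha)]+[x]=[x]$ in $l_{2q+1}(\Lambda)$.
   Context: $q\ge1$, $\epsilon=(-1)^q$, $\Lambda$ is a unital ring with involution $x\mapsto\bar x$, weakly finite (ranks of finitely generated free modules are well defined). Fix a subgroup $Z\subset\widetilde K_1(\Lambda)=\mathrm{coker}(K_1(\mathbb Z)\to K_1(\Lambda))$ invariant under $[f]\mapsto[f^*]$. A based module is a stably finitely generated free left $\Lambda$-module $M$ with an equivalence class of $s$-bases (bases of some $M\oplus\Lambda^m$; two are equivalent if after adding standard basis vectors the transformation matrix represents an element of $Z$). An isomorphism of based modules is simple if its torsion lies in $Z$. For a based module $M$ let $T_\epsilon$ act on $\mathrm{Hom}(M,M^* )$ by $(T_\epsilon\phi)(x)(y)=\epsilon\overline{\phi(y)(x)}$ and $Q_\epsilon(M)=\mathrm{coker}(1-T_\epsilon)$. An $\epsilon$-quadratic form is $(M,\psi)$ with $\psi\in Q_\epsilon(M)$; it is simple if $\psi+\epsilon\psi^*\colon M\to M^*$ is a simple isomorphism. Isometries are simple isomorphisms preserving $\psi$; $\mathrm{Aut}(M,\psi)$ is the group of self-isometries. $H_\epsilon(L)=(L\oplus L^*,\begin{pmatrix}0&1\\0&0\end{pmatrix})$.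 A Lagrangian is a based direct summand $L$ with $L=L^\perp$ (unbased, with respect to $\psi+\epsilon\psi^*$) and $\psi|_L=0\in Q_\epsilon(L)$; it is simple, for a simple form, if $0\to L\to M\to L^*\to0$ is a based exact sequence. A quasi-formation $(M,\psi;L,V)$ is a simple form with a simple Lagrangian $L$ and a based half-rank direct summand $V$; it is a simple formation if $V$ is a simple Lagrangian. Isomorphisms are isometries carrying $L$ to $L'$, $V$ to $V'$ by simple isomorphisms. Trivial formations are $(H_\epsilon(P);P,P^* )$; stable isomorphism is isomorphism after adding trivial formations. $l_{2q+1}(\Lambda)$ is the abelian monoid (direct sum) of stable isomorphism classes of quasi-formations modulo $(M,\psi;K,L)\oplus(M,\psi;L,V)\sim(M,\psi;K,V)$ for simple Lagrangians $K,L$. $L^s_{2q+1}(\Lambda)\subset l_{2q+1}(\Lambda)$ is the subgroup of classes of simple formations, acting on $l_{2q+1}(\Lambda)$ by addition. "$\alpha$ restricts to an isometry of $W$" means $\alpha(W)=W$ and $\alpha|_W$ is a (simple) isometry of the form induced on $W$. *)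

theory Defs
  imports
    "HOL-Algebra.Generated_Groups"
    "HOL-Library.Groups_Big_Fun"
    "HOL-Library.Function_Algebras"
    "HOL-Library.Product_Plus"
begin

section \<open>Rings with involution and left modules\<close>

definition ring_involution :: "('a::ring_1 \<Rightarrow> 'a) \<Rightarrow> bool" where
  "ring_involution bar \<longleftrightarrow>
     (\<forall>a b. bar (a + b) = bar a + bar b) \<and> (\<forall>a b. bar (a * b) = bar b * bar a) \<and>
     bar 1 = 1 \<and> (\<forall>a. bar (bar a) = a)"

text \<open>
  Addition is the one of the ambient type, so a module is a subset of an abelian group together
  with a scalar multiplication; the latter is only relevant on the carrier.
\<close>

record ('a, 'm) lmod = "'m partial_object" +
  scl :: "'a \<Rightarrow> 'm \<Rightarrow> 'm"

definition left_module :: "('a::ring_1, 'm::ab_group_add, 'z) lmod_scheme \<Rightarrow> bool" where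
  "left_module M \<longleftrightarrow>
     0 \<in> carrier M \<and>
     (\<forall>x\<in>carrier M. \<forall>y\<in>carrier M. x + y \<in> carrier M) \<and>
     (\<forall>x\<in>carrier M. - x \<in> carrier M) \<and>
     (\<forall>a. \<forall>x\<in>carrier M. scl M a x \<in> carrier M) \<and>
     (\<forall>a. \<forall>x\<in>carrier M. \<forall>y\<in>carrier M. scl M a (x + y) = scl M a x + scl M a y) \<and>
     (\<forall>a b. \<forall>x\<in>carrier M. scl M (a + b) x = scl M a x + scl M b x) \<and>
     (\<forall>a b. \<forall>x\<in>carrier M. scl M (a * b) x = scl M a (scl M b x)) \<and>
     (\<forall>x\<in>carrier M. scl M 1 x = x)"

definition mod_hom ::
  "('a::ring_1, 'm::ab_group_add, 'z) lmod_scheme \<Rightarrow> ('a, 'n::ab_group_add, 'w) lmod_scheme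
     \<Rightarrow> ('m \<Rightarrow> 'n) set" where
  "mod_hom M N = {f. f ` carrier M \<subseteq> carrier N \<and>
     (\<forall>x\<in>carrier M. \<forall>y\<in>carrier M. f (x + y) = f x + f y) \<and>
     (\<forall>a. \<forall>x\<in>carrier M. f (scl M a x) = scl N a (f x))}"

definition mod_iso ::
  "('a::ring_1, 'm::ab_group_add, 'z) lmod_scheme \<Rightarrow> ('a, 'n::ab_group_add, 'w) lmod_scheme
     \<Rightarrow> ('m \<Rightarrow> 'n) set" where
  "mod_iso M N = {f \<in> mod_hom M N. bij_betw f (carrier M) (carrier N)}"

text \<open>
  Homomorphisms as elements of an abelian group: to make equality of functions coincide with
  equality of homomorphisms, they vanish outside the carrier.
\<close>

definition Hom ::
  "('a::ring_1, 'm::ab_group_add, 'z) lmod_scheme \<Rightarrow> ('a, 'n::ab_group_add, 'w) lmod_scheme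
     \<Rightarrow> ('m \<Rightarrow> 'n) set" where
  "Hom M N = {f \<in> mod_hom M N. \<forall>x. x \<notin> carrier M \<longrightarrow> f x = 0}"

definition ring_mod :: "('a::ring_1, 'a) lmod" where
  "ring_mod = \<lparr>carrier = UNIV, scl = (*)\<rparr>"

definition free_mod :: "nat \<Rightarrow> ('a::ring_1, nat \<Rightarrow> 'a) lmod" where
  "free_mod n = \<lparr>carrier = {v. \<forall>i\<ge>n. v i = 0}, scl = (\<lambda>a v i. a * v i)\<rparr>"

definition std_vec :: "nat \<Rightarrow> nat \<Rightarrow> 'a::ring_1" where
  "std_vec i = (\<lambda>j. if j = i then 1 else 0)"

definition mod_sum ::
  "('a::ring_1, 'm::ab_group_add, 'z) lmod_scheme \<Rightarrow> ('a, 'n::ab_group_add, 'w) lmod_scheme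
     \<Rightarrow> ('a, 'm \<times> 'n) lmod" where
  "mod_sum M N = \<lparr>carrier = carrier M \<times> carrier N, scl = (\<lambda>a (x, y). (scl M a x, scl N a y))\<rparr>"

definition submodule ::
  "('a::ring_1, 'm::ab_group_add, 'z) lmod_scheme \<Rightarrow> ('a, 'm, 'w) lmod_scheme \<Rightarrow> bool" where
  "submodule L M \<longleftrightarrow> left_module L \<and> carrier L \<subseteq> carrier M \<and>
     (\<forall>a. \<forall>x\<in>carrier L. scl L a x = scl M a x)"

definition direct_summand ::
  "('a::ring_1, 'm::ab_group_add, 'z) lmod_scheme \<Rightarrow> ('a, 'm, 'w) lmod_scheme \<Rightarrow> bool" where
  "direct_summand L M \<longleftrightarrow> submodule L M \<and>
     (\<exists>N :: ('a, 'm) lmod. submodule N M \<and> carrier L \<inter> carrier N = {0} \<and>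
        (\<forall>x\<in>carrier M. \<exists>y\<in>carrier L. \<exists>z\<in>carrier N. x = y + z))"

definition weakly_finite :: "'a::ring_1 itself \<Rightarrow> bool" where
  "weakly_finite _ \<longleftrightarrow>
     (\<forall>m n. mod_iso (free_mod m :: ('a, nat \<Rightarrow> 'a) lmod) (free_mod n) \<noteq> {} \<longrightarrow> m = n)"

section \<open>The reduced group K1\<close>

text \<open>
  Elements of the stable general linear group are infinite matrices which agree with the identity
  outside a finite square block.
\<close>

type_synonym 'a smat = "nat \<Rightarrow> nat \<Rightarrow> 'a"

definition smat_one :: "'a::ring_1 smat" where
  "smat_one = (\<lambda>i j. if i = j then 1 else 0)"

definition smat_mult :: "'a::ring_1 smat \<Rightarrow> 'a smat \<Rightarrow> 'a smat" where
  "smat_mult A B = (\<lambda>i j. Sum_any (\<lambda>k. A i k * B k j))"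

definition smat_block :: "nat \<Rightarrow> 'a::ring_1 smat set" where
  "smat_block n = {A. \<forall>i j. n \<le> i \<or> n \<le> j \<longrightarrow> A i j = smat_one i j}"

definition GL_n :: "nat \<Rightarrow> 'a::ring_1 smat set" where
  "GL_n n = {A \<in> smat_block n. \<exists>B\<in>smat_block n. smat_mult A B = smat_one \<and> smat_mult B A = smat_one}"

definition GL :: "'a::ring_1 smat monoid" where
  "GL = \<lparr>carrier = (\<Union>n. GL_n n), mult = smat_mult, one = smat_one\<rparr>"

definition K1 :: "'a::ring_1 smat set monoid" where
  "K1 = GL Mod derived GL (carrier GL)"

definition K1_class :: "'a::ring_1 smat \<Rightarrow> 'a smat set" where
  "K1_class A = derived GL (carrier GL) #>\<^bsub>GL\<^esub> A"

text \<open>The map induced on K1 by the unique ring homomorphism from the integers.\<close>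

definition K1_of_int :: "int smat set \<Rightarrow> 'a::ring_1 smat set" where
  "K1_of_int C = (\<Union>A\<in>C. K1_class (\<lambda>i j. of_int (A i j)))"

definition K1_tilde :: "'a::ring_1 smat set set monoid" where
  "K1_tilde = K1 Mod (K1_of_int ` carrier K1)"

definition torsion :: "'a::ring_1 smat \<Rightarrow> 'a smat set set" where
  "torsion A = (K1_of_int ` carrier K1) #>\<^bsub>K1\<^esub> K1_class A"

definition smat_adjoint :: "('a::ring_1 \<Rightarrow> 'a) \<Rightarrow> 'a smat \<Rightarrow> 'a smat" where
  "smat_adjoint bar A = (\<lambda>i j. bar (A j i))"

definition adjoint_invariant :: "('a::ring_1 \<Rightarrow> 'a) \<Rightarrow> 'a smat set set set \<Rightarrow> bool" where
  "adjoint_invariant bar Z \<longleftrightarrow>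
     (\<forall>A\<in>carrier GL. torsion A \<in> Z \<longrightarrow> torsion (smat_adjoint bar A) \<in> Z)"

section \<open>Based modules\<close>

definition is_basis :: "('a::ring_1, 'm::ab_group_add, 'z) lmod_scheme \<Rightarrow> 'm list \<Rightarrow> bool" where
  "is_basis M b \<longleftrightarrow> set b \<subseteq> carrier M \<and>
     bij_betw (\<lambda>v. \<Sum>i<length b. scl M (v i) (b ! i)) (carrier (free_mod (length b))) (carrier M)"

text \<open>An \<open>s\<close>-basis is a pair of \<open>m\<close> and a (finite, ordered) basis of the sum with the free module of rank \<open>m\<close>.\<close>

type_synonym ('a, 'm) sbasis = "nat \<times> ('m \<times> (nat \<Rightarrow> 'a)) list"

definition s_basis ::
  "('a::ring_1, 'm::ab_group_add, 'z) lmod_scheme \<Rightarrow> ('a, 'm) sbasis \<Rightarrow> bool" where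
  "s_basis M s \<longleftrightarrow> is_basis (mod_sum M (free_mod (fst s))) (snd s)"

definition stabilize :: "nat \<Rightarrow> ('a::ring_1, 'm::ab_group_add) sbasis \<Rightarrow> ('a, 'm) sbasis" where
  "stabilize k s = (fst s + k, snd s @ map (\<lambda>i. (0, std_vec i)) [fst s..<fst s + k])"

text \<open>
  Coordinates are written as rows, so that composition of maps reverses the matrix product; this
  is invisible in the abelian group K1.
\<close>

definition expressed_by ::
  "('a::ring_1, 'm::ab_group_add, 'z) lmod_scheme \<Rightarrow> 'a smat \<Rightarrow> 'm list \<Rightarrow> 'm list \<Rightarrow> bool" where
  "expressed_by M A b c \<longleftrightarrow> length b = length c \<and> A \<in> GL_n (length c) \<and>
     (\<forall>i<length b. b ! i = (\<Sum>j<length c. scl M (A i j) (c ! j)))"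

definition s_equiv ::
  "'a smat set set set \<Rightarrow> ('a::ring_1, 'm::ab_group_add, 'z) lmod_scheme
     \<Rightarrow> ('a, 'm) sbasis \<Rightarrow> ('a, 'm) sbasis \<Rightarrow> bool" where
  "s_equiv Z M s t \<longleftrightarrow> (\<exists>k l A. fst s + k = fst t + l \<and>
     expressed_by (mod_sum M (free_mod (fst s + k))) A (snd (stabilize k s)) (snd (stabilize l t)) \<and>
     torsion A \<in> Z)"

definition s_class ::
  "'a smat set set set \<Rightarrow> ('a::ring_1, 'm::ab_group_add, 'z) lmod_scheme
     \<Rightarrow> ('a, 'm) sbasis \<Rightarrow> ('a, 'm) sbasis set" where
  "s_class Z M s = {t. s_basis M t \<and> s_equiv Z M s t}"

record ('a, 'm) based = "('a, 'm) lmod" +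
  sbases :: "(nat \<times> ('m \<times> (nat \<Rightarrow> 'a)) list) set"

definition based_module ::
  "'a smat set set set \<Rightarrow> ('a::ring_1, 'm::ab_group_add) based \<Rightarrow> bool" where
  "based_module Z M \<longleftrightarrow> left_module M \<and> (\<exists>s. s_basis M s \<and> sbases M = s_class Z M s)"

definition mod_rank :: "('a::ring_1, 'm::ab_group_add, 'z) lmod_scheme \<Rightarrow> int" where
  "mod_rank M = (THE r. \<exists>m b. s_basis M (m, b) \<and> r = int (length b) - int m)"

definition map_sbasis :: "('m \<Rightarrow> 'n) \<Rightarrow> ('a, 'm) sbasis \<Rightarrow> ('a, 'n) sbasis" where
  "map_sbasis f s = (fst s, map (map_prod f id) (snd s))"

definition simple_iso ::
  "'a smat set set set \<Rightarrow> ('a::ring_1, 'm::ab_group_add) based \<Rightarrow> ('a, 'n::ab_group_add) based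
     \<Rightarrow> ('m \<Rightarrow> 'n) set" where
  "simple_iso Z M N = {f \<in> mod_iso M N. \<exists>m b c A. (m, b) \<in> sbases M \<and> (m, c) \<in> sbases N \<and>
     expressed_by (mod_sum N (free_mod m)) A (map (map_prod f id) b) c \<and> torsion A \<in> Z}"

definition std_based :: "'a smat set set set \<Rightarrow> nat \<Rightarrow> ('a::ring_1, nat \<Rightarrow> 'a) based" where
  "std_based Z n = \<lparr>carrier = carrier (free_mod n), scl = scl (free_mod n),
     sbases = s_class Z (free_mod n) (0, map (\<lambda>i. (std_vec i, 0)) [0..<n])\<rparr>"

definition shift_vec :: "nat \<Rightarrow> (nat \<Rightarrow> 'a::zero) \<Rightarrow> nat \<Rightarrow> 'a" where
  "shift_vec m v = (\<lambda>i. if i < m then 0 else v (i - m))"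

definition sum_sbasis ::
  "('a::ring_1, 'm::ab_group_add) sbasis \<Rightarrow> ('a, 'n::ab_group_add) sbasis \<Rightarrow> ('a, 'm \<times> 'n) sbasis" where
  "sum_sbasis s t = (fst s + fst t,
     map (\<lambda>(x, v). ((x, 0), v)) (snd s) @ map (\<lambda>(y, w). ((0, y), shift_vec (fst s) w)) (snd t))"

definition based_sum ::
  "'a smat set set set \<Rightarrow> ('a::ring_1, 'm::ab_group_add) based \<Rightarrow> ('a, 'n::ab_group_add) based
     \<Rightarrow> ('a, 'm \<times> 'n) based" where
  "based_sum Z M N = \<lparr>carrier = carrier (mod_sum M N), scl = scl (mod_sum M N),
     sbases = (\<Union>s\<in>sbases M. \<Union>t\<in>sbases N. s_class Z (mod_sum M N) (sum_sbasis s t))\<rparr>"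

text \<open>The image of a based module under an injective homomorphism into \<open>N\<close>, with the transported bases.\<close>

definition based_image ::
  "('a::ring_1, 'n::ab_group_add, 'z) lmod_scheme \<Rightarrow> ('m \<Rightarrow> 'n) \<Rightarrow> ('a, 'm::ab_group_add) based
     \<Rightarrow> ('a, 'n) based" where
  "based_image N f M = \<lparr>carrier = f ` carrier M, scl = scl N, sbases = map_sbasis f ` sbases M\<rparr>"

text \<open>
  The dual is a left module via \<open>(a \<phi>)(x) = \<phi>(x) bar a\<close>. The dual of a free module of rank \<open>m\<close> is
  identified with that free module by means of the dual standard basis, i.e. a vector \<open>v\<close> acts as
  the functional \<open>y \<mapsto> \<Sum>k<m. y k * bar (v k)\<close>; in this way the dual basis of an \<open>s\<close>-basis is an
  \<open>s\<close>-basis of the dual.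
\<close>

definition s_pairing ::
  "('a::ring_1 \<Rightarrow> 'a) \<Rightarrow> nat \<Rightarrow> ('m \<Rightarrow> 'a) \<times> (nat \<Rightarrow> 'a) \<Rightarrow> 'm \<times> (nat \<Rightarrow> 'a) \<Rightarrow> 'a" where
  "s_pairing bar m c b = fst c (fst b) + (\<Sum>k<m. snd b k * bar (snd c k))"

definition dual_lmod ::
  "('a::ring_1 \<Rightarrow> 'a) \<Rightarrow> ('a, 'm::ab_group_add, 'z) lmod_scheme \<Rightarrow> ('a, 'm \<Rightarrow> 'a) lmod" where
  "dual_lmod bar M = \<lparr>carrier = Hom M ring_mod, scl = (\<lambda>a \<phi> x. \<phi> x * bar a)\<rparr>"

definition dual ::
  "('a::ring_1 \<Rightarrow> 'a) \<Rightarrow> ('a, 'm::ab_group_add) based \<Rightarrow> ('a, 'm \<Rightarrow> 'a) based" where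
  "dual bar M = \<lparr>carrier = carrier (dual_lmod bar M), scl = scl (dual_lmod bar M),
     sbases = {(m, c). s_basis (dual_lmod bar M) (m, c) \<and>
       (\<exists>b. (m, b) \<in> sbases M \<and> length b = length c \<and>
         (\<forall>i<length c. \<forall>j<length b. s_pairing bar m (c ! i) (b ! j) = (if i = j then 1 else 0)))}\<rparr>"

text \<open>
  A short exact sequence of based modules is based exact if the isomorphism from the direct sum of
  the outer terms defined by the inclusion and a splitting is simple (this does not depend on the
  splitting).
\<close>

definition based_exact ::
  "'a smat set set set \<Rightarrow> ('l \<Rightarrow> 'm) \<Rightarrow> ('m \<Rightarrow> 'n) \<Rightarrow> ('a::ring_1, 'l::ab_group_add) based
     \<Rightarrow> ('a, 'm::ab_group_add) based \<Rightarrow> ('a, 'n::ab_group_add) based \<Rightarrow> bool" where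
  "based_exact Z i p L M N \<longleftrightarrow>
     i \<in> mod_hom L M \<and> inj_on i (carrier L) \<and>
     p \<in> mod_hom M N \<and> p ` carrier M = carrier N \<and>
     i ` carrier L = {x \<in> carrier M. p x = 0} \<and>
     (\<exists>s\<in>mod_hom N M. (\<forall>y\<in>carrier N. p (s y) = y) \<and>
        (\<lambda>(x, y). i x + s y) \<in> simple_iso Z (based_sum Z L N) M)"

section \<open>Quadratic forms\<close>

text \<open>An element of \<open>Hom M (dual_lmod bar M)\<close> is a sesquilinear form, extended by zero in both arguments.\<close>

definition T_op :: "('a::ring_1 \<Rightarrow> 'a) \<Rightarrow> 'a \<Rightarrow> ('m \<Rightarrow> 'm \<Rightarrow> 'a) \<Rightarrow> 'm \<Rightarrow> 'm \<Rightarrow> 'a" where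
  "T_op bar \<epsilon> \<phi> = (\<lambda>x y. \<epsilon> * bar (\<phi> y x))"

definition Q_rel ::
  "('a::ring_1 \<Rightarrow> 'a) \<Rightarrow> 'a \<Rightarrow> ('a, 'm::ab_group_add, 'z) lmod_scheme
     \<Rightarrow> (('m \<Rightarrow> 'm \<Rightarrow> 'a) \<times> ('m \<Rightarrow> 'm \<Rightarrow> 'a)) set" where
  "Q_rel bar \<epsilon> M = {(\<phi>, \<phi>'). \<phi> \<in> Hom M (dual_lmod bar M) \<and> \<phi>' \<in> Hom M (dual_lmod bar M) \<and>
     (\<exists>\<theta>\<in>Hom M (dual_lmod bar M). \<phi>' - \<phi> = \<theta> - T_op bar \<epsilon> \<theta>)}"

definition Q_group ::
  "('a::ring_1 \<Rightarrow> 'a) \<Rightarrow> 'a \<Rightarrow> ('a, 'm::ab_group_add, 'z) lmod_scheme \<Rightarrow> ('m \<Rightarrow> 'm \<Rightarrow> 'a) set set" where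
  "Q_group bar \<epsilon> M = Hom M (dual_lmod bar M) // Q_rel bar \<epsilon> M"

definition Q_class ::
  "('a::ring_1 \<Rightarrow> 'a) \<Rightarrow> 'a \<Rightarrow> ('a, 'm::ab_group_add, 'z) lmod_scheme \<Rightarrow> ('m \<Rightarrow> 'm \<Rightarrow> 'a)
     \<Rightarrow> ('m \<Rightarrow> 'm \<Rightarrow> 'a) set" where
  "Q_class bar \<epsilon> M \<phi> = Q_rel bar \<epsilon> M `` {\<phi>}"

definition zero_ext ::
  "('a::ring_1, 'm::ab_group_add, 'z) lmod_scheme \<Rightarrow> ('m \<Rightarrow> 'm \<Rightarrow> 'a) \<Rightarrow> 'm \<Rightarrow> 'm \<Rightarrow> 'a" where
  "zero_ext M \<phi> = (\<lambda>x y. if x \<in> carrier M \<and> y \<in> carrier M then \<phi> x y else 0)"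

text \<open>\<open>\<psi> + \<epsilon>\<psi>*\<close>, which is independent of the representative of \<open>\<psi>\<close>.\<close>

definition Q_symm ::
  "('a::ring_1 \<Rightarrow> 'a) \<Rightarrow> 'a \<Rightarrow> ('m \<Rightarrow> 'm \<Rightarrow> 'a) set \<Rightarrow> 'm \<Rightarrow> 'm \<Rightarrow> 'a" where
  "Q_symm bar \<epsilon> \<psi> = the_elem ((\<lambda>\<phi>. \<phi> + T_op bar \<epsilon> \<phi>) ` \<psi>)"

text \<open>
  Operations on quadratic forms are computed on representatives; the union below is over equal
  classes.
\<close>

definition Q_pull ::
  "('a::ring_1 \<Rightarrow> 'a) \<Rightarrow> 'a \<Rightarrow> ('a, 'm::ab_group_add, 'z) lmod_scheme \<Rightarrow> ('m \<Rightarrow> 'n)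
     \<Rightarrow> ('n \<Rightarrow> 'n \<Rightarrow> 'a) set \<Rightarrow> ('m \<Rightarrow> 'm \<Rightarrow> 'a) set" where
  "Q_pull bar \<epsilon> M f \<psi> = (\<Union>\<phi>\<in>\<psi>. Q_class bar \<epsilon> M (zero_ext M (\<lambda>x y. \<phi> (f x) (f y))))"

abbreviation Q_restrict ::
  "('a::ring_1 \<Rightarrow> 'a) \<Rightarrow> 'a \<Rightarrow> ('a, 'm::ab_group_add, 'z) lmod_scheme
     \<Rightarrow> ('m \<Rightarrow> 'm \<Rightarrow> 'a) set \<Rightarrow> ('m \<Rightarrow> 'm \<Rightarrow> 'a) set" where
  "Q_restrict bar \<epsilon> L \<psi> \<equiv> Q_pull bar \<epsilon> L (\<lambda>x. x) \<psi>"

definition Q_sum ::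
  "('a::ring_1 \<Rightarrow> 'a) \<Rightarrow> 'a \<Rightarrow> ('a, 'm::ab_group_add, 'z) lmod_scheme
     \<Rightarrow> ('a, 'n::ab_group_add, 'w) lmod_scheme
     \<Rightarrow> ('m \<Rightarrow> 'm \<Rightarrow> 'a) set \<Rightarrow> ('n \<Rightarrow> 'n \<Rightarrow> 'a) set \<Rightarrow> ('m \<times> 'n \<Rightarrow> 'm \<times> 'n \<Rightarrow> 'a) set" where
  "Q_sum bar \<epsilon> M N \<psi> \<psi>' = (\<Union>\<phi>\<in>\<psi>. \<Union>\<phi>'\<in>\<psi>'. Q_class bar \<epsilon> (mod_sum M N)
     (zero_ext (mod_sum M N) (\<lambda>(x, x') (y, y'). \<phi> x y + \<phi>' x' y')))"

definition quadratic_form ::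
  "('a::ring_1 \<Rightarrow> 'a) \<Rightarrow> 'a \<Rightarrow> 'a smat set set set \<Rightarrow> ('a, 'm::ab_group_add) based
     \<Rightarrow> ('m \<Rightarrow> 'm \<Rightarrow> 'a) set \<Rightarrow> bool" where
  "quadratic_form bar \<epsilon> Z M \<psi> \<longleftrightarrow> based_module Z M \<and> \<psi> \<in> Q_group bar \<epsilon> M"

definition simple_form ::
  "('a::ring_1 \<Rightarrow> 'a) \<Rightarrow> 'a \<Rightarrow> 'a smat set set set \<Rightarrow> ('a, 'm::ab_group_add) based
     \<Rightarrow> ('m \<Rightarrow> 'm \<Rightarrow> 'a) set \<Rightarrow> bool" where
  "simple_form bar \<epsilon> Z M \<psi> \<longleftrightarrow> quadratic_form bar \<epsilon> Z M \<psi> \<and>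
     Q_symm bar \<epsilon> \<psi> \<in> simple_iso Z M (dual bar M)"

definition isometry ::
  "('a::ring_1 \<Rightarrow> 'a) \<Rightarrow> 'a \<Rightarrow> 'a smat set set set \<Rightarrow>
     ('a, 'm::ab_group_add) based \<Rightarrow> ('m \<Rightarrow> 'm \<Rightarrow> 'a) set \<Rightarrow>
     ('a, 'n::ab_group_add) based \<Rightarrow> ('n \<Rightarrow> 'n \<Rightarrow> 'a) set \<Rightarrow> ('m \<Rightarrow> 'n) set" where
  "isometry bar \<epsilon> Z M \<psi> N \<psi>' = {f \<in> simple_iso Z M N. Q_pull bar \<epsilon> M f \<psi>' = \<psi>}"

abbreviation Aut_form ::
  "('a::ring_1 \<Rightarrow> 'a) \<Rightarrow> 'a \<Rightarrow> 'a smat set set set \<Rightarrow>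
     ('a, 'm::ab_group_add) based \<Rightarrow> ('m \<Rightarrow> 'm \<Rightarrow> 'a) set \<Rightarrow> ('m \<Rightarrow> 'm) set" where
  "Aut_form bar \<epsilon> Z M \<psi> \<equiv> isometry bar \<epsilon> Z M \<psi> M \<psi>"

definition restricts_to_isometry ::
  "('a::ring_1 \<Rightarrow> 'a) \<Rightarrow> 'a \<Rightarrow> 'a smat set set set \<Rightarrow> ('m \<Rightarrow> 'm \<Rightarrow> 'a) set
     \<Rightarrow> ('m \<Rightarrow> 'm) \<Rightarrow> ('a, 'm::ab_group_add) based \<Rightarrow> bool" where
  "restricts_to_isometry bar \<epsilon> Z \<psi> \<alpha> W \<longleftrightarrow> \<alpha> ` carrier W = carrier W \<and>
     \<alpha> \<in> isometry bar \<epsilon> Z W (Q_restrict bar \<epsilon> W \<psi>) W (Q_restrict bar \<epsilon> W \<psi>)"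

definition hyp_mod ::
  "('a::ring_1 \<Rightarrow> 'a) \<Rightarrow> 'a smat set set set \<Rightarrow> ('a, 'm::ab_group_add) based
     \<Rightarrow> ('a, 'm \<times> ('m \<Rightarrow> 'a)) based" where
  "hyp_mod bar Z L = based_sum Z L (dual bar L)"

definition hyp_form ::
  "('a::ring_1 \<Rightarrow> 'a) \<Rightarrow> 'a \<Rightarrow> 'a smat set set set \<Rightarrow> ('a, 'm::ab_group_add) based
     \<Rightarrow> ('m \<times> ('m \<Rightarrow> 'a) \<Rightarrow> 'm \<times> ('m \<Rightarrow> 'a) \<Rightarrow> 'a) set" where
  "hyp_form bar \<epsilon> Z L = Q_class bar \<epsilon> (hyp_mod bar Z L)
     (zero_ext (hyp_mod bar Z L) (\<lambda>(x, \<phi>) (y, \<chi>). \<phi> y))"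

definition hyp_lag ::
  "('a::ring_1 \<Rightarrow> 'a) \<Rightarrow> 'a smat set set set \<Rightarrow> ('a, 'm::ab_group_add) based
     \<Rightarrow> ('a, 'm \<times> ('m \<Rightarrow> 'a)) based" where
  "hyp_lag bar Z L = based_image (hyp_mod bar Z L) (\<lambda>x. (x, 0)) L"

definition hyp_dual_lag ::
  "('a::ring_1 \<Rightarrow> 'a) \<Rightarrow> 'a smat set set set \<Rightarrow> ('a, 'm::ab_group_add) based
     \<Rightarrow> ('a, 'm \<times> ('m \<Rightarrow> 'a)) based" where
  "hyp_dual_lag bar Z L = based_image (hyp_mod bar Z L) (\<lambda>\<phi>. (0, \<phi>)) (dual bar L)"

definition perp ::
  "('a::ring_1 \<Rightarrow> 'a) \<Rightarrow> 'a \<Rightarrow> ('a, 'm::ab_group_add) based \<Rightarrow> ('m \<Rightarrow> 'm \<Rightarrow> 'a) set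
     \<Rightarrow> 'm set \<Rightarrow> 'm set" where
  "perp bar \<epsilon> M \<psi> S = {x \<in> carrier M. \<forall>y\<in>S. Q_symm bar \<epsilon> \<psi> x y = 0}"

definition lagrangian ::
  "('a::ring_1 \<Rightarrow> 'a) \<Rightarrow> 'a \<Rightarrow> 'a smat set set set \<Rightarrow> ('a, 'm::ab_group_add) based
     \<Rightarrow> ('m \<Rightarrow> 'm \<Rightarrow> 'a) set \<Rightarrow> ('a, 'm) based \<Rightarrow> bool" where
  "lagrangian bar \<epsilon> Z M \<psi> L \<longleftrightarrow> based_module Z L \<and> direct_summand L M \<and>
     carrier L = perp bar \<epsilon> M \<psi> (carrier L) \<and>
     Q_restrict bar \<epsilon> L \<psi> = Q_class bar \<epsilon> L 0"

definition simple_lagrangian ::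
  "('a::ring_1 \<Rightarrow> 'a) \<Rightarrow> 'a \<Rightarrow> 'a smat set set set \<Rightarrow> ('a, 'm::ab_group_add) based
     \<Rightarrow> ('m \<Rightarrow> 'm \<Rightarrow> 'a) set \<Rightarrow> ('a, 'm) based \<Rightarrow> bool" where
  "simple_lagrangian bar \<epsilon> Z M \<psi> L \<longleftrightarrow> lagrangian bar \<epsilon> Z M \<psi> L \<and>
     based_exact Z (\<lambda>x. x) (\<lambda>x y. if y \<in> carrier L then Q_symm bar \<epsilon> \<psi> x y else 0) L M (dual bar L)"

section \<open>Quasi-formations\<close>

record ('a, 'm) quasi =
  qmod :: "('a, 'm) based"
  qform :: "('m \<Rightarrow> 'm \<Rightarrow> 'a) set"
  qlag :: "('a, 'm) based"
  qsub :: "('a, 'm) based"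

definition quasi_formation ::
  "('a::ring_1 \<Rightarrow> 'a) \<Rightarrow> 'a \<Rightarrow> 'a smat set set set \<Rightarrow> ('a, 'm::ab_group_add) quasi \<Rightarrow> bool" where
  "quasi_formation bar \<epsilon> Z x \<longleftrightarrow>
     simple_form bar \<epsilon> Z (qmod x) (qform x) \<and>
     simple_lagrangian bar \<epsilon> Z (qmod x) (qform x) (qlag x) \<and>
     based_module Z (qsub x) \<and> direct_summand (qsub x) (qmod x) \<and>
     2 * mod_rank (qsub x) = mod_rank (qmod x)"

definition simple_formation ::
  "('a::ring_1 \<Rightarrow> 'a) \<Rightarrow> 'a \<Rightarrow> 'a smat set set set \<Rightarrow> ('a, 'm::ab_group_add) quasi \<Rightarrow> bool" where
  "simple_formation bar \<epsilon> Z x \<longleftrightarrow> quasi_formation bar \<epsilon> Z x \<and>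
     simple_lagrangian bar \<epsilon> Z (qmod x) (qform x) (qsub x)"

definition quasi_iso ::
  "('a::ring_1 \<Rightarrow> 'a) \<Rightarrow> 'a \<Rightarrow> 'a smat set set set \<Rightarrow> ('a, 'm::ab_group_add) quasi
     \<Rightarrow> ('a, 'n::ab_group_add) quasi \<Rightarrow> bool" where
  "quasi_iso bar \<epsilon> Z x y \<longleftrightarrow>
     (\<exists>f\<in>isometry bar \<epsilon> Z (qmod x) (qform x) (qmod y) (qform y).
        f ` carrier (qlag x) = carrier (qlag y) \<and> f \<in> simple_iso Z (qlag x) (qlag y) \<and>
        f ` carrier (qsub x) = carrier (qsub y) \<and> f \<in> simple_iso Z (qsub x) (qsub y))"

definition quasi_sum ::
  "('a::ring_1 \<Rightarrow> 'a) \<Rightarrow> 'a \<Rightarrow> 'a smat set set set \<Rightarrow> ('a, 'm::ab_group_add) quasi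
     \<Rightarrow> ('a, 'n::ab_group_add) quasi \<Rightarrow> ('a, 'm \<times> 'n) quasi" where
  "quasi_sum bar \<epsilon> Z x y =
     \<lparr>qmod = based_sum Z (qmod x) (qmod y),
      qform = Q_sum bar \<epsilon> (qmod x) (qmod y) (qform x) (qform y),
      qlag = based_sum Z (qlag x) (qlag y),
      qsub = based_sum Z (qsub x) (qsub y)\<rparr>"

definition trivial_formation ::
  "('a::ring_1 \<Rightarrow> 'a) \<Rightarrow> 'a \<Rightarrow> 'a smat set set set \<Rightarrow> ('a, 'm::ab_group_add) based
     \<Rightarrow> ('a, 'm \<times> ('m \<Rightarrow> 'a)) quasi" where
  "trivial_formation bar \<epsilon> Z P =
     \<lparr>qmod = hyp_mod bar Z P, qform = hyp_form bar \<epsilon> Z P,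
      qlag = hyp_lag bar Z P, qsub = hyp_dual_lag bar Z P\<rparr>"

section \<open>The monoid of stable classes of quasi-formations\<close>

text \<open>
  A stably finitely generated free module is isomorphic to a submodule of a finitely generated free
  module. Hence every quasi-formation is isomorphic to one whose underlying type is
  \<open>nat \<Rightarrow> 'a\<close>; these form a set of representatives, on which the equivalence relation defining the
  monoid is generated. Sums of representatives live on another type and are transported back along
  isomorphisms.
\<close>

definition stably_iso ::
  "('a::ring_1 \<Rightarrow> 'a) \<Rightarrow> 'a \<Rightarrow> 'a smat set set set \<Rightarrow> ('a, 'm::ab_group_add) quasi
     \<Rightarrow> ('a, 'n::ab_group_add) quasi \<Rightarrow> bool" where
  "stably_iso bar \<epsilon> Z x y \<longleftrightarrow>
     (\<exists>(P :: ('a, nat \<Rightarrow> 'a) based) (Q :: ('a, nat \<Rightarrow> 'a) based).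
        based_module Z P \<and> based_module Z Q \<and>
        quasi_iso bar \<epsilon> Z (quasi_sum bar \<epsilon> Z x (trivial_formation bar \<epsilon> Z P))
          (quasi_sum bar \<epsilon> Z y (trivial_formation bar \<epsilon> Z Q)))"

text \<open>
  The congruence on quasi-formations generated by stable isomorphism and the relation
  \<open>(M,\<psi>;K,L) + (M,\<psi>;L,V) \<sim> (M,\<psi>;K,V)\<close>.
\<close>

inductive l_equiv ::
  "('a::ring_1 \<Rightarrow> 'a) \<Rightarrow> 'a \<Rightarrow> 'a smat set set set \<Rightarrow> ('a, nat \<Rightarrow> 'a) quasi
     \<Rightarrow> ('a, nat \<Rightarrow> 'a) quasi \<Rightarrow> bool" for bar \<epsilon> Z where
  stable: "l_equiv bar \<epsilon> Z x y"
    if "quasi_formation bar \<epsilon> Z x" "quasi_formation bar \<epsilon> Z y" "stably_iso bar \<epsilon> Z x y"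
| compose: "l_equiv bar \<epsilon> Z x \<lparr>qmod = M, qform = \<psi>, qlag = K, qsub = V\<rparr>"
    if "simple_form bar \<epsilon> Z M \<psi>"
       "simple_lagrangian bar \<epsilon> Z M \<psi> K" "simple_lagrangian bar \<epsilon> Z M \<psi> L"
       "quasi_formation bar \<epsilon> Z \<lparr>qmod = M, qform = \<psi>, qlag = L, qsub = V\<rparr>"
       "quasi_formation bar \<epsilon> Z x"
       "quasi_iso bar \<epsilon> Z
          (quasi_sum bar \<epsilon> Z \<lparr>qmod = M, qform = \<psi>, qlag = K, qsub = L\<rparr>
             \<lparr>qmod = M, qform = \<psi>, qlag = L, qsub = V\<rparr>) x"
| add: "l_equiv bar \<epsilon> Z x' y'"
    if "l_equiv bar \<epsilon> Z x y" "quasi_formation bar \<epsilon> Z (z :: ('a, nat \<Rightarrow> 'a) quasi)"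
       "quasi_formation bar \<epsilon> Z x'" "quasi_formation bar \<epsilon> Z y'"
       "quasi_iso bar \<epsilon> Z (quasi_sum bar \<epsilon> Z x z) x'" "quasi_iso bar \<epsilon> Z (quasi_sum bar \<epsilon> Z y z) y'"
| sym: "l_equiv bar \<epsilon> Z y x" if "l_equiv bar \<epsilon> Z x y"
| trans: "l_equiv bar \<epsilon> Z x z" if "l_equiv bar \<epsilon> Z x y" "l_equiv bar \<epsilon> Z y z"

text \<open>The class of a quasi-formation on an arbitrary type.\<close>

definition l_class ::
  "('a::ring_1 \<Rightarrow> 'a) \<Rightarrow> 'a \<Rightarrow> 'a smat set set set \<Rightarrow> ('a, 'm::ab_group_add) quasi
     \<Rightarrow> ('a, nat \<Rightarrow> 'a) quasi set" where
  "l_class bar \<epsilon> Z x =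
     {y. \<exists>x'. quasi_formation bar \<epsilon> Z x' \<and> quasi_iso bar \<epsilon> Z x x' \<and> l_equiv bar \<epsilon> Z x' y}"

definition l_monoid ::
  "('a::ring_1 \<Rightarrow> 'a) \<Rightarrow> 'a \<Rightarrow> 'a smat set set set \<Rightarrow> ('a, nat \<Rightarrow> 'a) quasi set monoid" where
  "l_monoid bar \<epsilon> Z =
     \<lparr>carrier = {l_class bar \<epsilon> Z x | x :: ('a, nat \<Rightarrow> 'a) quasi. quasi_formation bar \<epsilon> Z x},
      mult = (\<lambda>A B. \<Union>x\<in>A. \<Union>y\<in>B. l_class bar \<epsilon> Z (quasi_sum bar \<epsilon> Z x y)),
      one = l_class bar \<epsilon> Z (trivial_formation bar \<epsilon> Z (std_based Z 0))\<rparr>"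

definition Ls_group ::
  "('a::ring_1 \<Rightarrow> 'a) \<Rightarrow> 'a \<Rightarrow> 'a smat set set set \<Rightarrow> ('a, nat \<Rightarrow> 'a) quasi set set" where
  "Ls_group bar \<epsilon> Z =
     {l_class bar \<epsilon> Z x | x :: ('a, nat \<Rightarrow> 'a) quasi. simple_formation bar \<epsilon> Z x}"

end

theory Submission
  imports Defs "HOL-Combinatorics.Permutations"
begin

text \<open>
  Write \<open>H\<close> for the hyperbolic form on \<open>F\<close>. Since \<open>\<alpha>\<close> is an isometry of \<open>H\<close> which maps \<open>F\<close> onto
  \<open>\<alpha>(F)\<close> and \<open>W\<close> onto itself by simple isomorphisms, it is an isomorphism of quasi-formations from
  \<open>(H; F, W)\<close> to \<open>(H; \<alpha>(F), W)\<close>. On the other hand \<open>\<alpha>(F)\<close> is again a simple Lagrangian, so that the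
  defining relation of the monoid for the Lagrangians \<open>F\<close> and \<open>\<alpha>(F)\<close> reads
  \<open>[H; F, \<alpha>(F)] + [H; \<alpha>(F), W] = [H; F, W]\<close>. Replacing the second summand by the isomorphic
  \<open>(H; F, W)\<close> gives the assertion.

  Turning this into a proof about classes of quasi-formations requires that isomorphism is an
  equivalence relation compatible with sums (\<open>quasi_iso_sym\<close>, \<open>quasi_iso_trans\<close>, \<open>quasi_iso_sum\<close>,
  \<open>quasi_iso_swap\<close>), that quasi-formations are closed under isomorphism and sums
  (\<open>quasi_formation_iso\<close>, \<open>quasi_formation_sum\<close>), and that each of them is isomorphic to one inside a
  free module (\<open>representative_exists\<close>). Then the sum of two classes is computed by any pair of
  representatives (\<open>l_monoid_mult_eqI\<close>).

  All of this rests on bookkeeping of torsion. Torsion is a homomorphism from the stable general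
  linear group to an abelian group which kills integral matrices (\<open>torsion_hom\<close>, \<open>torsion_of_int\<close>).
  Hence being related by a matrix with torsion in \<open>Z\<close> is an equivalence relation on bases which
  ignores their order (\<open>zrel_perm\<close>), and in which the torsion of an automorphism may be computed in any
  basis (\<open>zrel_conjugate\<close>). An isomorphism is simple exactly if it carries distinguished
  stable bases to equivalent ones (\<open>simple_isoD\<close>, \<open>simple_isoI\<close>); so matrices disappear from
  the arguments about composites, inverses, direct sums and rearrangements of simple
  isomorphisms. They return once more for duals, where a change of basis is replaced by its adjoint
  (\<open>dual_lists_zrel\<close>) and invariance of \<open>Z\<close> under adjoints enters.
\<close>

section \<open>The stable general linear group and torsion\<close>

text \<open>
  The set of indices contributing to an entry of a product depends on the row of that entry. Any
  initial segment which contains the block and the row index covers it, so that computations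
  with several factors can use one common finite range of summation.
\<close>

lemma smat_mult_eq_sum:
  assumes "A \<in> smat_block n" "n \<le> N" "i < N"
  shows "smat_mult A B i j = (\<Sum>k<N. A i k * B k j)"
  unfolding smat_mult_def
proof (rule Sum_any.expand_superset)
  show "{k. A i k * B k j \<noteq> 0} \<subseteq> {..<N}"
  proof (rule subsetI, rule ccontr)
    fix k assume k: "k \<in> {k. A i k * B k j \<noteq> 0}" "k \<notin> {..<N}"
    then have "A i k = smat_one i k" using assms by (auto simp: smat_block_def)
    with k assms show False by (auto simp: smat_one_def)
  qed
qed simp

lemma smat_block_mono: "A \<in> smat_block n \<Longrightarrow> n \<le> m \<Longrightarrow> A \<in> smat_block m"
  unfolding smat_block_def by auto

lemma smat_mult_block:
  assumes A: "A \<in> smat_block n" and B: "B \<in> smat_block n"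
  shows "smat_mult A B \<in> smat_block n"
  unfolding smat_block_def
proof safe
  fix i j
  have eq: "smat_mult A B i j = (\<Sum>k<max n (Suc (max i j)). A i k * B k j)"
    by (rule smat_mult_eq_sum[OF A]) auto
  {
    assume "n \<le> i"
    then have "A i k * B k j = (if k = i then B i j else 0)" for k
      using A by (auto simp: smat_block_def smat_one_def)
    then show "smat_mult A B i j = smat_one i j"
      using B \<open>n \<le> i\<close> eq by (simp add: smat_block_def max_def)
  }
  {
    assume "n \<le> j"
    then have "A i k * B k j = (if k = j then A i j else 0)" for k
      using B by (auto simp: smat_block_def smat_one_def)
    then show "smat_mult A B i j = smat_one i j"
      using A \<open>n \<le> j\<close> eq by (simp add: smat_block_def max_def)
  }
qed

lemma smat_mult_assoc:
  assumes A: "A \<in> smat_block n" and B: "B \<in> smat_block n"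
  shows "smat_mult (smat_mult A B) C = smat_mult A (smat_mult B C)"
proof (intro ext)
  fix i j
  define N where "N = max n (Suc i)"
  have N: "n \<le> N" "i < N" by (auto simp: N_def)
  have "smat_mult (smat_mult A B) C i j = (\<Sum>k<N. smat_mult A B i k * C k j)"
    by (rule smat_mult_eq_sum[OF smat_mult_block[OF A B] N])
  also have "\<dots> = (\<Sum>k<N. (\<Sum>l<N. A i l * B l k) * C k j)"
    by (simp add: smat_mult_eq_sum[OF A N])
  also have "\<dots> = (\<Sum>l<N. A i l * (\<Sum>k<N. B l k * C k j))"
    unfolding sum_distrib_left sum_distrib_right
    by (subst sum.swap) (simp add: mult.assoc)
  also have "\<dots> = (\<Sum>l<N. A i l * smat_mult B C l j)"
    using smat_mult_eq_sum[OF B N(1)] by simp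
  also have "\<dots> = smat_mult A (smat_mult B C) i j"
    by (rule smat_mult_eq_sum[OF A N, symmetric])
  finally show "smat_mult (smat_mult A B) C i j = smat_mult A (smat_mult B C) i j" .
qed

lemma smat_one_block [simp]: "smat_one \<in> smat_block n"
  by (simp add: smat_block_def)

lemma smat_mult_one:
  assumes "A \<in> smat_block n"
  shows "smat_mult smat_one A = A" "smat_mult A smat_one = A"
proof -
  show "smat_mult smat_one A = A"
  proof (intro ext)
    fix i j
    have "smat_mult smat_one A i j = (\<Sum>k<Suc i. smat_one i k * A k j)"
      by (rule smat_mult_eq_sum[of _ 0]) auto
    also have "\<dots> = (\<Sum>k<Suc i. if k = i then A i j else 0)"
      by (rule sum.cong) (auto simp: smat_one_def)
    finally show "smat_mult smat_one A i j = A i j" by simp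
  qed
  show "smat_mult A smat_one = A"
  proof (intro ext)
    fix i j
    have "smat_mult A smat_one i j = (\<Sum>k<max n (Suc (max i j)). A i k * smat_one k j)"
      by (rule smat_mult_eq_sum[OF assms]) auto
    also have "\<dots> = (\<Sum>k<max n (Suc (max i j)). if k = j then A i j else 0)"
      by (rule sum.cong) (auto simp: smat_one_def)
    also have "\<dots> = A i j" by (simp add: less_max_iff_disj less_Suc_eq_le)
    finally show "smat_mult A smat_one i j = A i j" .
  qed
qed

lemma GL_n_block: "A \<in> GL_n n \<Longrightarrow> A \<in> smat_block n"
  by (simp add: GL_n_def)

lemma GL_n_mono: "A \<in> GL_n n \<Longrightarrow> n \<le> m \<Longrightarrow> A \<in> GL_n m"
  unfolding GL_n_def using smat_block_mono by blast

lemma GL_n_one [simp]: "smat_one \<in> GL_n n"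
  unfolding GL_n_def using smat_mult_one(1)[OF smat_one_block] by auto

lemma GL_n_mult:
  assumes "A \<in> GL_n n" "B \<in> GL_n n"
  shows "smat_mult A B \<in> GL_n n"
proof -
  obtain A' where A: "A \<in> smat_block n" "A' \<in> smat_block n"
    "smat_mult A A' = smat_one" "smat_mult A' A = smat_one"
    using assms(1) by (auto simp: GL_n_def)
  obtain B' where B: "B \<in> smat_block n" "B' \<in> smat_block n"
    "smat_mult B B' = smat_one" "smat_mult B' B = smat_one"
    using assms(2) by (auto simp: GL_n_def)
  have "smat_mult (smat_mult A B) (smat_mult B' A') = smat_one"
    using A B by (metis smat_mult_assoc smat_mult_block smat_mult_one(1))
  moreover have "smat_mult (smat_mult B' A') (smat_mult A B) = smat_one"
    using A B by (metis smat_mult_assoc smat_mult_block smat_mult_one(1))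
  ultimately show ?thesis
    using A B smat_mult_block unfolding GL_n_def by blast
qed

lemma GL_n_inverse:
  assumes "A \<in> GL_n n"
  obtains B where "B \<in> GL_n n" "smat_mult A B = smat_one" "smat_mult B A = smat_one"
  using assms unfolding GL_n_def by blast

lemma carrier_GL: "A \<in> carrier GL \<longleftrightarrow> (\<exists>n. A \<in> GL_n n)"
  by (simp add: GL_def)

lemma GL_two:
  assumes "A \<in> carrier GL" "B \<in> carrier GL"
  obtains n where "A \<in> GL_n n" "B \<in> GL_n n"
proof -
  obtain k l where "A \<in> GL_n k" "B \<in> GL_n l" using assms by (auto simp: carrier_GL)
  then have "A \<in> GL_n (max k l)" "B \<in> GL_n (max k l)" by (auto intro: GL_n_mono)
  then show ?thesis using that by blast
qed

lemma group_GL: "group (GL :: 'a::ring_1 smat monoid)"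
proof (rule groupI)
  fix A B C :: "'a smat"
  assume A: "A \<in> carrier GL" and B: "B \<in> carrier GL"
  obtain n where n: "A \<in> GL_n n" "B \<in> GL_n n" using GL_two[OF A B] .
  show "A \<otimes>\<^bsub>GL\<^esub> B \<in> carrier GL"
    using GL_n_mult[OF n] by (auto simp: GL_def)
  show "A \<otimes>\<^bsub>GL\<^esub> B \<otimes>\<^bsub>GL\<^esub> C = A \<otimes>\<^bsub>GL\<^esub> (B \<otimes>\<^bsub>GL\<^esub> C)"
    using smat_mult_assoc[OF n[THEN GL_n_block]] by (simp add: GL_def)
next
  fix A :: "'a smat"
  assume A: "A \<in> carrier GL"
  then obtain n where n: "A \<in> GL_n n" by (auto simp: carrier_GL)
  show "\<one>\<^bsub>GL\<^esub> \<otimes>\<^bsub>GL\<^esub> A = A"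
    using smat_mult_one[OF GL_n_block[OF n]] by (simp add: GL_def)
  obtain B where "B \<in> GL_n n" "smat_mult B A = smat_one" using GL_n_inverse[OF n] .
  then show "\<exists>B\<in>carrier GL. B \<otimes>\<^bsub>GL\<^esub> A = \<one>\<^bsub>GL\<^esub>"
    by (auto simp: GL_def)
qed (auto simp: GL_def intro: GL_n_one)

lemma comm_group_K1: "comm_group (K1 :: 'a::ring_1 smat set monoid)"
  unfolding K1_def by (rule group.derived_quot_is_comm_group[OF group_GL])

lemma K1_class_hom: "K1_class \<in> hom GL (K1 :: 'a::ring_1 smat set monoid)"
proof -
  have "normal (derived GL (carrier GL)) (GL :: 'a smat monoid)"
    by (rule group.derived_self_is_normal[OF group_GL])
  then show ?thesis
    unfolding K1_class_def[abs_def] K1_def by (rule normal.r_coset_hom_Mod)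
qed

lemma carrier_K1: "carrier K1 = K1_class ` carrier GL"
  by (auto simp: K1_def K1_class_def FactGroup_def RCOSETS_def)

definition of_int_smat :: "int smat \<Rightarrow> 'a::ring_1 smat" where
  "of_int_smat A = (\<lambda>i j. of_int (A i j))"

lemma of_int_smat_block: "A \<in> smat_block n \<Longrightarrow> of_int_smat A \<in> smat_block n"
  by (auto simp: smat_block_def of_int_smat_def smat_one_def)

lemma of_int_smat_mult:
  assumes "A \<in> smat_block n"
  shows "of_int_smat (smat_mult A B) = smat_mult (of_int_smat A) (of_int_smat B)"
proof (intro ext)
  fix i j
  let ?N = "max n (Suc i)"
  have N: "n \<le> ?N" "i < ?N" by auto
  have "of_int_smat (smat_mult A B) i j = (\<Sum>k<?N. of_int_smat A i k * of_int_smat B k j)"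
    by (simp add: of_int_smat_def smat_mult_eq_sum[OF assms N])
  also have "\<dots> = smat_mult (of_int_smat A) (of_int_smat B) i j"
    by (rule smat_mult_eq_sum[OF of_int_smat_block[OF assms] N, symmetric])
  finally show "of_int_smat (smat_mult A B) i j = smat_mult (of_int_smat A) (of_int_smat B) i j" .
qed

lemma of_int_smat_one: "of_int_smat smat_one = smat_one"
  by (intro ext) (simp add: of_int_smat_def smat_one_def)

lemma of_int_smat_GL_n: "A \<in> GL_n n \<Longrightarrow> of_int_smat A \<in> GL_n n"
  unfolding GL_n_def using of_int_smat_block of_int_smat_mult of_int_smat_one
  by (smt (verit) mem_Collect_eq)

lemma of_int_smat_hom: "group_hom GL GL of_int_smat"
proof -
  have "of_int_smat \<in> hom GL GL"
  proof (rule homI)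
    fix A B :: "int smat"
    assume "A \<in> carrier GL" "B \<in> carrier GL"
    then obtain n where "A \<in> GL_n n" "B \<in> GL_n n" using GL_two by blast
    then show "of_int_smat (A \<otimes>\<^bsub>GL\<^esub> B) = of_int_smat A \<otimes>\<^bsub>GL\<^esub> of_int_smat B"
      using of_int_smat_mult[OF GL_n_block] by (simp add: GL_def)
  qed (auto simp: carrier_GL intro: of_int_smat_GL_n)
  then show ?thesis
    by (simp add: group_hom_def group_hom_axioms_def group_GL)
qed

lemma derived_GL_subgroup: "subgroup (derived GL (carrier GL)) (GL :: 'a::ring_1 smat monoid)"
  by (rule group.derived_is_subgroup[OF group_GL]) simp

lemma of_int_smat_derived:
  "of_int_smat ` derived GL (carrier GL) \<subseteq> derived GL (carrier (GL :: 'a::ring_1 smat monoid))"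
proof -
  interpret group_hom "GL :: int smat monoid" "GL :: 'a smat monoid" of_int_smat
    by (rule of_int_smat_hom)
  have "(of_int_smat ` derived GL (carrier GL) :: 'a smat set) = derived GL (of_int_smat ` carrier GL)"
    by (rule derived_img[symmetric]) simp
  also have "\<dots> \<subseteq> derived GL (carrier GL)"
    by (rule group.mono_derived[OF group_GL]) (use hom_closed in auto)
  finally show ?thesis .
qed

text \<open>
  The map on \<open>K1\<close> is defined as a union over all members of a class. These give the same class
  because entrywise inclusion of the integers, as a homomorphism of stable general linear groups, maps
  commutators to commutators.
\<close>

lemma K1_of_int_class:
  assumes B: "B \<in> carrier GL"
  shows "K1_of_int (K1_class B) = (K1_class (of_int_smat B) :: 'a::ring_1 smat set)"
proof -
  interpret Zg: group "GL :: int smat monoid" by (rule group_GL)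
  interpret Ag: group "GL :: 'a smat monoid" by (rule group_GL)
  interpret group_hom "GL :: int smat monoid" "GL :: 'a smat monoid" of_int_smat
    by (rule of_int_smat_hom)
  let ?D = "derived GL (carrier GL) :: 'a smat set"
  have sub: "subgroup ?D GL" by (rule derived_GL_subgroup)
  have eq: "K1_class (of_int_smat A) = (K1_class (of_int_smat B) :: 'a smat set)"
    if A: "A \<in> K1_class B" for A
  proof -
    obtain D where D: "D \<in> derived GL (carrier GL)" "A = D \<otimes>\<^bsub>GL\<^esub> B"
      using A unfolding K1_class_def r_coset_def by blast
    have Dc: "D \<in> carrier GL" using D(1) subgroup.subset[OF derived_GL_subgroup] by auto
    have "of_int_smat A = (of_int_smat D :: 'a smat) \<otimes>\<^bsub>GL\<^esub> of_int_smat B"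
      unfolding D(2) by (rule hom_mult[OF Dc B])
    moreover have "of_int_smat D \<in> ?D" using of_int_smat_derived D(1) by auto
    ultimately have "of_int_smat A \<in> ?D #>\<^bsub>GL\<^esub> of_int_smat B"
      by (auto simp: r_coset_def)
    then show ?thesis unfolding K1_class_def
      using Ag.repr_independence[OF _ _ sub] B by simp
  qed
  have "B \<in> K1_class B"
    unfolding K1_class_def by (rule Zg.rcos_self[OF B derived_GL_subgroup])
  moreover have "K1_of_int (K1_class B) = (\<Union>A\<in>K1_class B. K1_class (of_int_smat A) :: 'a smat set)"
    by (simp add: K1_of_int_def of_int_smat_def)
  ultimately show ?thesis using eq by blast
qed

abbreviation K1_int_image :: "'a::ring_1 smat set set" where
  "K1_int_image \<equiv> K1_of_int ` carrier K1"

lemma K1_int_image_eq: "K1_int_image = (K1_class \<circ> of_int_smat) ` carrier GL"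
  unfolding carrier_K1 image_image comp_def by (rule image_cong) (simp_all add: K1_of_int_class)

text \<open>
  This makes the reduced group \<open>K1_tilde\<close> a group: the image of \<open>K1\<close> of the integers is the image of a
  homomorphism into an abelian group.
\<close>

lemma K1_int_image_normal: "normal K1_int_image (K1 :: 'a::ring_1 smat set monoid)"
proof -
  have "K1_class \<circ> of_int_smat \<in> hom GL (K1 :: 'a smat set monoid)"
    using of_int_smat_hom K1_class_hom
    unfolding group_hom_def group_hom_axioms_def by (auto intro: hom_compose)
  then have "group_hom GL (K1 :: 'a smat set monoid) (K1_class \<circ> of_int_smat)"
    using comm_group_K1 group_GL
    by (auto simp: group_hom_def group_hom_axioms_def comm_group_def)
  then have "subgroup K1_int_image (K1 :: 'a smat set monoid)"
    unfolding K1_int_image_eq by (rule group_hom.img_is_subgroup)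
  then show ?thesis by (rule comm_group.subgroup_imp_normal[OF comm_group_K1])
qed

lemma torsion_hom: "torsion \<in> hom GL (K1_tilde :: 'a::ring_1 smat set set monoid)"
proof -
  have "(\<lambda>C. K1_int_image #>\<^bsub>K1\<^esub> C) \<in> hom K1 (K1_tilde :: 'a smat set set monoid)"
    unfolding K1_tilde_def by (rule normal.r_coset_hom_Mod[OF K1_int_image_normal])
  then have "(\<lambda>C. K1_int_image #>\<^bsub>K1\<^esub> C) \<circ> K1_class \<in> hom GL (K1_tilde :: 'a smat set set monoid)"
    using K1_class_hom by (rule hom_compose[rotated])
  then show ?thesis by (simp add: torsion_def[abs_def] comp_def)
qed

lemma comm_group_K1_tilde: "comm_group (K1_tilde :: 'a::ring_1 smat set set monoid)"
  unfolding K1_tilde_def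
  by (rule comm_group.abelian_FactGroup[OF comm_group_K1])
     (rule normal_imp_subgroup[OF K1_int_image_normal])

lemma group_hom_torsion: "group_hom GL (K1_tilde :: 'a::ring_1 smat set set monoid) torsion"
  using torsion_hom comm_group_K1_tilde group_GL
  by (auto simp: group_hom_def group_hom_axioms_def comm_group_def)

lemma torsion_of_int:
  assumes "B \<in> carrier GL"
  shows "torsion (of_int_smat B) = (\<one>\<^bsub>K1_tilde\<^esub> :: 'a::ring_1 smat set set)"
proof -
  have "K1_class (of_int_smat B) \<in> (K1_int_image :: 'a smat set set)"
    using assms unfolding K1_int_image_eq by auto
  then have "torsion (of_int_smat B) = (K1_int_image :: 'a smat set set)"
    unfolding torsion_def
    using subgroup.rcos_const[OF normal_imp_subgroup[OF K1_int_image_normal]] comm_group_K1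
    by (auto simp: comm_group_def)
  then show ?thesis by (simp add: K1_tilde_def)
qed

lemma torsion_mult:
  "A \<in> carrier GL \<Longrightarrow> B \<in> carrier GL \<Longrightarrow>
    torsion (smat_mult A B) = torsion A \<otimes>\<^bsub>K1_tilde\<^esub> torsion B"
  using group_hom.hom_mult[OF group_hom_torsion, of A B] by (simp add: GL_def)

lemma torsion_closed: "A \<in> carrier GL \<Longrightarrow> torsion A \<in> carrier K1_tilde"
  using group_hom.hom_closed[OF group_hom_torsion] .

lemma torsion_one: "torsion smat_one = \<one>\<^bsub>K1_tilde\<^esub>"
  using group_hom.hom_one[OF group_hom_torsion] by (simp add: GL_def)

section \<open>Modules, bases and the comparison of bases\<close>

lemma left_moduleD:
  assumes "left_module M"
  shows "0 \<in> carrier M"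
    and "x \<in> carrier M \<Longrightarrow> y \<in> carrier M \<Longrightarrow> x + y \<in> carrier M"
    and "x \<in> carrier M \<Longrightarrow> - x \<in> carrier M"
    and "x \<in> carrier M \<Longrightarrow> scl M a x \<in> carrier M"
    and "x \<in> carrier M \<Longrightarrow> y \<in> carrier M \<Longrightarrow> scl M a (x + y) = scl M a x + scl M a y"
    and "x \<in> carrier M \<Longrightarrow> scl M (a + b) x = scl M a x + scl M b x"
    and "x \<in> carrier M \<Longrightarrow> scl M (a * b) x = scl M a (scl M b x)"
    and "x \<in> carrier M \<Longrightarrow> scl M 1 x = x"
  using assms unfolding left_module_def by blast+

lemma scl_zero_left: "left_module M \<Longrightarrow> x \<in> carrier M \<Longrightarrow> scl M 0 x = 0"
  using left_moduleD(6)[of M x 0 0] by simp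

lemma scl_zero_right: "left_module M \<Longrightarrow> scl M a 0 = 0"
  using left_moduleD(5)[of M 0 0 a] left_moduleD(1)[of M] by simp

lemma left_module_diff:
  "left_module M \<Longrightarrow> x \<in> carrier M \<Longrightarrow> y \<in> carrier M \<Longrightarrow> x - y \<in> carrier M"
  using left_moduleD(2)[of M x "- y"] left_moduleD(3)[of M y] by simp

lemma left_module_sum:
  assumes "left_module M" "\<And>i. i \<in> I \<Longrightarrow> f i \<in> carrier M"
  shows "(\<Sum>i\<in>I. f i) \<in> carrier M"
  using assms(2)
proof (induction I rule: infinite_finite_induct)
  case (insert i I)
  then show ?case using left_moduleD(2)[OF assms(1)] by simp
qed (simp_all add: left_moduleD(1)[OF assms(1)])

lemma scl_sum:
  assumes "left_module M" "\<And>i. i \<in> I \<Longrightarrow> f i \<in> carrier M"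
  shows "scl M a (\<Sum>i\<in>I. f i) = (\<Sum>i\<in>I. scl M a (f i))"
  using assms(2)
proof (induction I rule: infinite_finite_induct)
  case (insert i I)
  then show ?case
    using left_moduleD(5)[OF assms(1)] left_module_sum[OF assms(1), of I f] by simp
qed (simp_all add: scl_zero_right[OF assms(1)])

lemma sum_scl:
  assumes "left_module M" "x \<in> carrier M"
  shows "scl M (\<Sum>i\<in>I. r i) x = (\<Sum>i\<in>I. scl M (r i) x)"
proof (induction I rule: infinite_finite_induct)
  case (insert i I)
  then show ?case using left_moduleD(6)[OF assms] by simp
qed (simp_all add: scl_zero_left[OF assms])

lemma mod_homD:
  assumes "f \<in> mod_hom M N"
  shows "x \<in> carrier M \<Longrightarrow> f x \<in> carrier N"
    and "x \<in> carrier M \<Longrightarrow> y \<in> carrier M \<Longrightarrow> f (x + y) = f x + f y"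
    and "x \<in> carrier M \<Longrightarrow> f (scl M a x) = scl N a (f x)"
  using assms unfolding mod_hom_def by auto

lemma mod_homI:
  assumes "\<And>x. x \<in> carrier M \<Longrightarrow> f x \<in> carrier N"
    and "\<And>x y. x \<in> carrier M \<Longrightarrow> y \<in> carrier M \<Longrightarrow> f (x + y) = f x + f y"
    and "\<And>a x. x \<in> carrier M \<Longrightarrow> f (scl M a x) = scl N a (f x)"
  shows "f \<in> mod_hom M N"
  using assms unfolding mod_hom_def by auto

lemma mod_hom_zero: "left_module M \<Longrightarrow> f \<in> mod_hom M N \<Longrightarrow> f 0 = 0"
  using mod_homD(2)[of f M N 0 0] left_moduleD(1)[of M] by simp

lemma mod_hom_sum:
  assumes "left_module M" "f \<in> mod_hom M N" "\<And>i. i \<in> I \<Longrightarrow> g i \<in> carrier M"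
  shows "f (\<Sum>i\<in>I. g i) = (\<Sum>i\<in>I. f (g i))"
  using assms(3)
proof (induction I rule: infinite_finite_induct)
  case (insert i I)
  then show ?case
    using mod_homD(2)[OF assms(2)] left_module_sum[OF assms(1), of I g] by simp
qed (simp_all add: mod_hom_zero[OF assms(1,2)])

lemma mod_hom_comp: "f \<in> mod_hom M N \<Longrightarrow> g \<in> mod_hom N P \<Longrightarrow> (\<lambda>x. g (f x)) \<in> mod_hom M P"
  by (rule mod_homI) (simp_all add: mod_homD)

lemma mod_isoD:
  assumes "f \<in> mod_iso M N"
  shows "f \<in> mod_hom M N" "bij_betw f (carrier M) (carrier N)"
  using assms unfolding mod_iso_def by auto

lemma mod_iso_comp:
  assumes "f \<in> mod_iso M N" "g \<in> mod_iso N P"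
  shows "(\<lambda>x. g (f x)) \<in> mod_iso M P"
  using assms mod_hom_comp[of f M N g P] bij_betw_trans[of f "carrier M" "carrier N" g "carrier P"]
  unfolding mod_iso_def by (auto simp: comp_def)

lemma mod_iso_inverse:
  assumes "left_module M" "f \<in> mod_iso M N"
  obtains g where "g \<in> mod_iso N M"
    "\<And>x. x \<in> carrier M \<Longrightarrow> g (f x) = x" "\<And>y. y \<in> carrier N \<Longrightarrow> f (g y) = y"
proof -
  define g where "g = inv_into (carrier M) f"
  note f = mod_isoD[OF assms(2)]
  have gf: "g (f x) = x" if "x \<in> carrier M" for x
    using f(2) that unfolding g_def by (simp add: bij_betw_def)
  have fg: "f (g y) = y" if "y \<in> carrier N" for y
    using f(2) that unfolding g_def by (auto simp: bij_betw_def f_inv_into_f)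
  have bij: "bij_betw g (carrier N) (carrier M)"
    unfolding g_def by (rule bij_betw_inv_into[OF f(2)])
  then have gM: "g y \<in> carrier M" if "y \<in> carrier N" for y
    using that by (auto simp: bij_betw_def)
  have "g \<in> mod_hom N M"
  proof (rule mod_homI)
    fix x y assume xy: "x \<in> carrier N" "y \<in> carrier N"
    have "f (g x + g y) = x + y"
      using mod_homD(2)[OF f(1)] gM fg xy by simp
    then show "g (x + y) = g x + g y"
      using gf[of "g x + g y"] left_moduleD(2)[OF assms(1)] gM xy by simp
  next
    fix a x assume x: "x \<in> carrier N"
    have "f (scl M a (g x)) = scl N a x"
      using mod_homD(3)[OF f(1)] gM fg x by simp
    then show "g (scl N a x) = scl M a (g x)"
      using gf[of "scl M a (g x)"] left_moduleD(4)[OF assms(1)] gM x by simp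
  qed (rule gM)
  then have "g \<in> mod_iso N M" using bij unfolding mod_iso_def by simp
  then show ?thesis using that gf fg by blast
qed

lemma mod_isoI_inverse:
  assumes "f \<in> mod_hom M N" "\<And>y. y \<in> carrier N \<Longrightarrow> g y \<in> carrier M"
    "\<And>x. x \<in> carrier M \<Longrightarrow> g (f x) = x" "\<And>y. y \<in> carrier N \<Longrightarrow> f (g y) = y"
  shows "f \<in> mod_iso M N"
  unfolding mod_iso_def using assms mod_homD(1)[OF assms(1)]
  by (auto intro!: bij_betw_byWitness[of _ g])

lemma left_module_free_mod [simp]: "left_module (free_mod n)"
  by (auto simp: left_module_def free_mod_def fun_eq_iff algebra_simps)

lemma left_module_mod_sum [simp]:
  "left_module M \<Longrightarrow> left_module N \<Longrightarrow> left_module (mod_sum M N)"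
  unfolding left_module_def mod_sum_def by (auto simp: zero_prod_def)

lemma carrier_mod_sum [simp]: "carrier (mod_sum M N) = carrier M \<times> carrier N"
  by (simp add: mod_sum_def)

lemma scl_mod_sum [simp]: "scl (mod_sum M N) a (x, y) = (scl M a x, scl N a y)"
  by (simp add: mod_sum_def)

lemma scl_free_mod [simp]: "scl (free_mod n) a v = (\<lambda>i. a * v i)"
  by (simp add: free_mod_def)

lemma carrier_free_mod: "v \<in> carrier (free_mod n) \<longleftrightarrow> (\<forall>i\<ge>n. v i = 0)"
  by (simp add: free_mod_def)

lemma zero_free_mod [simp]: "0 \<in> carrier (free_mod n)"
  by (simp add: carrier_free_mod)

definition lincomb ::
  "('a::ring_1, 'm::ab_group_add, 'z) lmod_scheme \<Rightarrow> (nat \<Rightarrow> 'a) \<Rightarrow> 'm list \<Rightarrow> 'm" where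
  "lincomb M v b = (\<Sum>i<length b. scl M (v i) (b ! i))"

lemma lincomb_closed:
  "left_module M \<Longrightarrow> set b \<subseteq> carrier M \<Longrightarrow> lincomb M v b \<in> carrier M"
  unfolding lincomb_def by (rule left_module_sum) (auto intro!: left_moduleD(4))

lemma lincomb_cong: "(\<And>i. i < length b \<Longrightarrow> v i = w i) \<Longrightarrow> lincomb M v b = lincomb M w b"
  unfolding lincomb_def by simp

lemma lincomb_add:
  assumes "left_module M" "set b \<subseteq> carrier M"
  shows "lincomb M (\<lambda>i. v i + w i) b = lincomb M v b + lincomb M w b"
proof -
  have b: "b ! i \<in> carrier M" if "i < length b" for i using that assms(2) nth_mem by blast
  show ?thesis unfolding lincomb_def sum.distrib[symmetric]
    by (rule sum.cong) (auto simp: b left_moduleD(6)[OF assms(1)])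
qed

lemma lincomb_scl:
  assumes "left_module M" "set b \<subseteq> carrier M"
  shows "lincomb M (\<lambda>i. a * v i) b = scl M a (lincomb M v b)"
proof -
  have b: "b ! i \<in> carrier M" if "i < length b" for i using that assms(2) nth_mem by blast
  show ?thesis unfolding lincomb_def
    by (subst scl_sum[OF assms(1)])
       (auto intro!: sum.cong simp: b left_moduleD(4)[OF assms(1)] left_moduleD(7)[OF assms(1)])
qed

lemma lincomb_zero:
  assumes "left_module M" "set b \<subseteq> carrier M"
  shows "lincomb M (\<lambda>i. 0) b = 0"
  unfolding lincomb_def
  by (rule sum.neutral) (use assms scl_zero_left[OF assms(1)] nth_mem in auto)

lemma lincomb_unit:
  assumes "left_module M" "set b \<subseteq> carrier M" "i < length b"
  shows "lincomb M (\<lambda>j. if j = i then 1 else 0) b = b ! i"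
proof -
  have b: "b ! i \<in> carrier M" if "i < length b" for i using that assms(2) nth_mem by blast
  have "lincomb M (\<lambda>j. if j = i then 1 else 0) b = (\<Sum>j<length b. if j = i then b ! i else 0)"
    unfolding lincomb_def
    by (rule sum.cong) (auto simp: b left_moduleD(8)[OF assms(1)] scl_zero_left[OF assms(1)])
  then show ?thesis using assms(3) by simp
qed

lemma lincomb_diff:
  assumes "left_module M" "set b \<subseteq> carrier M"
  shows "lincomb M (\<lambda>i. v i - w i) b = lincomb M v b - lincomb M w b"
proof -
  have "lincomb M (\<lambda>i. v i - w i) b + lincomb M w b = lincomb M v b"
    by (subst lincomb_add[OF assms, symmetric]) simp
  then show ?thesis by (simp add: algebra_simps)
qed

lemma lincomb_hom:
  assumes "left_module M" "f \<in> mod_hom M N" "set b \<subseteq> carrier M"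
  shows "f (lincomb M v b) = lincomb N v (map f b)"
proof -
  have b: "b ! i \<in> carrier M" if "i < length b" for i using that assms(3) nth_mem by blast
  show ?thesis unfolding lincomb_def
    by (subst mod_hom_sum[OF assms(1,2)])
       (auto intro!: sum.cong simp: b left_moduleD(4)[OF assms(1)] mod_homD(3)[OF assms(2)])
qed

lemma lincomb_append:
  "lincomb M v (b @ c) = lincomb M v b + lincomb M (\<lambda>i. v (length b + i)) c"
proof -
  have "lincomb M v (b @ c) = (\<Sum>i<length b. scl M (v i) ((b @ c) ! i)) +
      (\<Sum>i=length b..<length b + length c. scl M (v i) ((b @ c) ! i))"
    unfolding lincomb_def length_append lessThan_atLeast0 by (rule sum.atLeastLessThan_concat[symmetric]) auto
  moreover have "(\<Sum>i=length b..<length b + length c. scl M (v i) ((b @ c) ! i)) =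
      (\<Sum>i<length c. scl M (v (length b + i)) (c ! i))"
    using sum.shift_bounds_nat_ivl[of "\<lambda>i. scl M (v i) ((b @ c) ! i)" 0 "length b" "length c"]
    by (simp add: lessThan_atLeast0 add.commute nth_append)
  ultimately show ?thesis unfolding lincomb_def by (simp add: nth_append)
qed

text \<open>
  The definition of a basis speaks of a bijection from vectors vanishing beyond the length of the list.
  The description by generation and linear independence allows arbitrary coefficient functions, whose
  values beyond the length are immaterial; this avoids truncating them.
\<close>

lemma is_basis_iff:
  assumes M: "left_module M"
  shows "is_basis M b \<longleftrightarrow> set b \<subseteq> carrier M \<and> (\<forall>x\<in>carrier M. \<exists>v. x = lincomb M v b) \<and>
    (\<forall>v. lincomb M v b = 0 \<longrightarrow> (\<forall>i<length b. v i = 0))"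
proof
  assume b: "is_basis M b"
  then have sub: "set b \<subseteq> carrier M"
    and bij: "bij_betw (\<lambda>v. lincomb M v b) (carrier (free_mod (length b))) (carrier M)"
    by (auto simp: is_basis_def lincomb_def)
  have "v i = 0" if v: "lincomb M v b = 0" and i: "i < length b" for v i
  proof -
    define w where "w = (\<lambda>i. if i < length b then v i else 0)"
    have "lincomb M w b = lincomb M 0 b"
      using v lincomb_zero[OF M sub] lincomb_cong[of b w v M] by (simp add: w_def zero_fun_def)
    moreover have "w \<in> carrier (free_mod (length b))" "0 \<in> carrier (free_mod (length b))"
      by (auto simp: w_def carrier_free_mod)
    ultimately have "w = 0" using bij by (auto simp: bij_betw_def dest!: inj_onD)
    then have "w i = 0" by simp
    then show ?thesis using i by (simp add: w_def)
  qed
  with sub bij show "set b \<subseteq> carrier M \<and> (\<forall>x\<in>carrier M. \<exists>v. x = lincomb M v b) \<and>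
    (\<forall>v. lincomb M v b = 0 \<longrightarrow> (\<forall>i<length b. v i = 0))"
    unfolding bij_betw_def by blast
next
  assume *: "set b \<subseteq> carrier M \<and> (\<forall>x\<in>carrier M. \<exists>v. x = lincomb M v b) \<and>
    (\<forall>v. lincomb M v b = 0 \<longrightarrow> (\<forall>i<length b. v i = 0))"
  then have sub: "set b \<subseteq> carrier M" by blast
  have "inj_on (\<lambda>v. lincomb M v b) (carrier (free_mod (length b)))"
  proof (rule inj_onI)
    fix v w assume v: "v \<in> carrier (free_mod (length b))" "w \<in> carrier (free_mod (length b))"
      and "lincomb M v b = lincomb M w b"
    then have "lincomb M (\<lambda>i. v i - w i) b = 0" by (simp add: lincomb_diff[OF M sub])
    then have "v i - w i = 0" if "i < length b" for i using * that by blast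
    with v show "v = w"
      by (intro ext) (metis carrier_free_mod eq_iff_diff_eq_0 not_le)
  qed
  moreover have "(\<lambda>v. lincomb M v b) ` carrier (free_mod (length b)) = carrier M"
  proof
    show "(\<lambda>v. lincomb M v b) ` carrier (free_mod (length b)) \<subseteq> carrier M"
      using lincomb_closed[OF M sub] by auto
    show "carrier M \<subseteq> (\<lambda>v. lincomb M v b) ` carrier (free_mod (length b))"
    proof
      fix x assume "x \<in> carrier M"
      then obtain v where v: "x = lincomb M v b" using * by blast
      have "x = lincomb M (\<lambda>i. if i < length b then v i else 0) b"
        unfolding v by (rule lincomb_cong) simp
      moreover have "(\<lambda>i. if i < length b then v i else 0) \<in> carrier (free_mod (length b))"
        by (auto simp: carrier_free_mod)
      ultimately show "x \<in> (\<lambda>v. lincomb M v b) ` carrier (free_mod (length b))" by blast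
    qed
  qed
  ultimately show "is_basis M b" using sub
    unfolding is_basis_def bij_betw_def lincomb_def by blast
qed

lemma basis_subset: "is_basis M b \<Longrightarrow> set b \<subseteq> carrier M"
  by (simp add: is_basis_def)

lemma basis_span:
  "left_module M \<Longrightarrow> is_basis M b \<Longrightarrow> x \<in> carrier M \<Longrightarrow> \<exists>v. x = lincomb M v b"
  by (simp add: is_basis_iff)

lemma basis_coord_unique:
  assumes "left_module M" "is_basis M b" "lincomb M v b = lincomb M w b" "i < length b"
  shows "v i = w i"
proof -
  have "lincomb M (\<lambda>i. v i - w i) b = 0"
    using assms basis_subset[OF assms(2)] by (simp add: lincomb_diff)
  then show ?thesis using assms(1,2,4) by (auto simp: is_basis_iff)
qed

lemma basis_map:
  assumes M: "left_module M" and N: "left_module N" and f: "f \<in> mod_iso M N" and b: "is_basis M b"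
  shows "is_basis N (map f b)"
proof -
  note fh = mod_isoD(1)[OF f]
  have sub: "set b \<subseteq> carrier M" by (rule basis_subset[OF b])
  obtain g where g: "g \<in> mod_iso N M" "\<And>x. x \<in> carrier M \<Longrightarrow> g (f x) = x"
    "\<And>y. y \<in> carrier N \<Longrightarrow> f (g y) = y"
    using mod_iso_inverse[OF M f] by blast
  have "\<exists>v. y = lincomb N v (map f b)" if y: "y \<in> carrier N" for y
  proof -
    obtain v where "g y = lincomb M v b"
      using basis_span[OF M b] mod_homD(1)[OF mod_isoD(1)[OF g(1)]] y by blast
    then show ?thesis using lincomb_hom[OF M fh sub] g(3)[OF y] by metis
  qed
  moreover have "v i = 0" if v: "lincomb N v (map f b) = 0" and i: "i < length b" for v i
  proof -
    have "f (lincomb M v b) = 0" using v lincomb_hom[OF M fh sub] by simp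
    then have "lincomb M v b = 0"
      using g(2)[OF lincomb_closed[OF M sub]] mod_hom_zero[OF N mod_isoD(1)[OF g(1)]] by metis
    then show ?thesis using b i by (simp add: is_basis_iff[OF M])
  qed
  ultimately show ?thesis
    using sub mod_homD(1)[OF fh] by (auto simp: is_basis_iff[OF N])
qed

lemma inl_mod_hom: "left_module N \<Longrightarrow> (\<lambda>x. (x, 0)) \<in> mod_hom M (mod_sum M N)"
  by (rule mod_homI) (auto simp: left_moduleD(1) scl_zero_right)

lemma inr_mod_hom: "left_module M \<Longrightarrow> (\<lambda>y. (0, y)) \<in> mod_hom N (mod_sum M N)"
  by (rule mod_homI) (auto simp: left_moduleD(1) scl_zero_right)

lemma basis_mod_sum:
  assumes M: "left_module M" and N: "left_module N" and b: "is_basis M b" and c: "is_basis N c"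
  shows "is_basis (mod_sum M N) (map (\<lambda>x. (x, 0)) b @ map (\<lambda>y. (0, y)) c)"
proof -
  have sub: "set b \<subseteq> carrier M" "set c \<subseteq> carrier N" using b c basis_subset by auto
  have eq: "lincomb (mod_sum M N) v (map (\<lambda>x. (x, 0)) b @ map (\<lambda>y. (0, y)) c) =
      (lincomb M v b, lincomb N (\<lambda>i. v (length b + i)) c)" for v
    using lincomb_hom[OF M inl_mod_hom[OF N] sub(1), of v, symmetric]
      lincomb_hom[OF N inr_mod_hom[OF M] sub(2), of "\<lambda>i. v (length b + i)", symmetric]
    by (simp add: lincomb_append)
  have "\<exists>v. z = lincomb (mod_sum M N) v (map (\<lambda>x. (x, 0)) b @ map (\<lambda>y. (0, y)) c)"
    if z: "z \<in> carrier (mod_sum M N)" for z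
  proof -
    obtain v w where vw: "fst z = lincomb M v b" "snd z = lincomb N w c"
      using basis_span[OF M b, of "fst z"] basis_span[OF N c, of "snd z"] z by auto
    define u where "u = (\<lambda>i. if i < length b then v i else w (i - length b))"
    have "lincomb M u b = lincomb M v b" by (rule lincomb_cong) (simp add: u_def)
    moreover have "lincomb N (\<lambda>i. u (length b + i)) c = lincomb N w c"
      by (rule lincomb_cong) (simp add: u_def)
    ultimately show ?thesis unfolding eq using vw by (metis prod.collapse)
  qed
  moreover have "v i = 0"
    if v: "lincomb (mod_sum M N) v (map (\<lambda>x. (x, 0)) b @ map (\<lambda>y. (0, y)) c) = 0"
      and i: "i < length b + length c" for v i
  proof -
    have "lincomb M v b = 0" "lincomb N (\<lambda>i. v (length b + i)) c = 0"
      using v by (simp_all add: eq zero_prod_def)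
    then have "\<forall>i<length b. v i = 0" "\<forall>i<length c. v (length b + i) = 0"
      using b c M N by (auto simp: is_basis_iff)
    then show ?thesis using i by (metis add_diff_inverse_nat nat_add_left_cancel_less)
  qed
  ultimately show ?thesis using sub M N
    by (auto simp: is_basis_iff left_moduleD(1))
qed

abbreviation std_basis :: "nat \<Rightarrow> (nat \<Rightarrow> 'a::ring_1) list" where
  "std_basis n \<equiv> map std_vec [0..<n]"

lemma sum_fun_apply: "(\<Sum>i\<in>I. f i) x = (\<Sum>i\<in>I. f i x)"
  by (induction I rule: infinite_finite_induct) auto

lemma lincomb_std_basis: "lincomb (free_mod m) v (std_basis n) = (\<lambda>i. if i < n then v i else 0)"
proof
  fix i
  have "lincomb (free_mod m) v (std_basis n) i = (\<Sum>j<n. v j * std_vec j i)"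
    unfolding lincomb_def by (simp add: sum_fun_apply)
  also have "\<dots> = (\<Sum>j<n. if j = i then v i else 0)"
    by (rule sum.cong) (auto simp: std_vec_def)
  finally show "lincomb (free_mod m) v (std_basis n) i = (if i < n then v i else 0)"
    by simp
qed

lemma std_basis_is_basis: "is_basis (free_mod n) (std_basis n)"
proof -
  have "\<exists>w. v = lincomb (free_mod n) w (std_basis n)" if "v \<in> carrier (free_mod n)" for v :: "nat \<Rightarrow> 'a"
    using that by (intro exI[of _ v]) (auto simp: lincomb_std_basis carrier_free_mod)
  moreover have "set (std_basis n) \<subseteq> carrier (free_mod n :: ('a, nat \<Rightarrow> 'a) lmod)"
    by (auto simp: carrier_free_mod std_vec_def)
  ultimately show ?thesis
    unfolding is_basis_iff[OF left_module_free_mod]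
    by (auto simp: lincomb_std_basis fun_eq_iff split: if_splits)
qed

lemma basis_iso:
  assumes "left_module M" "is_basis M b"
  shows "(\<lambda>v. lincomb M v b) \<in> mod_iso (free_mod (length b)) M"
proof -
  note sub = basis_subset[OF assms(2)]
  have "(\<lambda>v. lincomb M v b) \<in> mod_hom (free_mod (length b)) M"
    by (rule mod_homI)
       (auto simp: lincomb_closed[OF assms(1) sub] lincomb_add[OF assms(1) sub, symmetric]
         lincomb_scl[OF assms(1) sub, symmetric] plus_fun_def)
  then show ?thesis
    using assms(2) unfolding mod_iso_def is_basis_def lincomb_def by simp
qed

text \<open>
  Two bases give an isomorphism of the corresponding standard free modules, to which weak finiteness applies.
\<close>

lemma basis_length_unique:
  fixes M :: "('a::ring_1, 'm::ab_group_add, 'z) lmod_scheme"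
  assumes "weakly_finite TYPE('a)" "left_module M" "is_basis M b" "is_basis M c"
  shows "length b = length c"
proof -
  obtain g where "g \<in> mod_iso M (free_mod (length c) :: ('a, nat \<Rightarrow> 'a) lmod)"
    using mod_iso_inverse[OF left_module_free_mod basis_iso[OF assms(2,4)]] by blast
  then have "(\<lambda>v. g (lincomb M v b)) \<in> mod_iso (free_mod (length b)) (free_mod (length c))"
    using mod_iso_comp[OF basis_iso[OF assms(2,3)]] by blast
  then show ?thesis using assms(1) unfolding weakly_finite_def by blast
qed

lemma expressed_by_lincomb:
  "expressed_by M A b c \<longleftrightarrow> length b = length c \<and> A \<in> GL_n (length c) \<and>
     (\<forall>i<length b. b ! i = lincomb M (A i) c)"
  unfolding expressed_by_def lincomb_def by (rule refl)

text \<open>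
  Substituting one coordinate expression into another multiplies the matrices; with coordinates
  written as rows the matrix of the outer expression is the left factor.
\<close>

lemma lincomb_compose:
  assumes M: "left_module M" and d: "set d \<subseteq> carrier M" and len: "length c = n" "length d = n"
    and A: "A \<in> smat_block n" and i: "i < n"
    and c: "\<And>j. j < n \<Longrightarrow> c ! j = lincomb M (B j) d"
  shows "lincomb M (A i) c = lincomb M (smat_mult A B i) d"
proof -
  have dk: "d ! k \<in> carrier M" if "k < n" for k
    using nth_mem[of k d] that d len by auto
  have "lincomb M (A i) c = (\<Sum>j<n. scl M (A i j) (\<Sum>k<n. scl M (B j k) (d ! k)))"
    unfolding lincomb_def len(1) by (rule sum.cong) (auto simp: c lincomb_def len)
  also have "\<dots> = (\<Sum>j<n. \<Sum>k<n. scl M (A i j * B j k) (d ! k))"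
    by (rule sum.cong[OF refl], subst scl_sum[OF M])
       (auto simp: dk left_moduleD(4)[OF M] left_moduleD(7)[OF M])
  also have "\<dots> = (\<Sum>k<n. \<Sum>j<n. scl M (A i j * B j k) (d ! k))" by (rule sum.swap)
  also have "\<dots> = (\<Sum>k<n. scl M (smat_mult A B i k) (d ! k))"
    by (rule sum.cong[OF refl], subst smat_mult_eq_sum[OF A order_refl i], subst sum_scl[OF M])
       (auto simp: dk)
  finally show ?thesis unfolding lincomb_def len .
qed

lemma expressed_byD:
  assumes "expressed_by M A b c"
  shows "length b = length c" "A \<in> GL_n (length c)"
    and "i < length b \<Longrightarrow> b ! i = lincomb M (A i) c"
  using assms unfolding expressed_by_lincomb by blast+

lemma expressed_by_trans:
  assumes M: "left_module M" and d: "set d \<subseteq> carrier M"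
    and A: "expressed_by M A b c" and B: "expressed_by M B c d"
  shows "expressed_by M (smat_mult A B) b d"
  unfolding expressed_by_lincomb
proof (intro conjI allI impI)
  note A = expressed_byD[OF A] and B = expressed_byD[OF B]
  show "length b = length d" using A(1) B(1) by simp
  show "smat_mult A B \<in> GL_n (length d)" using GL_n_mult A(2) B(1,2) by metis
  fix i assume i: "i < length b"
  have Ab: "A \<in> smat_block (length d)" using GL_n_block A(2) B(1) by metis
  have "lincomb M (A i) c = lincomb M (smat_mult A B i) d"
    by (rule lincomb_compose[OF M d B(1) refl Ab]) (use i A(1) B in simp_all)
  then show "b ! i = lincomb M (smat_mult A B i) d"
    using A(3)[OF i] by simp
qed

lemma expressed_by_refl:
  fixes M :: "('a::ring_1, 'm::ab_group_add, 'z) lmod_scheme"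
  assumes "left_module M" "set b \<subseteq> carrier M"
  shows "expressed_by M smat_one b b"
proof -
  have "b ! i = lincomb M (smat_one i) b" if "i < length b" for i
  proof -
    have "smat_one i = (\<lambda>j. if j = i then 1 else (0::'a))" by (auto simp: smat_one_def)
    then show ?thesis using lincomb_unit[OF assms that] by simp
  qed
  then show ?thesis by (simp add: expressed_by_lincomb)
qed

lemma expressed_by_sym:
  assumes M: "left_module M" and c: "set c \<subseteq> carrier M" and A: "expressed_by M A b c"
    and B: "B \<in> GL_n (length c)" "smat_mult B A = smat_one"
  shows "expressed_by M B c b"
  unfolding expressed_by_lincomb
proof (intro conjI allI impI)
  note A = expressed_byD[OF A]
  show "length c = length b" "B \<in> GL_n (length b)" using A(1) B by simp_all
  fix i assume i: "i < length c"
  have "lincomb M (B i) b = lincomb M (smat_mult B A i) c"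
    by (rule lincomb_compose[OF M c A(1) refl GL_n_block[OF B(1)] i]) (use A in simp)
  then show "c ! i = lincomb M (B i) b"
    using expressed_byD(3)[OF expressed_by_refl[OF M c] i] B by simp
qed

text \<open>
  The two coordinate matrices obtained from generation are inverse to each other by uniqueness of
  coordinates. Outside the square block they have to be completed by the identity matrix.
\<close>

lemma basis_expressed_by:
  assumes M: "left_module M" and b: "is_basis M b" and c: "is_basis M c" and len: "length b = length c"
  obtains A where "expressed_by M A b c"
proof -
  have coords: "\<exists>A\<in>smat_block (length c). \<forall>i<length c. b ! i = lincomb M (A i) c"
    if b: "is_basis M b" and c: "is_basis M c" and len: "length b = length c" for b c
  proof -
    have "\<forall>i. \<exists>v. i < length c \<longrightarrow> b ! i = lincomb M v c"
      using basis_span[OF M c] basis_subset[OF b] len by (metis nth_mem subsetD)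
    then obtain A where A: "\<And>i. i < length c \<Longrightarrow> b ! i = lincomb M (A i) c" by metis
    define A' where "A' = (\<lambda>i j. if i < length c \<and> j < length c then A i j else smat_one i j)"
    have "A' \<in> smat_block (length c)" by (auto simp: A'_def smat_block_def)
    moreover have "b ! i = lincomb M (A' i) c" if "i < length c" for i
      unfolding A[OF that] by (rule lincomb_cong) (use that in \<open>simp add: A'_def\<close>)
    ultimately show ?thesis by blast
  qed
  have inv: "smat_mult A B = smat_one"
    if b: "is_basis M b" and len: "length b = n" "length c = n"
      and A: "A \<in> smat_block n" "\<forall>i<n. b ! i = lincomb M (A i) c"
      and B: "B \<in> smat_block n" "\<forall>i<n. c ! i = lincomb M (B i) b" for A B b c and n
  proof (intro ext)
    fix i j
    show "smat_mult A B i j = smat_one i j"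
    proof (cases "i < n \<and> j < n")
      case True
      have "lincomb M (smat_mult A B i) b = b ! i"
        using lincomb_compose[OF M basis_subset[OF b] len(2,1) A(1), of i B] A B True by simp
      also have "\<dots> = lincomb M (smat_one i) b"
        using expressed_byD(3)[OF expressed_by_refl[OF M basis_subset[OF b]]] True len by simp
      finally show ?thesis using basis_coord_unique[OF M b] True len by blast
    next
      case False
      then show ?thesis using smat_mult_block[OF A(1) B(1)] by (auto simp: smat_block_def)
    qed
  qed
  obtain A where A: "A \<in> smat_block (length c)" "\<forall>i<length c. b ! i = lincomb M (A i) c"
    using coords[OF b c len] by blast
  obtain B where B: "B \<in> smat_block (length c)" "\<forall>i<length c. c ! i = lincomb M (B i) b"
    using coords[OF c b] len by auto
  have "smat_mult A B = smat_one" "smat_mult B A = smat_one"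
    using inv[OF b len refl A B] inv[OF c refl len B A] by auto
  then have "expressed_by M A b c"
    unfolding expressed_by_lincomb GL_n_def using A B len by auto
  then show ?thesis using that by blast
qed

definition perm_smat :: "(nat \<Rightarrow> nat) \<Rightarrow> 'a::ring_1 smat" where
  "perm_smat p = (\<lambda>i j. if j = p i then 1 else 0)"

lemma perm_smat_block:
  assumes p: "p permutes {..<n}"
  shows "perm_smat p \<in> (smat_block n :: 'a::ring_1 smat set)"
proof -
  have "perm_smat p i j = (smat_one i j :: 'a)" if "n \<le> i \<or> n \<le> j" for i j
  proof (cases "n \<le> i")
    case True
    then show ?thesis using permutes_not_in[OF p, of i] by (auto simp: perm_smat_def smat_one_def)
  next
    case False
    then have "p i < n" using permutes_in_image[OF p, of i] by simp
    then show ?thesis using that False by (simp add: perm_smat_def smat_one_def)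
  qed
  then show ?thesis by (simp add: smat_block_def)
qed

lemma perm_smat_mult:
  assumes "p permutes {..<n}"
  shows "smat_mult (perm_smat p) (perm_smat r) = perm_smat (r \<circ> p)"
proof (intro ext)
  fix i j
  let ?N = "max n (Suc i)"
  have pi: "p i < ?N"
    using permutes_in_image[OF assms, of i] permutes_not_in[OF assms, of i] by (cases "i < n") auto
  have "smat_mult (perm_smat p) (perm_smat r) i j = (\<Sum>k<?N. perm_smat p i k * perm_smat r k j)"
    by (rule smat_mult_eq_sum[OF perm_smat_block[OF assms]]) auto
  also have "\<dots> = (\<Sum>k<?N. if k = p i then perm_smat r (p i) j else 0)"
    by (rule sum.cong) (auto simp: perm_smat_def)
  finally show "smat_mult (perm_smat p) (perm_smat r) i j = perm_smat (r \<circ> p) i j"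
    using pi by (simp add: perm_smat_def)
qed

lemma perm_smat_GL_n:
  assumes "p permutes {..<n}"
  shows "perm_smat p \<in> (GL_n n :: 'a::ring_1 smat set)"
proof -
  note p' = permutes_inv[OF assms]
  have one: "perm_smat id = (smat_one :: 'a smat)"
    by (auto simp: perm_smat_def smat_one_def fun_eq_iff)
  have "smat_mult (perm_smat p) (perm_smat (inv_into UNIV p)) = (smat_one :: 'a smat)"
    "smat_mult (perm_smat (inv_into UNIV p)) (perm_smat p) = (smat_one :: 'a smat)"
    using permutes_inv_o[OF assms] one by (simp_all add: perm_smat_mult[OF assms] perm_smat_mult[OF p'])
  then show ?thesis unfolding GL_n_def
    using perm_smat_block[OF assms] perm_smat_block[OF p'] by blast
qed

text \<open>
  Permutation matrices are integral, hence they vanish in the reduced group.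
\<close>

lemma torsion_perm_smat:
  assumes "p permutes {..<n}"
  shows "torsion (perm_smat p) = (\<one>\<^bsub>K1_tilde\<^esub> :: 'a::ring_1 smat set set)"
proof -
  have "perm_smat p = (of_int_smat (perm_smat p) :: 'a smat)"
    by (simp add: perm_smat_def of_int_smat_def fun_eq_iff)
  moreover have "perm_smat p \<in> carrier (GL :: int smat monoid)"
    using perm_smat_GL_n[OF assms] by (auto simp: carrier_GL)
  ultimately show ?thesis using torsion_of_int[of "perm_smat p"] by simp
qed

locale torsion_subgroup =
  fixes Z :: "'a::ring_1 smat set set set"
  assumes Z_subgroup: "subgroup Z K1_tilde"
begin

text \<open>
  The comparison of bases is formulated for arbitrary families of vectors: in this way it is
  preserved by all homomorphisms and by appending further vectors.
\<close>

definition zrel :: "('a, 'm::ab_group_add, 'z) lmod_scheme \<Rightarrow> 'm list \<Rightarrow> 'm list \<Rightarrow> bool" where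
  "zrel M b c \<longleftrightarrow> (\<exists>A. expressed_by M A b c \<and> torsion A \<in> Z)"

lemma zrel_scl_cong: "scl M = scl N \<Longrightarrow> zrel M b c \<longleftrightarrow> zrel N b c"
  by (simp add: zrel_def expressed_by_def)

lemma zrel_refl: "left_module M \<Longrightarrow> set b \<subseteq> carrier M \<Longrightarrow> zrel M b b"
  unfolding zrel_def using expressed_by_refl torsion_one subgroup.one_closed[OF Z_subgroup] by metis

lemma zrel_trans:
  assumes M: "left_module M" and d: "set d \<subseteq> carrier M" and "zrel M b c" "zrel M c d"
  shows "zrel M b d"
proof -
  obtain A B where AB: "expressed_by M A b c" "torsion A \<in> Z" "expressed_by M B c d" "torsion B \<in> Z"
    using assms unfolding zrel_def by auto
  then have "A \<in> carrier GL" "B \<in> carrier GL" by (auto simp: expressed_by_def carrier_GL)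
  then have "torsion (smat_mult A B) \<in> Z"
    using AB subgroup.m_closed[OF Z_subgroup] by (simp add: torsion_mult)
  then show ?thesis unfolding zrel_def using expressed_by_trans[OF M d AB(1,3)] by blast
qed

lemma zrel_sym:
  assumes M: "left_module M" and c: "set c \<subseteq> carrier M" and "zrel M b c"
  shows "zrel M c b"
proof -
  interpret K: comm_group "K1_tilde :: 'a smat set set monoid" by (rule comm_group_K1_tilde)
  obtain A where A: "expressed_by M A b c" "torsion A \<in> Z"
    using assms unfolding zrel_def by auto
  then obtain B where B: "B \<in> GL_n (length c)" "smat_mult A B = smat_one" "smat_mult B A = smat_one"
    using GL_n_inverse by (metis expressed_by_def)
  have GL: "A \<in> carrier GL" "B \<in> carrier GL"
    using A B by (auto simp: expressed_by_def carrier_GL)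
  have "torsion B \<otimes>\<^bsub>K1_tilde\<^esub> torsion A = \<one>\<^bsub>K1_tilde\<^esub>"
    using B GL by (simp add: torsion_mult[symmetric] torsion_one)
  then have "torsion B = inv\<^bsub>K1_tilde\<^esub> torsion A"
    using K.inv_equality GL torsion_closed by metis
  then have "torsion B \<in> Z" using subgroup.m_inv_closed[OF Z_subgroup A(2)] by simp
  then show ?thesis
    unfolding zrel_def using expressed_by_sym[OF M c A(1) B(1,3)] by blast
qed

lemma zrel_map:
  assumes "left_module M" "f \<in> mod_hom M N" "set c \<subseteq> carrier M" "zrel M b c"
  shows "zrel N (map f b) (map f c)"
proof -
  obtain A where A: "expressed_by M A b c" "torsion A \<in> Z" using assms(4) by (auto simp: zrel_def)
  then have "expressed_by N A (map f b) (map f c)"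
    using lincomb_hom[OF assms(1-3)] by (auto simp: expressed_by_lincomb)
  then show ?thesis using A by (auto simp: zrel_def)
qed

text \<open>
  Stable matrices are identified with their sums with identity matrices, so the same matrix
  describes the longer families.
\<close>

lemma zrel_append_right:
  assumes M: "left_module M" and sub: "set c \<subseteq> carrier M" "set d \<subseteq> carrier M" and bc: "zrel M b c"
  shows "zrel M (b @ d) (c @ d)"
proof -
  obtain A where A: "expressed_by M A b c" "torsion A \<in> Z" using bc by (auto simp: zrel_def)
  have len: "length b = length c" and GL: "A \<in> GL_n (length c)"
    using A by (auto simp: expressed_by_def)
  have "(b @ d) ! i = lincomb M (A i) (c @ d)" if i: "i < length b + length d" for i
  proof (cases "i < length b")
    case True
    have "lincomb M (\<lambda>j. A i (length c + j)) d = lincomb M (\<lambda>j. 0) d"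
      by (rule lincomb_cong) (use True len GL_n_block[OF GL] in \<open>auto simp: smat_block_def smat_one_def\<close>)
    then show ?thesis
      using True A len lincomb_zero[OF M sub(2)]
      by (simp add: lincomb_append nth_append expressed_by_lincomb)
  next
    case False
    have "lincomb M (A i) c = lincomb M (\<lambda>j. 0) c"
      by (rule lincomb_cong) (use False len GL_n_block[OF GL] in \<open>auto simp: smat_block_def smat_one_def\<close>)
    moreover have "lincomb M (\<lambda>j. A i (length c + j)) d = lincomb M (\<lambda>j. if j = i - length c then 1 else 0) d"
      by (rule lincomb_cong) (use False len GL_n_block[OF GL] in \<open>auto simp: smat_block_def smat_one_def\<close>)
    ultimately show ?thesis
      using False len i lincomb_zero[OF M sub(1)] lincomb_unit[OF M sub(2), of "i - length c"]
      by (auto simp: lincomb_append nth_append)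
  qed
  moreover have "A \<in> GL_n (length (c @ d))" using GL by (rule GL_n_mono) simp
  ultimately have "expressed_by M A (b @ d) (c @ d)" using len by (simp add: expressed_by_lincomb)
  then show ?thesis using A(2) by (auto simp: zrel_def)
qed

lemma zrel_perm:
  assumes M: "left_module M" and sub: "set c \<subseteq> carrier M" and "mset b = mset c"
  shows "zrel M b c"
proof -
  obtain p where p: "p permutes {..<length c}" "permute_list p c = b"
    using mset_eq_permutation[OF assms(3)] by blast
  have "b ! i = lincomb M (perm_smat p i) c" if "i < length c" for i
  proof -
    have "p i < length c" using permutes_in_image[OF p(1), of i] that by simp
    then show ?thesis using lincomb_unit[OF M sub] that p permute_list_nth[OF p(1)]
      by (auto simp: perm_smat_def)
  qed
  then have "expressed_by M (perm_smat p) b c"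
    using p perm_smat_GL_n[OF p(1)] by (auto simp: expressed_by_lincomb)
  moreover have "torsion (perm_smat p :: 'a smat) \<in> Z"
    unfolding torsion_perm_smat[OF p(1)] by (rule subgroup.one_closed[OF Z_subgroup])
  ultimately show ?thesis by (auto simp: zrel_def)
qed

text \<open>
  The block sum of two matrices is treated by changing the first block, exchanging the
  blocks, changing the new first block and exchanging them again.
\<close>

lemma zrel_append:
  assumes M: "left_module M" and sub: "set b' \<subseteq> carrier M" "set c' \<subseteq> carrier M" "set c \<subseteq> carrier M"
    and rel: "zrel M b b'" "zrel M c c'"
  shows "zrel M (b @ c) (b' @ c')"
proof -
  have sub': "set (c @ b') \<subseteq> carrier M" "set (c' @ b') \<subseteq> carrier M" "set (b' @ c') \<subseteq> carrier M"
    using sub by auto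
  have "zrel M (b @ c) (b' @ c)" by (rule zrel_append_right[OF M sub(1,3) rel(1)])
  moreover have "zrel M (b' @ c) (c @ b')" by (rule zrel_perm[OF M sub'(1)]) simp
  ultimately have "zrel M (b @ c) (c @ b')" by (rule zrel_trans[OF M sub'(1)])
  moreover have "zrel M (c @ b') (c' @ b')" by (rule zrel_append_right[OF M sub(2,1) rel(2)])
  ultimately have "zrel M (b @ c) (c' @ b')" by (rule zrel_trans[OF M sub'(2)])
  moreover have "zrel M (c' @ b') (b' @ c')" by (rule zrel_perm[OF M sub'(3)]) simp
  ultimately show ?thesis by (rule zrel_trans[OF M sub'(3)])
qed

text \<open>
  The torsion of an automorphism does not depend on the basis in which its matrix is written, since
  a change of basis conjugates the matrix.
\<close>

lemma zrel_conjugate: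
  assumes M: "left_module M" and b: "is_basis M b" and c: "is_basis M c" and len: "length b = length c"
    and g: "g \<in> mod_hom M M" and rel: "zrel M b (map g b)"
  shows "zrel M c (map g c)"
proof -
  interpret K: comm_group "K1_tilde :: 'a smat set set monoid" by (rule comm_group_K1_tilde)
  note sub = basis_subset[OF b] basis_subset[OF c]
  have gsub: "set (map g b) \<subseteq> carrier M" "set (map g c) \<subseteq> carrier M"
    using sub mod_homD(1)[OF g] by auto
  obtain P where P: "expressed_by M P b c" by (rule basis_expressed_by[OF M b c len])
  then obtain P' where P': "P' \<in> GL_n (length c)" "smat_mult P' P = smat_one"
    using GL_n_inverse by (metis expressed_by_def)
  obtain A where A: "expressed_by M A b (map g b)" "torsion A \<in> Z" using rel by (auto simp: zrel_def)
  have gP: "expressed_by M P (map g b) (map g c)"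
    using P lincomb_hom[OF M g sub(2)] by (auto simp: expressed_by_lincomb)
  have P'e: "expressed_by M P' c b" by (rule expressed_by_sym[OF M sub(2) P P'])
  have "expressed_by M (smat_mult P' (smat_mult A P)) c (map g c)"
    by (rule expressed_by_trans[OF M gsub(2) P'e expressed_by_trans[OF M gsub(2) A(1) gP]])
  moreover have "torsion (smat_mult P' (smat_mult A P)) = torsion A"
  proof -
    have GL: "A \<in> carrier GL" "P \<in> carrier GL" "P' \<in> carrier GL"
      using A P P' by (auto simp: expressed_by_def carrier_GL)
    have AP: "smat_mult A P \<in> carrier GL"
      using A(1) P len by (auto simp: expressed_by_def carrier_GL intro!: exI[of _ "length c"] GL_n_mult)
    have "torsion (smat_mult P' (smat_mult A P)) =
        torsion A \<otimes>\<^bsub>K1_tilde\<^esub> (torsion P' \<otimes>\<^bsub>K1_tilde\<^esub> torsion P)"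
      using GL AP by (simp add: torsion_mult torsion_closed K.m_ac)
    also have "torsion P' \<otimes>\<^bsub>K1_tilde\<^esub> torsion P = \<one>\<^bsub>K1_tilde\<^esub>"
      using GL P'(2) by (simp add: torsion_mult[symmetric] torsion_one)
    finally show ?thesis using torsion_closed[OF GL(1)] by simp
  qed
  ultimately show ?thesis using A(2) unfolding zrel_def by metis
qed

end

section \<open>Stable bases and based modules\<close>

lemma shift_vec_zero [simp]: "shift_vec m 0 = 0"
  by (auto simp: shift_vec_def fun_eq_iff)

lemma shift_vec_add: "shift_vec m (v + w) = shift_vec m v + shift_vec m (w :: nat \<Rightarrow> 'a::ab_group_add)"
  by (auto simp: shift_vec_def fun_eq_iff)

lemma shift_vec_scl: "shift_vec m (\<lambda>i. a * v i) = (\<lambda>i. a * shift_vec m v i :: 'a::ring_1)"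
  by (auto simp: shift_vec_def fun_eq_iff)

lemma shift_vec_std [simp]: "shift_vec m (std_vec i) = std_vec (m + i)"
  by (auto simp: shift_vec_def std_vec_def fun_eq_iff)

lemma shift_vec_shift_vec: "shift_vec m (shift_vec n v) = shift_vec (m + n) v"
  by (auto simp: shift_vec_def fun_eq_iff)

lemma free_mod_mono: "v \<in> carrier (free_mod n) \<Longrightarrow> n \<le> m \<Longrightarrow> v \<in> carrier (free_mod m)"
  by (auto simp: carrier_free_mod)

abbreviation stab_mod ::
  "('a::ring_1, 'm::ab_group_add, 'z) lmod_scheme \<Rightarrow> nat \<Rightarrow> ('a, 'm \<times> (nat \<Rightarrow> 'a)) lmod" where
  "stab_mod M m \<equiv> mod_sum M (free_mod m)"

lemma scl_stab_mod_indep: "scl (stab_mod M m) = scl (stab_mod M n)"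
  by (auto simp: fun_eq_iff)

lemma stab_mod_mono: "z \<in> carrier (stab_mod M m) \<Longrightarrow> m \<le> n \<Longrightarrow> z \<in> carrier (stab_mod M n)"
  by (auto simp: carrier_free_mod)

lemma fst_stabilize [simp]: "fst (stabilize k s) = fst s + k"
  by (simp add: stabilize_def)

lemma snd_stabilize: "snd (stabilize k s) = snd s @ map (\<lambda>i. (0, std_vec i)) [fst s..<fst s + k]"
  by (simp add: stabilize_def)

lemma stabilize_0 [simp]: "stabilize 0 s = s"
  by (simp add: stabilize_def)

lemma stabilize_stabilize: "stabilize l (stabilize k s) = stabilize (k + l) s"
  using upt_add_eq_append[of "fst s" "fst s + k" l] by (simp add: stabilize_def add.assoc)

lemma s_basis_subset: "s_basis M s \<Longrightarrow> set (snd s) \<subseteq> carrier (stab_mod M (fst s))"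
  unfolding s_basis_def by (rule basis_subset)

text \<open>The free summands of two stabilizations are put next to each other by shifting the second one.\<close>

lemma sum_stab_mod_iso:
  fixes M :: "('a::ring_1, 'm::ab_group_add, 'z) lmod_scheme"
    and N :: "('a, 'n::ab_group_add, 'w) lmod_scheme"
  assumes M: "left_module M" and N: "left_module N"
  shows "(\<lambda>((x, v), (y, w)). ((x, y), v + shift_vec m w))
    \<in> mod_iso (mod_sum (stab_mod M m) (stab_mod N n)) (stab_mod (mod_sum M N) (m + n))"
    (is "?f \<in> mod_iso ?S ?T")
proof -
  define g :: "('m \<times> 'n) \<times> (nat \<Rightarrow> 'a) \<Rightarrow> ('m \<times> (nat \<Rightarrow> 'a)) \<times> ('n \<times> (nat \<Rightarrow> 'a))"
    where "g = (\<lambda>((x, y), u). ((x, \<lambda>i. if i < m then u i else 0), (y, \<lambda>i. u (m + i))))"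
  have "?f \<in> mod_hom ?S ?T"
  proof (rule mod_homI)
    fix z assume "z \<in> carrier ?S"
    then show "?f z \<in> carrier ?T" by (auto simp: carrier_free_mod shift_vec_def)
  next
    fix z z' assume "z \<in> carrier ?S" "z' \<in> carrier ?S"
    then show "?f (z + z') = ?f z + ?f z'"
      by (auto simp: shift_vec_add split: prod.splits)
  next
    fix a z
    show "?f (scl ?S a z) = scl ?T a (?f z)"
      by (simp add: case_prod_beta mod_sum_def free_mod_def shift_vec_scl plus_fun_def distrib_left)
  qed
  then show ?thesis
  proof (rule mod_isoI_inverse[where g = g])
    fix z assume "z \<in> carrier ?T"
    then show "g z \<in> carrier ?S" "?f (g z) = z"
      by (auto simp: g_def carrier_free_mod shift_vec_def fun_eq_iff)
  next
    fix z assume "z \<in> carrier ?S"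
    then show "g (?f z) = z"
      by (auto simp: g_def carrier_free_mod shift_vec_def fun_eq_iff)
  qed
qed

lemma sum_sbasis_eq_map:
  "snd (sum_sbasis s t) = map (\<lambda>((x, v), (y, w)). ((x, y), v + shift_vec (fst s) w))
     (map (\<lambda>z. (z, 0)) (snd s) @ map (\<lambda>z. (0, z)) (snd t))"
  by (simp add: sum_sbasis_def zero_prod_def case_prod_beta)

lemma fst_sum_sbasis [simp]: "fst (sum_sbasis s t) = fst s + fst t"
  by (simp add: sum_sbasis_def)

lemma s_basis_sum:
  assumes M: "left_module M" and N: "left_module N" and s: "s_basis M s" and t: "s_basis N t"
  shows "s_basis (mod_sum M N) (sum_sbasis s t)"
  unfolding s_basis_def sum_sbasis_eq_map fst_sum_sbasis
  by (intro basis_map[OF _ _ sum_stab_mod_iso] basis_mod_sum)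
     (use assms in \<open>simp_all add: s_basis_def\<close>)

lemma stabilize_iso:
  fixes M :: "('a::ring_1, 'm::ab_group_add, 'z) lmod_scheme"
  assumes M: "left_module M"
  shows "(\<lambda>((x, v), w). (x, v + shift_vec m w))
    \<in> mod_iso (mod_sum (stab_mod M m) (free_mod k)) (stab_mod M (m + k))"
    (is "?f \<in> mod_iso ?S ?T")
proof -
  define g :: "'m \<times> (nat \<Rightarrow> 'a) \<Rightarrow> ('m \<times> (nat \<Rightarrow> 'a)) \<times> (nat \<Rightarrow> 'a)"
    where "g = (\<lambda>(x, u). ((x, \<lambda>i. if i < m then u i else 0), \<lambda>i. u (m + i)))"
  have "?f \<in> mod_hom ?S ?T"
  proof (rule mod_homI)
    fix z assume "z \<in> carrier ?S"
    then show "?f z \<in> carrier ?T" by (auto simp: carrier_free_mod shift_vec_def)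
  next
    fix z z' assume "z \<in> carrier ?S" "z' \<in> carrier ?S"
    then show "?f (z + z') = ?f z + ?f z'"
      by (auto simp: shift_vec_add split: prod.splits)
  next
    fix a z
    show "?f (scl ?S a z) = scl ?T a (?f z)"
      by (simp add: case_prod_beta mod_sum_def free_mod_def shift_vec_scl plus_fun_def distrib_left)
  qed
  then show ?thesis
  proof (rule mod_isoI_inverse[where g = g])
    fix z assume "z \<in> carrier ?T"
    then show "g z \<in> carrier ?S" "?f (g z) = z"
      by (auto simp: g_def carrier_free_mod shift_vec_def fun_eq_iff)
  next
    fix z assume "z \<in> carrier ?S"
    then show "g (?f z) = z"
      by (auto simp: g_def carrier_free_mod shift_vec_def fun_eq_iff)
  qed
qed

lemma s_basis_stabilize:
  assumes M: "left_module M" and s: "s_basis M s"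
  shows "s_basis M (stabilize k s)"
proof -
  let ?f = "\<lambda>((x, v), w). (x, v + shift_vec (fst s) w)"
  have "is_basis (stab_mod M (fst s + k))
      (map ?f (map (\<lambda>z. (z, 0)) (snd s) @ map (\<lambda>w. (0, w)) (std_basis k)))"
    by (intro basis_map[OF _ _ stabilize_iso] basis_mod_sum std_basis_is_basis)
       (use assms in \<open>simp_all add: s_basis_def\<close>)
  also have "map ?f (map (\<lambda>z. (z, 0)) (snd s) @ map (\<lambda>w. (0, w)) (std_basis k)) = snd (stabilize k s)"
  proof -
    have "map (\<lambda>i. (0, std_vec (fst s + i))) [0..<k] = map (\<lambda>i. (0, std_vec i)) (map (\<lambda>i. i + fst s) [0..<k])"
      by (simp add: add.commute)
    then show ?thesis
      by (simp add: snd_stabilize map_add_upt case_prod_beta zero_prod_def comp_def add.commute)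
  qed
  finally show ?thesis by (simp add: s_basis_def)
qed

lemma s_basis_rank_unique:
  fixes M :: "('a::ring_1, 'm::ab_group_add, 'z) lmod_scheme"
  assumes "weakly_finite TYPE('a)" and M: "left_module M" and s: "s_basis M s" and t: "s_basis M t"
  shows "length (snd s) + fst t = length (snd t) + fst s"
proof -
  have "is_basis (stab_mod M (fst s + fst t)) (snd (stabilize (fst t) s))"
    "is_basis (stab_mod M (fst s + fst t)) (snd (stabilize (fst s) t))"
    using s_basis_stabilize[OF M s, of "fst t"] s_basis_stabilize[OF M t, of "fst s"]
    by (simp_all add: s_basis_def add.commute)
  then have "length (snd (stabilize (fst t) s)) = length (snd (stabilize (fst s) t))"
    by (rule basis_length_unique[OF assms(1), rotated]) (simp add: M)
  then show ?thesis by (simp add: snd_stabilize)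
qed

lemma mod_rank_eq:
  fixes M :: "('a::ring_1, 'm::ab_group_add, 'z) lmod_scheme"
  assumes "weakly_finite TYPE('a)" and M: "left_module M" and s: "s_basis M s"
  shows "mod_rank M = int (length (snd s)) - int (fst s)"
  unfolding mod_rank_def
proof (rule the_equality)
  show "\<exists>m b. s_basis M (m, b) \<and> int (length (snd s)) - int (fst s) = int (length b) - int m"
    using s by (metis prod.collapse)
next
  fix r assume "\<exists>m b. s_basis M (m, b) \<and> r = int (length b) - int m"
  then obtain m b where b: "s_basis M (m, b)" "r = int (length b) - int m" by blast
  then show "r = int (length (snd s)) - int (fst s)"
    using s_basis_rank_unique[OF assms(1) M s b(1)] by simp
qed

lemma mod_hom_stab: "f \<in> mod_hom M N \<Longrightarrow> map_prod f id \<in> mod_hom (stab_mod M m) (stab_mod N m)"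
  by (rule mod_homI) (auto simp: mod_homD)

lemma mod_iso_map_prod:
  assumes "f \<in> mod_iso M M'" "g \<in> mod_iso N N'"
  shows "map_prod f g \<in> mod_iso (mod_sum M N) (mod_sum M' N')"
proof -
  have "map_prod f g \<in> mod_hom (mod_sum M N) (mod_sum M' N')"
    using assms by (intro mod_homI) (auto simp: mod_homD[OF mod_isoD(1)])
  moreover have "bij_betw (map_prod f g) (carrier M \<times> carrier N) (carrier M' \<times> carrier N')"
    using assms by (intro bij_betw_map_prod) (auto dest: mod_isoD(2))
  ultimately show ?thesis by (simp add: mod_iso_def)
qed

lemma mod_iso_id: "id \<in> mod_iso M M"
  by (auto simp: mod_iso_def mod_hom_def)

lemma mod_iso_stab: "f \<in> mod_iso M N \<Longrightarrow> map_prod f id \<in> mod_iso (stab_mod M m) (stab_mod N m)"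
  by (rule mod_iso_map_prod[OF _ mod_iso_id])

lemma fst_map_sbasis [simp]: "fst (map_sbasis f s) = fst s"
  by (simp add: map_sbasis_def)

lemma snd_map_sbasis: "snd (map_sbasis f s) = map (map_prod f id) (snd s)"
  by (simp add: map_sbasis_def)

lemma map_sbasis_comp: "map_sbasis g (map_sbasis f s) = map_sbasis (\<lambda>x. g (f x)) s"
  by (simp add: map_sbasis_def prod.map_comp comp_def id_def)

lemma map_sbasis_cong:
  assumes "s_basis M s" "\<And>x. x \<in> carrier M \<Longrightarrow> f x = g x"
  shows "map_sbasis f s = map_sbasis g s"
  using s_basis_subset[OF assms(1)] assms(2) by (auto simp: map_sbasis_def map_prod_def split: prod.splits)

lemma map_sbasis_id_on:
  assumes "s_basis M s" "\<And>x. x \<in> carrier M \<Longrightarrow> f x = x"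
  shows "map_sbasis f s = s"
proof -
  have "map_sbasis f s = map_sbasis (\<lambda>x. x) s" by (rule map_sbasis_cong[OF assms])
  also have "\<dots> = s" by (simp add: map_sbasis_def map_prod_def id_def)
  finally show ?thesis .
qed

lemma s_basis_map:
  assumes "left_module M" "left_module N" "f \<in> mod_iso M N" "s_basis M s"
  shows "s_basis N (map_sbasis f s)"
  unfolding s_basis_def snd_map_sbasis fst_map_sbasis
  by (rule basis_map[OF _ _ mod_iso_stab[OF assms(3)]]) (use assms in \<open>simp_all add: s_basis_def\<close>)

lemma map_sbasis_stabilize:
  "f 0 = 0 \<Longrightarrow> map_sbasis f (stabilize k s) = stabilize k (map_sbasis f s)"
  by (simp add: map_sbasis_def stabilize_def)

lemma sum_sbasis_map:
  assumes "f 0 = 0" "g 0 = 0"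
  shows "map_sbasis (map_prod f g) (sum_sbasis s t) = sum_sbasis (map_sbasis f s) (map_sbasis g t)"
  using assms by (simp add: map_sbasis_def sum_sbasis_def case_prod_beta)

text \<open>
  On the right no permutation of coordinates occurs: the additional free summand is the last one
  on both sides. Compare \<open>sum_stabilize_left\<close> below.
\<close>

lemma sum_stabilize_right:
  fixes s :: "('a::ring_1, 'b::ab_group_add) sbasis" and t :: "('a, 'd::ab_group_add) sbasis"
  shows "sum_sbasis s (stabilize l t) = stabilize l (sum_sbasis s t)"
proof -
  have "map (\<lambda>i. (x, std_vec (fst s + i))) [fst t..<fst t + l] =
      map (\<lambda>i. (x, std_vec i)) [fst s + fst t..<fst s + fst t + l]" for x :: "'b \<times> 'd"
    by (intro nth_equalityI) (auto simp: add.assoc)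
  then show ?thesis
    by (simp add: sum_sbasis_def stabilize_def zero_prod_def comp_def add.assoc)
qed

text \<open>
  This exchanges two adjacent blocks of lengths \<open>k\<close> and \<open>l\<close> which start at position \<open>u\<close>. Rearranging the
  free summands of stable bases of direct sums always amounts to such an exchange.
\<close>

definition block_swap :: "nat \<Rightarrow> nat \<Rightarrow> nat \<Rightarrow> nat \<Rightarrow> nat" where
  "block_swap u k l = (\<lambda>i. if u \<le> i \<and> i < u + k then i + l
     else if u + k \<le> i \<and> i < u + k + l then i - k else i)"

lemma block_swap_permutes:
  assumes "u + k + l \<le> n"
  shows "block_swap u k l permutes {..<n}"
proof (rule bij_imp_permutes)
  show "bij_betw (block_swap u k l) {..<n} {..<n}"
    by (rule bij_betw_byWitness[where f' = "block_swap u l k"])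
       (use assms in \<open>auto simp: block_swap_def\<close>)
  show "block_swap u k l i = i" if "i \<notin> {..<n}" for i
    using that assms by (auto simp: block_swap_def)
qed

abbreviation permute_coords :: "(nat \<Rightarrow> nat) \<Rightarrow> 'm \<times> (nat \<Rightarrow> 'a) \<Rightarrow> 'm \<times> (nat \<Rightarrow> 'a)" where
  "permute_coords p z \<equiv> (fst z, snd z \<circ> p)"

lemma permute_coords_hom:
  assumes "p permutes {..<m}"
  shows "permute_coords p \<in> mod_hom (stab_mod M m) (stab_mod M m)"
proof (rule mod_homI)
  fix z assume z: "z \<in> carrier (stab_mod M m)"
  have "\<forall>i\<ge>m. p i = i" using permutes_not_in[OF assms] by auto
  then show "permute_coords p z \<in> carrier (stab_mod M m)"
    using z by (auto simp: carrier_free_mod)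
qed (auto simp: fun_eq_iff)

lemma permute_coords_iso:
  assumes "p permutes {..<m}"
  shows "permute_coords p \<in> mod_iso (stab_mod M m) (stab_mod M m)"
proof (rule mod_isoI_inverse[OF permute_coords_hom[OF assms]])
  note p' = permutes_inv[OF assms]
  fix z assume z: "z \<in> carrier (stab_mod M m)"
  then show "permute_coords (inv_into UNIV p) z \<in> carrier (stab_mod M m)"
    by (rule mod_homD(1)[OF permute_coords_hom[OF p']])
qed (use permutes_inv_o[OF assms] in \<open>auto simp: comp_assoc\<close>)

lemma mset_permute_std_vec:
  fixes x :: "'m::ab_group_add"
  assumes r: "r permutes {a..<b}"
  shows "mset (map (permute_coords r) (map (\<lambda>i. (x, std_vec i :: nat \<Rightarrow> 'a::ring_1)) [a..<b])) =
    mset (map (\<lambda>i. (x, std_vec i)) [a..<b])"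
proof -
  let ?q = "inv_into UNIV r"
  have q: "std_vec i \<circ> r = (std_vec (?q i) :: nat \<Rightarrow> 'a)" for i
    by (rule ext) (metis (no_types) comp_apply std_vec_def permutes_inv_eq[OF r])
  have "map (permute_coords r) (map (\<lambda>i. (x, std_vec i :: nat \<Rightarrow> 'a)) [a..<b]) =
      map (\<lambda>i. (x, std_vec (?q i))) [a..<b]"
    unfolding map_map by (rule map_cong[OF HOL.refl]) (simp only: comp_apply fst_conv snd_conv q)
  then have "mset (map (permute_coords r) (map (\<lambda>i. (x, std_vec i :: nat \<Rightarrow> 'a)) [a..<b])) =
      mset (map (\<lambda>i. (x, std_vec (?q i))) [a..<b])" by (rule arg_cong)
  also have "\<dots> = image_mset (\<lambda>i. (x, std_vec i)) (image_mset ?q (mset_set {a..<b}))"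
    by (simp add: image_mset.compositionality comp_def)
  also have "image_mset ?q (mset_set {a..<b}) = mset_set {a..<b}"
    by (rule permutes_image_mset[OF permutes_inv[OF r]])
  also have "image_mset (\<lambda>i. (x, std_vec i)) (mset_set {a..<b}) = mset (map (\<lambda>i. (x, std_vec i)) [a..<b])"
    by simp
  finally show ?thesis .
qed

context torsion_subgroup
begin

lemma s_equiv_iff:
  "s_equiv Z M s t \<longleftrightarrow> (\<exists>k l. fst s + k = fst t + l \<and>
     zrel (stab_mod M (fst s + k)) (snd (stabilize k s)) (snd (stabilize l t)))"
  unfolding s_equiv_def zrel_def by blast

lemma s_equivI:
  "fst s = fst t \<Longrightarrow> zrel (stab_mod M (fst s)) (snd s) (snd t) \<Longrightarrow> s_equiv Z M s t"
  unfolding s_equiv_iff by (intro exI[of _ 0]) simp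

lemma s_equiv_refl: "left_module M \<Longrightarrow> s_basis M s \<Longrightarrow> s_equiv Z M s s"
  by (intro s_equivI[OF refl] zrel_refl left_module_mod_sum left_module_free_mod s_basis_subset)

lemma s_equiv_sym:
  assumes M: "left_module M" and t: "s_basis M t" and st: "s_equiv Z M s t"
  shows "s_equiv Z M t s"
proof -
  obtain k l where kl: "fst s + k = fst t + l"
    "zrel (stab_mod M (fst s + k)) (snd (stabilize k s)) (snd (stabilize l t))"
    using st by (auto simp: s_equiv_iff)
  have "zrel (stab_mod M (fst t + l)) (snd (stabilize l t)) (snd (stabilize k s))"
    using zrel_sym[OF _ _ kl(2)] s_basis_subset[OF s_basis_stabilize[OF M t, of l]] M kl(1) by simp
  then show ?thesis unfolding s_equiv_iff using kl(1) by metis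
qed

text \<open>
  Scalar multiplication on the free summand does not depend on its rank, so a relation can be read in
  any larger stabilization.
\<close>

lemma zrel_stabilize:
  assumes M: "left_module M" and t: "s_basis M t" and "fst s = fst t"
    and rel: "zrel (stab_mod M (fst t)) (snd s) (snd t)"
  shows "zrel (stab_mod M (fst t + k)) (snd (stabilize k s)) (snd (stabilize k t))"
proof -
  have "zrel (stab_mod M (fst t + k)) (snd s) (snd t)"
    using rel zrel_scl_cong[OF scl_stab_mod_indep] by blast
  moreover have "set (snd t) \<subseteq> carrier (stab_mod M (fst t + k))"
    using s_basis_subset[OF t] by (auto intro: stab_mod_mono free_mod_mono)
  moreover have "set (map (\<lambda>i. (0, std_vec i)) [fst t..<fst t + k]) \<subseteq> carrier (stab_mod M (fst t + k))"
    using left_moduleD(1)[OF M] by (auto simp: carrier_free_mod std_vec_def)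
  ultimately show ?thesis
    using M assms(3) by (simp add: snd_stabilize zrel_append_right)
qed

lemma s_equiv_trans:
  assumes M: "left_module M" and s: "s_basis M s" and t: "s_basis M t" and u: "s_basis M u"
    and st: "s_equiv Z M s t" and tu: "s_equiv Z M t u"
  shows "s_equiv Z M s u"
proof -
  obtain k l where kl: "fst s + k = fst t + l"
    "zrel (stab_mod M (fst s + k)) (snd (stabilize k s)) (snd (stabilize l t))"
    using st by (auto simp: s_equiv_iff)
  obtain k' l' where kl': "fst t + k' = fst u + l'"
    "zrel (stab_mod M (fst t + k')) (snd (stabilize k' t)) (snd (stabilize l' u))"
    using tu by (auto simp: s_equiv_iff)
  let ?n = "fst t + l + k'"
  have "zrel (stab_mod M ?n) (snd (stabilize (k + k') s)) (snd (stabilize (l + k') t))"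
    using zrel_stabilize[OF M s_basis_stabilize[OF M t, of l], of "stabilize k s" k'] kl
    by (simp add: stabilize_stabilize)
  moreover have "zrel (stab_mod M ?n) (snd (stabilize (l + k') t)) (snd (stabilize (l' + l) u))"
  proof -
    have n: "fst u + l' + l = ?n" using kl'(1) by simp
    have "zrel (stab_mod M (fst (stabilize l' u) + l)) (snd (stabilize l (stabilize k' t)))
        (snd (stabilize l (stabilize l' u)))"
      by (rule zrel_stabilize[OF M s_basis_stabilize[OF M u]]) (use kl' in simp_all)
    then show ?thesis using n by (simp only: fst_stabilize stabilize_stabilize add.commute[of k' l])
  qed
  moreover have "set (snd (stabilize (l' + l) u)) \<subseteq> carrier (stab_mod M ?n)"
  proof -
    have n: "fst (stabilize (l' + l) u) = ?n" using kl'(1) by simp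
    show ?thesis using s_basis_subset[OF s_basis_stabilize[OF M u, of "l' + l"]] unfolding n .
  qed
  ultimately have "zrel (stab_mod M ?n) (snd (stabilize (k + k') s)) (snd (stabilize (l' + l) u))"
    using zrel_trans[of "stab_mod M ?n"] M by simp
  moreover have "fst s + (k + k') = ?n" "fst u + (l' + l) = ?n"
    using kl(1) kl'(1) by simp_all
  ultimately show ?thesis unfolding s_equiv_iff by metis
qed

lemma s_equiv_stabilize:
  assumes M: "left_module M" and s: "s_basis M s"
  shows "s_equiv Z M (stabilize k s) s" "s_equiv Z M s (stabilize k s)"
proof -
  have "zrel (stab_mod M (fst s + k)) (snd (stabilize k s)) (snd (stabilize k s))"
    using s_basis_subset[OF s_basis_stabilize[OF M s, of k]] M by (intro zrel_refl) auto
  then show "s_equiv Z M (stabilize k s) s"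
    unfolding s_equiv_iff by (intro exI[of _ 0] exI[of _ k]) simp
  then show "s_equiv Z M s (stabilize k s)" by (rule s_equiv_sym[OF M s])
qed

lemma s_equiv_map:
  assumes M: "left_module M" and f: "f \<in> mod_hom M N" and t: "s_basis M t" and st: "s_equiv Z M s t"
  shows "s_equiv Z N (map_sbasis f s) (map_sbasis f t)"
proof -
  obtain k l where kl: "fst s + k = fst t + l"
    "zrel (stab_mod M (fst s + k)) (snd (stabilize k s)) (snd (stabilize l t))"
    using st by (auto simp: s_equiv_iff)
  have f0: "f 0 = 0" by (rule mod_hom_zero[OF M f])
  have "zrel (stab_mod N (fst s + k)) (map (map_prod f id) (snd (stabilize k s)))
      (map (map_prod f id) (snd (stabilize l t)))"
    using s_basis_subset[OF s_basis_stabilize[OF M t, of l]] M kl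
    by (intro zrel_map[OF _ mod_hom_stab[OF f]]) auto
  then show ?thesis
    unfolding s_equiv_iff using kl(1) map_sbasis_stabilize[of f, OF f0] snd_map_sbasis fst_map_sbasis
    by metis
qed

text \<open>
  Permuting the coordinates of the free summand is harmless: stably this automorphism is conjugate
  to the same permutation of a second copy of the free summand, and that one just permutes
  basis vectors.
\<close>

lemma s_equiv_permute_coords:
  fixes M :: "('a, 'm::ab_group_add, 'z) lmod_scheme"
  assumes M: "left_module M" and s: "s_basis M (m, b)" and p: "p permutes {..<m}"
    and c: "mset c = mset (map (permute_coords p) b)"
  shows "s_equiv Z M (m, b) (m, c)"
proof -
  \<comment> \<open>The free summand is doubled; \<open>\<tau>\<close> exchanges the two copies, and \<open>r\<close> is \<open>p\<close> acting on the second copy.\<close>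
  let ?N = "stab_mod M (m + m)"
  define \<tau> where "\<tau> = block_swap 0 m m"
  define r where "r = \<tau> \<circ> p \<circ> \<tau>"
  define B where "B = snd (stabilize m (m, b))"
  have N: "left_module ?N" using M by simp
  have p2: "p permutes {..<m + m}" by (rule permutes_subset[OF p]) auto
  have \<tau>: "\<tau> permutes {..<m + m}" unfolding \<tau>_def by (rule block_swap_permutes) simp
  have \<tau>\<tau>: "\<tau> \<circ> \<tau> = id" by (auto simp: \<tau>_def block_swap_def fun_eq_iff)
  have r: "r permutes {..<m + m}" unfolding r_def by (intro permutes_compose \<tau> p2)
  have pge: "p i = i" if "m \<le> i" for i using permutes_not_in[OF p] that by simp
  have plt: "p i < m \<longleftrightarrow> i < m" for i using permutes_in_image[OF p, of i] by simp
  have rlt: "r i = i" if "i < m" for i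
    using that pge by (simp add: r_def \<tau>_def block_swap_def)
  have rge: "m \<le> r i \<longleftrightarrow> m \<le> i" for i
    using rlt permutes_inj[OF r] by (metis injD not_le)
  have conj: "\<tau> \<circ> p = r \<circ> \<tau>" using \<tau>\<tau> by (simp add: r_def comp_assoc)
  have bsub: "set b \<subseteq> carrier (stab_mod M m)" using s_basis_subset[OF s] by simp
  have B: "is_basis ?N B"
    using s_basis_stabilize[OF M s, of m] by (simp add: s_basis_def B_def)
  define E :: "('m \<times> (nat \<Rightarrow> 'a)) list" where "E = map (\<lambda>i. (0, std_vec i)) [m..<m + m]"
  have BE: "B = b @ E" by (simp add: B_def E_def snd_stabilize)
  have "zrel ?N B (map (permute_coords r) B)"
  proof (rule zrel_perm[OF N])
    show "set (map (permute_coords r) B) \<subseteq> carrier ?N"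
      using basis_subset[OF B] mod_homD(1)[OF permute_coords_hom[OF r]] by (auto simp del: carrier_mod_sum)
    have "map (permute_coords r) b = b"
    proof (rule map_idI)
      fix z assume "z \<in> set b"
      then have "\<forall>i\<ge>m. snd z i = 0" using bsub by (auto simp: carrier_free_mod)
      then have "snd z (r i) = snd z i" for i using rlt rge by (cases "i < m") auto
      then show "permute_coords r z = z" by (simp add: prod_eq_iff fun_eq_iff)
    qed
    moreover have "mset (map (permute_coords r) E) = mset E"
    proof -
      have "r permutes {m..<m + m}"
        by (rule permutes_superset[OF r]) (auto intro: rlt)
      then show ?thesis unfolding E_def by (rule mset_permute_std_vec)
    qed
    ultimately show "mset B = mset (map (permute_coords r) B)"
      by (simp only: BE map_append mset_append)
  qed
  then have "zrel ?N (map (permute_coords \<tau>) B) (map (permute_coords \<tau>) (map (permute_coords r) B))"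
    using basis_subset[OF B] mod_homD(1)[OF permute_coords_hom[OF r]]
    by (intro zrel_map[OF N permute_coords_hom[OF \<tau>]]) (auto simp del: carrier_mod_sum)
  also have "map (permute_coords \<tau>) (map (permute_coords r) B) =
      map (permute_coords p) (map (permute_coords \<tau>) B)"
    using conj by (simp add: comp_assoc)
  finally have rel: "zrel ?N (map (permute_coords \<tau>) B) (map (permute_coords p) (map (permute_coords \<tau>) B))" .
  have "zrel ?N B (map (permute_coords p) B)"
    by (rule zrel_conjugate[OF N basis_map[OF N N permute_coords_iso[OF \<tau>] B] B _ permute_coords_hom[OF p2] rel])
       simp
  also have "map (permute_coords p) B = map (permute_coords p) b @ E"
  proof -
    have "std_vec i \<circ> p = (std_vec i :: nat \<Rightarrow> 'a)" if "m \<le> i" for i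
    proof
      fix j
      have "p j = i \<longleftrightarrow> j = i"
        using that plt[of j] pge[of j] by (cases "j < m") auto
      then show "(std_vec i \<circ> p) j = (std_vec i j :: 'a)" by (simp add: std_vec_def)
    qed
    then show ?thesis by (simp add: BE E_def)
  qed
  finally have B1: "zrel ?N B (map (permute_coords p) b @ E)" .
  have csub: "set c \<subseteq> carrier ?N"
  proof
    fix y assume "y \<in> set c"
    then have "y \<in> set (map (permute_coords p) b)" by (simp only: mset_eq_setD[OF c])
    then obtain z where z: "z \<in> set b" "y = permute_coords p z" by (simp only: set_map) (elim imageE)
    have "z \<in> carrier ?N" using subsetD[OF bsub z(1)] by (rule stab_mod_mono) simp
    then show "y \<in> carrier ?N" unfolding z(2) by (rule mod_homD(1)[OF permute_coords_hom[OF p2]])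
  qed
  have Esub: "set E \<subseteq> carrier ?N" using basis_subset[OF B] unfolding BE set_append by (rule le_supE)
  have "zrel ?N (map (permute_coords p) b) c" by (rule zrel_perm[OF N csub c[symmetric]])
  then have "zrel ?N (map (permute_coords p) b @ E) (c @ E)"
    by (rule zrel_append_right[OF N csub Esub])
  then have "zrel ?N B (c @ E)"
    by (rule zrel_trans[OF N _ B1, rotated]) (use csub Esub in simp)
  then show ?thesis
    unfolding s_equiv_iff B_def E_def by (intro exI[of _ m]) (simp add: snd_stabilize)
qed

lemma s_equiv_block_swap:
  assumes M: "left_module M" and s: "s_basis M s" and t: "fst t = fst s" and n: "u + k + l \<le> fst s"
    and c: "mset (snd t) = mset (map (permute_coords (block_swap u k l)) (snd s))"
  shows "s_equiv Z M s t"
proof -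
  have "s_equiv Z M (fst s, snd s) (fst s, snd t)"
    by (rule s_equiv_permute_coords[OF M _ block_swap_permutes[OF n] c]) (simp add: s)
  then show ?thesis using t by (metis prod.collapse)
qed

lemma zrel_sum_sbasis:
  assumes M: "left_module M" and N: "left_module N" and s': "s_basis M s'" and t': "s_basis N t'" and tb: "s_basis N t"
    and s: "fst s = fst s'" "zrel (stab_mod M (fst s)) (snd s) (snd s')"
    and t: "fst t = fst t'" "zrel (stab_mod N (fst t)) (snd t) (snd t')"
  shows "zrel (stab_mod (mod_sum M N) (fst s + fst t)) (snd (sum_sbasis s t)) (snd (sum_sbasis s' t'))"
proof -
  let ?m = "fst s'" and ?n = "fst t'"
  let ?S = "mod_sum (stab_mod M ?m) (stab_mod N ?n)"
  have left: "left_module (stab_mod M ?m)" "left_module (stab_mod N ?n)" "left_module ?S"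
    using M N by auto
  note sub = s_basis_subset[OF s'] s_basis_subset[OF t']
  have hom: "(\<lambda>z. (z, 0)) \<in> mod_hom (stab_mod M ?m) ?S" "(\<lambda>z. (0, z)) \<in> mod_hom (stab_mod N ?n) ?S"
    using inl_mod_hom[OF left(2)] inr_mod_hom[OF left(1)] by auto
  have im: "set (map (\<lambda>z. (z, 0)) (snd s')) \<subseteq> carrier ?S" "set (map (\<lambda>z. (0, z)) (snd t')) \<subseteq> carrier ?S"
    using sub mod_homD(1)[OF hom(1)] mod_homD(1)[OF hom(2)] by (auto simp del: carrier_mod_sum)
  have rel: "zrel ?S (map (\<lambda>z. (z, 0)) (snd s)) (map (\<lambda>z. (z, 0)) (snd s'))"
    "zrel ?S (map (\<lambda>z. (0, z)) (snd t)) (map (\<lambda>z. (0, z)) (snd t'))"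
    using zrel_map[OF left(1) hom(1) sub(1)] zrel_map[OF left(2) hom(2) sub(2)] s t by auto
  have "set (snd t) \<subseteq> carrier (stab_mod N ?n)"
    using s_basis_subset[OF tb] by (simp add: t(1) del: carrier_mod_sum)
  then have "set (map (\<lambda>z. (0, z)) (snd t)) \<subseteq> carrier ?S"
    using mod_homD(1)[OF hom(2)] by (auto simp del: carrier_mod_sum)
  then have "zrel ?S (map (\<lambda>z. (z, 0)) (snd s) @ map (\<lambda>z. (0, z)) (snd t))
      (map (\<lambda>z. (z, 0)) (snd s') @ map (\<lambda>z. (0, z)) (snd t'))"
    by (rule zrel_append[OF left(3) im _ rel])
  then have "zrel (stab_mod (mod_sum M N) (?m + ?n))
      (map (\<lambda>((x, v), (y, w)). ((x, y), v + shift_vec ?m w))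
        (map (\<lambda>z. (z, 0)) (snd s) @ map (\<lambda>z. (0, z)) (snd t)))
      (map (\<lambda>((x, v), (y, w)). ((x, y), v + shift_vec ?m w))
        (map (\<lambda>z. (z, 0)) (snd s') @ map (\<lambda>z. (0, z)) (snd t')))"
    using im by (intro zrel_map[OF left(3) mod_isoD(1)[OF sum_stab_mod_iso[OF M N]]])
      (auto simp del: carrier_mod_sum)
  then show ?thesis unfolding sum_sbasis_eq_map s(1) t(1) .
qed

lemma block_swap_below:
  fixes v :: "nat \<Rightarrow> 'a"
  assumes "v \<in> carrier (free_mod u)"
  shows "v \<circ> block_swap u k l = v"
  using assms by (auto simp: block_swap_def carrier_free_mod fun_eq_iff)

lemma block_swap_above:
  fixes v :: "nat \<Rightarrow> 'a"
  shows "shift_vec (u + k + l) v \<circ> block_swap u k l = shift_vec (u + k + l) v"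
  by (auto simp: block_swap_def fun_eq_iff shift_vec_def)

lemma block_swap_first:
  fixes v :: "nat \<Rightarrow> 'a"
  assumes "v \<in> carrier (free_mod l)"
  shows "shift_vec u v \<circ> block_swap u k l = shift_vec (u + k) v"
  using assms by (auto simp: block_swap_def carrier_free_mod fun_eq_iff shift_vec_def add.commute)

lemma block_swap_second:
  fixes v :: "nat \<Rightarrow> 'a"
  assumes "v \<in> carrier (free_mod k)"
  shows "shift_vec (u + l) v \<circ> block_swap u k l = shift_vec u v"
  using assms by (auto simp: block_swap_def carrier_free_mod fun_eq_iff shift_vec_def)

lemma map_permute_coords:
  assumes "s_basis M s"
    and "\<And>x v. x \<in> carrier M \<Longrightarrow> v \<in> carrier (free_mod (fst s)) \<Longrightarrow> permute_coords p (f (x, v)) = g (x, v)"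
  shows "map (permute_coords p) (map f (snd s)) = map g (snd s)"
  unfolding map_map using s_basis_subset[OF assms(1)] assms(2) by (intro map_cong) auto

text \<open>
  Stabilizing the first summand inserts the new coordinates in front of those of the second summand
  and the new basis vectors in front of its basis. Both differences are permutations.
\<close>

lemma sum_stabilize_left:
  fixes M :: "('a, 'm::ab_group_add, 'z) lmod_scheme" and N :: "('a, 'n::ab_group_add, 'w) lmod_scheme"
  assumes M: "left_module M" and N: "left_module N" and s: "s_basis M s" and t: "s_basis N t"
  shows "s_equiv Z (mod_sum M N) (sum_sbasis (stabilize k s) t) (stabilize k (sum_sbasis s t))"
proof (rule s_equiv_block_swap[where u = "fst s" and k = "fst t" and l = k])
  show "s_basis (mod_sum M N) (sum_sbasis (stabilize k s) t)"
    by (rule s_basis_sum[OF M N s_basis_stabilize[OF M s] t])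
  let ?p = "block_swap (fst s) (fst t) k"
  have "map (permute_coords ?p) (map (\<lambda>(x, v). ((x, 0), v)) (snd s)) =
      map (\<lambda>(x, v). ((x, 0 :: 'n), v)) (snd s)"
    by (rule map_permute_coords[OF s]) (simp add: block_swap_below)
  moreover have "map (permute_coords ?p) (map (\<lambda>(y, w). ((0, y), shift_vec (fst s + k) w)) (snd t)) =
      map (\<lambda>(y, w). ((0 :: 'm, y), shift_vec (fst s) w)) (snd t)"
    by (rule map_permute_coords[OF t]) (simp add: block_swap_second)
  moreover have "map (permute_coords ?p) (map (\<lambda>i. (0, std_vec i)) [fst s..<fst s + k]) =
      (map (\<lambda>i. (0, std_vec i)) [fst s + fst t..<fst s + fst t + k] :: (('m \<times> 'n) \<times> (nat \<Rightarrow> 'a)) list)"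
  proof (rule nth_equalityI)
    fix i assume "i < length (map (permute_coords ?p) (map (\<lambda>i. (0 :: 'm \<times> 'n, std_vec i :: nat \<Rightarrow> 'a)) [fst s..<fst s + k]))"
    then have i: "i < k" by simp
    then have "std_vec i \<in> carrier (free_mod k :: ('a, nat \<Rightarrow> 'a) lmod)"
      by (simp add: carrier_free_mod std_vec_def)
    from block_swap_first[OF this, of "fst s" "fst t"] i
    show "map (permute_coords ?p) (map (\<lambda>i. (0, std_vec i)) [fst s..<fst s + k]) ! i =
      (map (\<lambda>i. (0, std_vec i)) [fst s + fst t..<fst s + fst t + k] :: (('m \<times> 'n) \<times> (nat \<Rightarrow> 'a)) list) ! i"
      by simp
  qed simp
  ultimately have "map (permute_coords ?p) (snd (sum_sbasis (stabilize k s) t)) =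
     map (\<lambda>(x, v). ((x, 0), v)) (snd s) @ map (\<lambda>i. (0, std_vec i)) [fst s + fst t..<fst s + fst t + k] @
     map (\<lambda>(y, w). ((0, y), shift_vec (fst s) w)) (snd t)"
    unfolding sum_sbasis_def stabilize_def
    by (simp only: fst_conv snd_conv map_append append_assoc map_map comp_def case_prod_conv zero_prod_def)
  then show "mset (snd (stabilize k (sum_sbasis s t))) =
      mset (map (permute_coords ?p) (snd (sum_sbasis (stabilize k s) t)))"
    by (simp only:) (simp add: sum_sbasis_def stabilize_def)
qed (use M N in auto)

text \<open>
  After stabilizing both pairs until they are related by matrices, the block sum of these matrices
  relates the sums.
\<close>

lemma s_equiv_sum:
  assumes M: "left_module M" and N: "left_module N"
    and s: "s_basis M s" "s_basis M s'" "s_equiv Z M s s'"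
    and t: "s_basis N t" "s_basis N t'" "s_equiv Z N t t'"
  shows "s_equiv Z (mod_sum M N) (sum_sbasis s t) (sum_sbasis s' t')"
proof -
  let ?S = "mod_sum M N"
  have S: "left_module ?S" using M N by simp
  have stab: "s_equiv Z ?S (sum_sbasis s t) (sum_sbasis (stabilize k s) (stabilize l t))"
    if s: "s_basis M s" and t: "s_basis N t" for s t k l
  proof -
    let ?a = "sum_sbasis s t" and ?b = "stabilize k (stabilize l (sum_sbasis s t))"
    and ?c = "sum_sbasis (stabilize k s) (stabilize l t)"
    have b: "s_basis ?S ?a" "s_basis ?S (stabilize l ?a)" "s_basis ?S ?b" "s_basis ?S ?c"
      by (intro s_basis_sum s_basis_stabilize S M N s t)+
    have "s_equiv Z ?S ?c (stabilize k (sum_sbasis s (stabilize l t)))"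
      by (rule sum_stabilize_left[OF M N s s_basis_stabilize[OF N t]])
    then have "s_equiv Z ?S ?c ?b" by (simp add: sum_stabilize_right)
    then have "s_equiv Z ?S ?b ?c" by (rule s_equiv_sym[OF S b(3)])
    moreover have "s_equiv Z ?S ?a ?b"
      unfolding stabilize_stabilize by (rule s_equiv_stabilize(2)[OF S b(1)])
    ultimately show ?thesis by (intro s_equiv_trans[OF S b(1,3,4)])
  qed
  obtain k k' where k: "fst s + k = fst s' + k'"
    "zrel (stab_mod M (fst s + k)) (snd (stabilize k s)) (snd (stabilize k' s'))"
    using s(3) by (auto simp: s_equiv_iff)
  obtain l l' where l: "fst t + l = fst t' + l'"
    "zrel (stab_mod N (fst t + l)) (snd (stabilize l t)) (snd (stabilize l' t'))"
    using t(3) by (auto simp: s_equiv_iff)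
  let ?b = "sum_sbasis (stabilize k s) (stabilize l t)"
    and ?c = "sum_sbasis (stabilize k' s') (stabilize l' t')"
  have basis: "s_basis ?S (sum_sbasis s t)" "s_basis ?S ?b" "s_basis ?S ?c" "s_basis ?S (sum_sbasis s' t')"
    using M N s t by (auto intro!: s_basis_sum s_basis_stabilize)
  have "s_equiv Z ?S ?b ?c"
  proof (rule s_equivI)
    show "zrel (stab_mod ?S (fst ?b)) (snd ?b) (snd ?c)"
      unfolding fst_sum_sbasis
      by (rule zrel_sum_sbasis[OF M N s_basis_stabilize[OF M s(2)] s_basis_stabilize[OF N t(2)]
          s_basis_stabilize[OF N t(1)]]) (use k l in simp_all)
  qed (use k l in simp)
  moreover have "s_equiv Z ?S ?c (sum_sbasis s' t')"
    by (rule s_equiv_sym[OF S basis(3) stab[OF s(2) t(2)]])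
  ultimately show ?thesis
    using stab[OF s(1) t(1)] s_equiv_trans[OF S basis(1,2,3)] s_equiv_trans[OF S basis(1,3,4)] by blast
qed


section \<open>Simple isomorphisms\<close>

text \<open>
  For a based module the distinguished stable bases form a full equivalence class. For a dual module
  this would involve the identification with the double dual. Families of pairwise equivalent
  stable bases which are closed under stabilization determine the simple isomorphisms just as well, and
  they pass to duals directly.
\<close>

definition weakly_based :: "('a, 'm::ab_group_add) based \<Rightarrow> bool" where
  "weakly_based M \<longleftrightarrow> left_module M \<and> sbases M \<noteq> {} \<and>
     (\<forall>s\<in>sbases M. s_basis M s \<and> (\<forall>k. stabilize k s \<in> sbases M)) \<and>
     (\<forall>s\<in>sbases M. \<forall>t\<in>sbases M. s_equiv Z M s t)"

lemma weakly_basedD: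
  assumes "weakly_based M"
  shows "left_module M" "\<exists>s. s \<in> sbases M"
    and "s \<in> sbases M \<Longrightarrow> s_basis M s"
    and "s \<in> sbases M \<Longrightarrow> stabilize k s \<in> sbases M"
    and "s \<in> sbases M \<Longrightarrow> t \<in> sbases M \<Longrightarrow> s_equiv Z M s t"
  using assms unfolding weakly_based_def by auto

lemma based_moduleD:
  assumes "based_module Z M"
  shows "weakly_based M"
    and "s \<in> sbases M \<Longrightarrow> s_basis M t \<Longrightarrow> s_equiv Z M s t \<Longrightarrow> t \<in> sbases M"
proof -
  obtain s0 where M: "left_module M" and s0: "s_basis M s0" and eq: "sbases M = s_class Z M s0"
    using assms by (auto simp: based_module_def)
  have mem: "t \<in> sbases M \<longleftrightarrow> s_basis M t \<and> s_equiv Z M s0 t" for t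
    unfolding eq s_class_def by simp
  show "t \<in> sbases M" if "s \<in> sbases M" "s_basis M t" "s_equiv Z M s t" for s t
    using that s_equiv_trans[OF M s0] unfolding mem by blast
  note stabI = this
  show "weakly_based M"
    unfolding weakly_based_def
  proof (intro conjI ballI allI)
    show "sbases M \<noteq> {}" using mem s0 s_equiv_refl[OF M s0] by blast
    fix s assume s: "s \<in> sbases M"
    show "s_basis M s" using s mem by simp
    show "stabilize k s \<in> sbases M" for k
      using stabI[OF s] s mem s_basis_stabilize[OF M] s_equiv_stabilize(2)[OF M] by blast
    fix t assume t: "t \<in> sbases M"
    have "s_equiv Z M s s0" using s s_equiv_sym[OF M] unfolding mem by blast
    then show "s_equiv Z M s t" using s t s0 s_equiv_trans[OF M, of s s0 t] unfolding mem by blast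
  qed (rule M)
qed

lemma based_moduleI:
  assumes M: "left_module M" and s: "s_basis M s" and "sbases M = s_class Z M s"
  shows "based_module Z M"
  using assms unfolding based_module_def by blast

text \<open>
  A simple isomorphism is given by one pair of stable bases, but it relates all of them, since the
  distinguished bases on each side are equivalent. Conversely one equivalent pair is enough, as
  \<open>simple_isoI\<close> shows by stabilizing it to a common rank.
\<close>

lemma simple_isoD:
  assumes M: "weakly_based M" and N: "weakly_based N" and f: "f \<in> simple_iso Z M N"
  shows "f \<in> mod_iso M N"
    and "s \<in> sbases M \<Longrightarrow> t \<in> sbases N \<Longrightarrow> s_equiv Z N (map_sbasis f s) t"
proof -
  note wM = weakly_basedD[OF M] and wN = weakly_basedD[OF N]
  show fi: "f \<in> mod_iso M N" using f by (simp add: simple_iso_def)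
  obtain m b c A where *: "(m, b) \<in> sbases M" "(m, c) \<in> sbases N"
    "expressed_by (mod_sum N (free_mod m)) A (map (map_prod f id) b) c" "torsion A \<in> Z"
    using f unfolding simple_iso_def by blast
  have fb: "s_basis N (map_sbasis f s)" if "s \<in> sbases M" for s
    by (rule s_basis_map[OF wM(1) wN(1) fi wM(3)[OF that]])
  have 1: "s_equiv Z N (map_sbasis f (m, b)) (m, c)"
    by (rule s_equivI) (use * in \<open>auto simp: zrel_def snd_map_sbasis\<close>)
  show "s_equiv Z N (map_sbasis f s) t" if s: "s \<in> sbases M" and t: "t \<in> sbases N"
  proof -
    have "s_equiv Z N (map_sbasis f s) (map_sbasis f (m, b))"
      by (rule s_equiv_map[OF wM(1) mod_isoD(1)[OF fi] wM(3)[OF *(1)] wM(5)[OF s *(1)]])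
    then have "s_equiv Z N (map_sbasis f s) (m, c)"
      by (rule s_equiv_trans[OF wN(1) fb[OF s] fb[OF *(1)] wN(3)[OF *(2)] _ 1])
    then show ?thesis
      by (rule s_equiv_trans[OF wN(1) fb[OF s] wN(3)[OF *(2)] wN(3)[OF t] _ wN(5)[OF *(2) t]])
  qed
qed

lemma simple_isoI:
  assumes M: "weakly_based M" and N: "weakly_based N" and f: "f \<in> mod_iso M N"
    and s: "s \<in> sbases M" and t: "t \<in> sbases N" and st: "s_equiv Z N (map_sbasis f s) t"
  shows "f \<in> simple_iso Z M N"
proof -
  note wM = weakly_basedD[OF M] and wN = weakly_basedD[OF N]
  obtain k l where kl: "fst s + k = fst t + l"
    "zrel (stab_mod N (fst s + k)) (snd (stabilize k (map_sbasis f s))) (snd (stabilize l t))"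
    using st by (auto simp: s_equiv_iff)
  have f0: "f 0 = 0" by (rule mod_hom_zero[OF wM(1) mod_isoD(1)[OF f]])
  have "(fst s + k, snd (stabilize k s)) \<in> sbases M"
    using wM(4)[OF s, of k] by (metis fst_stabilize prod.collapse)
  moreover have "(fst s + k, snd (stabilize l t)) \<in> sbases N"
    using wN(4)[OF t, of l] kl(1) by (metis fst_stabilize prod.collapse)
  moreover have "zrel (stab_mod N (fst s + k)) (map (map_prod f id) (snd (stabilize k s))) (snd (stabilize l t))"
    using kl(2) by (simp only: map_sbasis_stabilize[of f, OF f0, symmetric] snd_map_sbasis)
  ultimately show ?thesis
    using f unfolding simple_iso_def zrel_def by blast
qed

lemma simple_iso_cong:
  assumes M: "weakly_based M" and N: "weakly_based N" and f: "f \<in> simple_iso Z M N"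
    and eq: "\<And>x. x \<in> carrier M \<Longrightarrow> f x = g x"
  shows "g \<in> simple_iso Z M N"
proof -
  note wM = weakly_basedD[OF M] and fD = simple_isoD[OF M N f]
  have "g \<in> mod_hom M N"
    using mod_homD[OF mod_isoD(1)[OF fD(1)]] eq left_moduleD[OF wM(1)]
    by (intro mod_homI) metis+
  moreover have "bij_betw g (carrier M) (carrier N)"
    using mod_isoD(2)[OF fD(1)] bij_betw_cong[of "carrier M" f g] eq by blast
  ultimately have g: "g \<in> mod_iso M N" by (simp add: mod_iso_def)
  obtain s t where st: "s \<in> sbases M" "t \<in> sbases N"
    using wM(2) weakly_basedD(2)[OF N] by blast
  have "map_sbasis f s = map_sbasis g s" by (rule map_sbasis_cong[OF wM(3)[OF st(1)] eq])
  then show ?thesis using simple_isoI[OF M N g st] fD(2)[OF st] by simp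
qed

lemma simple_iso_comp:
  assumes M: "weakly_based M" and N: "weakly_based N" and P: "weakly_based P"
    and f: "f \<in> simple_iso Z M N" and g: "g \<in> simple_iso Z N P"
  shows "(\<lambda>x. g (f x)) \<in> simple_iso Z M P"
proof -
  note wM = weakly_basedD[OF M] and wN = weakly_basedD[OF N] and wP = weakly_basedD[OF P]
  note fD = simple_isoD[OF M N f] and gD = simple_isoD[OF N P g]
  obtain s t u where st: "s \<in> sbases M" "t \<in> sbases N" "u \<in> sbases P"
    using wM(2) wN(2) wP(2) by blast
  have fs: "s_basis N (map_sbasis f s)" by (rule s_basis_map[OF wM(1) wN(1) fD(1) wM(3)[OF st(1)]])
  have "s_equiv Z P (map_sbasis g (map_sbasis f s)) (map_sbasis g t)"
    by (rule s_equiv_map[OF wN(1) mod_isoD(1)[OF gD(1)] wN(3)[OF st(2)] fD(2)[OF st(1,2)]])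
  then have "s_equiv Z P (map_sbasis g (map_sbasis f s)) u"
    by (rule s_equiv_trans[OF wP(1) s_basis_map[OF wN(1) wP(1) gD(1) fs]
        s_basis_map[OF wN(1) wP(1) gD(1) wN(3)[OF st(2)]] wP(3)[OF st(3)] _ gD(2)[OF st(2,3)]])
  then show ?thesis
    unfolding map_sbasis_comp by (rule simple_isoI[OF M P mod_iso_comp[OF fD(1) gD(1)] st(1,3)])
qed

lemma simple_iso_id:
  assumes M: "weakly_based M" and eq: "\<And>x. x \<in> carrier M \<Longrightarrow> f x = x"
  shows "f \<in> simple_iso Z M M"
proof (rule simple_iso_cong[OF M M])
  note wM = weakly_basedD[OF M]
  obtain s where s: "s \<in> sbases M" using wM(2) by blast
  have "map_sbasis id s = s" by (rule map_sbasis_id_on[OF wM(3)[OF s]]) simp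
  then show "id \<in> simple_iso Z M M" using simple_isoI[OF M M mod_iso_id s s] wM(5)[OF s s] by simp
qed (use eq in simp)

lemma simple_iso_inverse:
  assumes M: "weakly_based M" and N: "weakly_based N" and f: "f \<in> simple_iso Z M N"
  obtains g where "g \<in> simple_iso Z N M"
    "\<And>x. x \<in> carrier M \<Longrightarrow> g (f x) = x" "\<And>y. y \<in> carrier N \<Longrightarrow> f (g y) = y"
proof -
  note wM = weakly_basedD[OF M] and wN = weakly_basedD[OF N] and fD = simple_isoD[OF M N f]
  obtain g where g: "g \<in> mod_iso N M" "\<And>x. x \<in> carrier M \<Longrightarrow> g (f x) = x"
    "\<And>y. y \<in> carrier N \<Longrightarrow> f (g y) = y"
    using mod_iso_inverse[OF wM(1) fD(1)] by blast
  obtain s t where st: "s \<in> sbases M" "t \<in> sbases N" using wM(2) wN(2) by blast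
  have "s_equiv Z M (map_sbasis g (map_sbasis f s)) (map_sbasis g t)"
    by (rule s_equiv_map[OF wN(1) mod_isoD(1)[OF g(1)] wN(3)[OF st(2)] fD(2)[OF st]])
  moreover have "map_sbasis g (map_sbasis f s) = s"
    unfolding map_sbasis_comp by (rule map_sbasis_id_on[OF wM(3)[OF st(1)] g(2)])
  ultimately have "s_equiv Z M (map_sbasis g t) s"
    using s_equiv_sym[OF wM(1) s_basis_map[OF wN(1) wM(1) g(1) wN(3)[OF st(2)]], of s] by simp
  then have "g \<in> simple_iso Z N M" by (rule simple_isoI[OF N M g(1) st(2,1)])
  then show ?thesis using that g(2,3) by blast
qed

text \<open>
  The target contains every stable basis equivalent to a distinguished one, hence the image of a
  distinguished basis. This makes duals functorial for simple isomorphisms.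
\<close>

lemma simple_iso_mem_sbases:
  assumes M: "weakly_based M" and N: "based_module Z N" and f: "f \<in> simple_iso Z M N"
    and s: "s \<in> sbases M"
  shows "map_sbasis f s \<in> sbases N"
proof -
  note wM = weakly_basedD[OF M] and wN = weakly_basedD[OF based_moduleD(1)[OF N]]
  note fD = simple_isoD[OF M based_moduleD(1)[OF N] f]
  obtain t where t: "t \<in> sbases N" using wN(2) by blast
  have fs: "s_basis N (map_sbasis f s)" by (rule s_basis_map[OF wM(1) wN(1) fD(1) wM(3)[OF s]])
  show ?thesis
    by (rule based_moduleD(2)[OF N t fs s_equiv_sym[OF wN(1) wN(3)[OF t] fD(2)[OF s t]]])
qed

lemma carrier_based_sum [simp]: "carrier (based_sum Z M N) = carrier M \<times> carrier N"
  by (simp add: based_sum_def)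

lemma scl_based_sum [simp]: "scl (based_sum Z M N) = scl (mod_sum M N)"
  by (simp add: based_sum_def)

lemma left_module_cong:
  "carrier M = carrier N \<Longrightarrow> scl M = scl N \<Longrightarrow> left_module M \<longleftrightarrow> left_module N"
  by (simp add: left_module_def)

lemma mod_hom_cong:
  "carrier M = carrier M' \<Longrightarrow> scl M = scl M' \<Longrightarrow> carrier N = carrier N' \<Longrightarrow> scl N = scl N' \<Longrightarrow>
    mod_hom M N = mod_hom M' N'"
  by (simp add: mod_hom_def)

lemma mod_iso_cong:
  "carrier M = carrier M' \<Longrightarrow> scl M = scl M' \<Longrightarrow> carrier N = carrier N' \<Longrightarrow> scl N = scl N' \<Longrightarrow>
    mod_iso M N = mod_iso M' N'"
  using mod_hom_cong[of M M' N N'] by (simp add: mod_iso_def)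

lemma mod_sum_cong:
  "carrier M = carrier M' \<Longrightarrow> scl M = scl M' \<Longrightarrow> mod_sum M N = mod_sum M' N"
  by (simp add: mod_sum_def)

lemma s_basis_cong:
  "carrier M = carrier M' \<Longrightarrow> scl M = scl M' \<Longrightarrow> s_basis M s \<longleftrightarrow> s_basis M' s"
  using mod_sum_cong[of M M' "free_mod (fst s)"] by (simp add: s_basis_def)

lemma s_equiv_cong:
  "carrier M = carrier M' \<Longrightarrow> scl M = scl M' \<Longrightarrow> s_equiv Z M s t \<longleftrightarrow> s_equiv Z M' s t"
  using mod_sum_cong[of M M' "free_mod (_ :: nat)"] by (simp add: s_equiv_def)

lemma s_class_cong:
  "carrier M = carrier M' \<Longrightarrow> scl M = scl M' \<Longrightarrow> s_class Z M s = s_class Z M' s"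
  using s_basis_cong[of M M'] s_equiv_cong[of M M' s] by (simp add: s_class_def)

lemma based_sum_as_mod_sum:
  "left_module (based_sum Z M N) \<longleftrightarrow> left_module (mod_sum M N)"
  "s_basis (based_sum Z M N) s \<longleftrightarrow> s_basis (mod_sum M N) s"
  "s_equiv Z (based_sum Z M N) s t \<longleftrightarrow> s_equiv Z (mod_sum M N) s t"
  "s_class Z (based_sum Z M N) s = s_class Z (mod_sum M N) s"
  by (intro left_module_cong s_basis_cong s_equiv_cong s_class_cong; simp)+

text \<open>
  The distinguished bases of a sum are defined as a union of equivalence classes. These coincide by
  \<open>s_equiv_sum\<close>.
\<close>

lemma based_module_sum:
  assumes M: "weakly_based M" and N: "weakly_based N"
  shows "based_module Z (based_sum Z M N)"
    and "s \<in> sbases M \<Longrightarrow> t \<in> sbases N \<Longrightarrow> sum_sbasis s t \<in> sbases (based_sum Z M N)"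
proof -
  note wM = weakly_basedD[OF M] and wN = weakly_basedD[OF N]
  let ?S = "mod_sum M N"
  have S: "left_module ?S" using wM wN by simp
  have bas: "s_basis ?S (sum_sbasis s t)" if "s \<in> sbases M" "t \<in> sbases N" for s t
    using s_basis_sum[OF wM(1) wN(1)] wM(3) wN(3) that by blast
  show mem: "sum_sbasis s t \<in> sbases (based_sum Z M N)" if st: "s \<in> sbases M" "t \<in> sbases N" for s t
    using st bas[OF st] s_equiv_refl[OF S bas[OF st]] by (auto simp: based_sum_def s_class_def)
  obtain s t where st: "s \<in> sbases M" "t \<in> sbases N" using wM(2) wN(2) by blast
  have "sbases (based_sum Z M N) = s_class Z ?S (sum_sbasis s t)"
  proof
    show "s_class Z ?S (sum_sbasis s t) \<subseteq> sbases (based_sum Z M N)"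
      using st by (auto simp: based_sum_def)
    show "sbases (based_sum Z M N) \<subseteq> s_class Z ?S (sum_sbasis s t)"
    proof
      fix u assume "u \<in> sbases (based_sum Z M N)"
      then obtain s' t' where st': "s' \<in> sbases M" "t' \<in> sbases N" and u: "s_basis ?S u" "s_equiv Z ?S (sum_sbasis s' t') u"
        by (auto simp: based_sum_def s_class_def)
      have "s_equiv Z ?S (sum_sbasis s t) (sum_sbasis s' t')"
        using st st' by (intro s_equiv_sum wM wN)
      then have "s_equiv Z ?S (sum_sbasis s t) u"
        by (rule s_equiv_trans[OF S bas[OF st] bas[OF st'] u(1) _ u(2)])
      then show "u \<in> s_class Z ?S (sum_sbasis s t)" using u by (simp add: s_class_def)
    qed
  qed
  then show "based_module Z (based_sum Z M N)"
    using S bas[OF st] based_moduleI[of "based_sum Z M N" "sum_sbasis s t"]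
    by (simp add: based_sum_as_mod_sum)
qed

lemma weakly_based_sum: "weakly_based M \<Longrightarrow> weakly_based N \<Longrightarrow> weakly_based (based_sum Z M N)"
  by (rule based_moduleD(1)[OF based_module_sum(1)])

lemma simple_iso_sum:
  assumes M: "weakly_based M" and M': "weakly_based M'" and N: "weakly_based N" and N': "weakly_based N'"
    and f: "f \<in> simple_iso Z M M'" and g: "g \<in> simple_iso Z N N'"
  shows "map_prod f g \<in> simple_iso Z (based_sum Z M N) (based_sum Z M' N')"
proof -
  note wM = weakly_basedD[OF M] and wN = weakly_basedD[OF N]
  note wM' = weakly_basedD[OF M'] and wN' = weakly_basedD[OF N']
  note fD = simple_isoD[OF M M' f] and gD = simple_isoD[OF N N' g]
  obtain s t where st: "s \<in> sbases M" "t \<in> sbases N" using wM(2) wN(2) by blast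
  obtain s' t' where st': "s' \<in> sbases M'" "t' \<in> sbases N'" using wM'(2) wN'(2) by blast
  have zero: "f 0 = 0" "g 0 = 0"
    using mod_hom_zero[OF wM(1) mod_isoD(1)[OF fD(1)]] mod_hom_zero[OF wN(1) mod_isoD(1)[OF gD(1)]] by auto
  show ?thesis
  proof (rule simple_isoI[OF weakly_based_sum[OF M N] weakly_based_sum[OF M' N'] _
        based_module_sum(2)[OF M N st] based_module_sum(2)[OF M' N' st']])
    show "map_prod f g \<in> mod_iso (based_sum Z M N) (based_sum Z M' N')"
      using mod_iso_map_prod[OF fD(1) gD(1)]
        mod_iso_cong[of "based_sum Z M N" "mod_sum M N" "based_sum Z M' N'" "mod_sum M' N'"] by simp
    show "s_equiv Z (based_sum Z M' N') (map_sbasis (map_prod f g) (sum_sbasis s t)) (sum_sbasis s' t')"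
      unfolding sum_sbasis_map[of f g, OF zero] based_sum_as_mod_sum
      by (intro s_equiv_sum wM'(1) wN'(1) fD(2) gD(2) st st' s_basis_map[OF wM(1) wM'(1) fD(1)]
          s_basis_map[OF wN(1) wN'(1) gD(1)] wM(3) wN(3) wM'(3) wN'(3))
  qed
qed

text \<open>
  The bases of the two sums differ in the order of the two lists and of the free coordinates.
\<close>

lemma simple_iso_swap:
  fixes M :: "('a, 'm::ab_group_add) based" and N :: "('a, 'n::ab_group_add) based"
  assumes M: "weakly_based M" and N: "weakly_based N"
  shows "prod.swap \<in> simple_iso Z (based_sum Z M N) (based_sum Z N M)"
proof -
  note wM = weakly_basedD[OF M] and wN = weakly_basedD[OF N]
  obtain s t where st: "s \<in> sbases M" "t \<in> sbases N" using wM(2) wN(2) by blast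
  have iso: "prod.swap \<in> mod_iso (based_sum Z M N) (based_sum Z N M)"
  proof (rule mod_isoI_inverse[where g = prod.swap])
    show "prod.swap \<in> mod_hom (based_sum Z M N) (based_sum Z N M)"
      by (rule mod_homI) auto
  qed auto
  let ?p = "block_swap 0 (fst t) (fst s)"
  have mem: "sum_sbasis s t \<in> sbases (based_sum Z M N)" "sum_sbasis t s \<in> sbases (based_sum Z N M)"
    using based_module_sum(2)[OF M N st] based_module_sum(2)[OF N M st(2,1)] by auto
  have bas: "s_basis (based_sum Z N M) (map_sbasis prod.swap (sum_sbasis s t))"
    by (rule s_basis_map[OF weakly_basedD(1)[OF weakly_based_sum[OF M N]]
          weakly_basedD(1)[OF weakly_based_sum[OF N M]] iso weakly_basedD(3)[OF weakly_based_sum[OF M N] mem(1)]])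
  have 1: "map (permute_coords ?p) (map (\<lambda>(x, v). ((0 :: 'n, x), v)) (snd s)) =
      map (\<lambda>(x, v). ((0, x), shift_vec (fst t) v)) (snd s)"
    using block_swap_first[of _ "fst s" 0 "fst t"]
    by (intro map_permute_coords[OF wM(3)[OF st(1)]]) (simp add: shift_vec_def)
  have 2: "map (permute_coords ?p) (map (\<lambda>(y, w). ((y, 0 :: 'm), shift_vec (fst s) w)) (snd t)) =
      map (\<lambda>(y, w). ((y, 0), w)) (snd t)"
    using block_swap_second[of _ "fst t" 0 "fst s"]
    by (intro map_permute_coords[OF wN(3)[OF st(2)]]) (simp add: shift_vec_def)
  have eq: "snd (map_sbasis prod.swap (sum_sbasis s t)) =
     map (\<lambda>(x, v). ((0, x), v)) (snd s) @ map (\<lambda>(y, w). ((y, 0), shift_vec (fst s) w)) (snd t)"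
    by (simp add: map_sbasis_def sum_sbasis_def case_prod_beta)
  have "s_equiv Z (based_sum Z N M) (map_sbasis prod.swap (sum_sbasis s t)) (sum_sbasis t s)"
  proof (rule s_equiv_block_swap[where u = 0 and k = "fst t" and l = "fst s"])
    show "mset (snd (sum_sbasis t s)) = mset (map (permute_coords ?p) (snd (map_sbasis prod.swap (sum_sbasis s t))))"
      unfolding eq map_append 1 2 by (simp add: sum_sbasis_def)
  qed (use bas weakly_basedD(1)[OF weakly_based_sum[OF N M]] in auto)
  then show ?thesis
    by (rule simple_isoI[OF weakly_based_sum[OF M N] weakly_based_sum[OF N M] iso mem])
qed

text \<open>
  Exchanging the middle terms only permutes basis vectors and free coordinates. This is what
  turns the splittings of two Lagrangians into a splitting of their sum.
\<close>

lemma simple_iso_middle_swap: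
  fixes A :: "('a, 'b::ab_group_add) based" and B :: "('a, 'c::ab_group_add) based"
    and C :: "('a, 'd::ab_group_add) based" and D :: "('a, 'e::ab_group_add) based"
  assumes A: "weakly_based A" and B: "weakly_based B" and C: "weakly_based C" and D: "weakly_based D"
  shows "(\<lambda>((w, x), (y, z)). ((w, y), (x, z))) \<in> simple_iso Z
    (based_sum Z (based_sum Z A B) (based_sum Z C D)) (based_sum Z (based_sum Z A C) (based_sum Z B D))"
    (is "?f \<in> simple_iso Z ?M ?N")
proof -
  note wA = weakly_basedD[OF A] and wB = weakly_basedD[OF B]
  note wC = weakly_basedD[OF C] and wD = weakly_basedD[OF D]
  have M: "weakly_based ?M" and N: "weakly_based ?N" by (intro weakly_based_sum A B C D)+
  obtain a b c d where abcd: "a \<in> sbases A" "b \<in> sbases B" "c \<in> sbases C" "d \<in> sbases D"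
    using wA(2) wB(2) wC(2) wD(2) by blast
  let ?s = "sum_sbasis (sum_sbasis a b) (sum_sbasis c d)" and ?t = "sum_sbasis (sum_sbasis a c) (sum_sbasis b d)"
  have mem: "?s \<in> sbases ?M" "?t \<in> sbases ?N"
    by (intro based_module_sum(2) weakly_based_sum A B C D abcd)+
  have iso: "?f \<in> mod_iso ?M ?N"
  proof (rule mod_isoI_inverse[where g = "\<lambda>((w, y), (x, z)). ((w, x), (y, z))"])
    show "?f \<in> mod_hom ?M ?N"
      by (rule mod_homI) (auto simp: mod_sum_def)
  qed auto
  have bas: "s_basis ?N (map_sbasis ?f ?s)"
    by (rule s_basis_map[OF weakly_basedD(1)[OF M] weakly_basedD(1)[OF N] iso weakly_basedD(3)[OF M mem(1)]])
  let ?p = "block_swap (fst a) (fst c) (fst b)"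
  have 1: "map (permute_coords ?p) (map (\<lambda>(x, v). (((x, 0 :: 'd), (0 :: 'c, 0 :: 'e)), v)) (snd a)) =
      map (\<lambda>(x, v). (((x, 0), (0, 0)), v)) (snd a)"
    by (intro map_permute_coords[OF wA(3)[OF abcd(1)]]) (simp add: block_swap_below)
  have 2: "map (permute_coords ?p) (map (\<lambda>(x, v). (((0 :: 'b, 0 :: 'd), (x, 0 :: 'e)), shift_vec (fst a) v)) (snd b)) =
      map (\<lambda>(x, v). (((0, 0), (x, 0)), shift_vec (fst a + fst c) v)) (snd b)"
    by (intro map_permute_coords[OF wB(3)[OF abcd(2)]]) (simp add: block_swap_first)
  have 3: "map (permute_coords ?p) (map (\<lambda>(x, v). (((0 :: 'b, x), (0 :: 'c, 0 :: 'e)), shift_vec (fst a + fst b) v)) (snd c)) =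
      map (\<lambda>(x, v). (((0, x), (0, 0)), shift_vec (fst a) v)) (snd c)"
    by (intro map_permute_coords[OF wC(3)[OF abcd(3)]]) (simp add: block_swap_second)
  have 4: "map (permute_coords ?p) (map (\<lambda>(x, v). (((0 :: 'b, 0 :: 'd), (0 :: 'c, x)), shift_vec (fst a + fst c + fst b) v)) (snd d)) =
      map (\<lambda>(x, v). (((0, 0), (0, x)), shift_vec (fst a + fst c + fst b) v)) (snd d)"
    by (intro map_permute_coords[OF wD(3)[OF abcd(4)]]) (simp add: block_swap_above)
  have eq: "snd (map_sbasis ?f ?s) =
     map (\<lambda>(x, v). (((x, 0), (0, 0)), v)) (snd a) @ map (\<lambda>(x, v). (((0, 0), (x, 0)), shift_vec (fst a) v)) (snd b) @
     map (\<lambda>(x, v). (((0, x), (0, 0)), shift_vec (fst a + fst b) v)) (snd c) @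
     map (\<lambda>(x, v). (((0, 0), (0, x)), shift_vec (fst a + fst c + fst b) v)) (snd d)"
    by (simp add: map_sbasis_def sum_sbasis_def case_prod_beta zero_prod_def shift_vec_shift_vec ac_simps)
  have "s_equiv Z ?N (map_sbasis ?f ?s) ?t"
  proof (rule s_equiv_block_swap[where u = "fst a" and k = "fst c" and l = "fst b"])
    show "mset (snd ?t) = mset (map (permute_coords ?p) (snd (map_sbasis ?f ?s)))"
      unfolding eq map_append 1 2 3 4
      by (simp add: sum_sbasis_def case_prod_unfold zero_prod_def shift_vec_shift_vec ac_simps comp_def)
  qed (use bas weakly_basedD(1)[OF N] in auto)
  then show ?thesis by (rule simple_isoI[OF M N iso mem])
qed

lemma mod_rank_sum:
  assumes wf: "weakly_finite TYPE('a)" and M: "weakly_based M" and N: "weakly_based N"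
  shows "mod_rank (based_sum Z M N) = mod_rank M + mod_rank N"
proof -
  note wM = weakly_basedD[OF M] and wN = weakly_basedD[OF N]
  obtain s t where st: "s \<in> sbases M" "t \<in> sbases N" using wM(2) wN(2) by blast
  note S = weakly_basedD[OF weakly_based_sum[OF M N]]
  show ?thesis
    using mod_rank_eq[OF wf wM(1) wM(3)[OF st(1)]] mod_rank_eq[OF wf wN(1) wN(3)[OF st(2)]]
      mod_rank_eq[OF wf S(1) S(3)[OF based_module_sum(2)[OF M N st]]]
    by (simp add: sum_sbasis_def)
qed

lemma mod_rank_iso:
  assumes wf: "weakly_finite TYPE('a)" and M: "weakly_based M" and N: "weakly_based N"
    and f: "f \<in> mod_iso M N"
  shows "mod_rank M = mod_rank N"
proof -
  note wM = weakly_basedD[OF M] and wN = weakly_basedD[OF N]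
  obtain s where s: "s \<in> sbases M" using wM(2) by blast
  show ?thesis
    using mod_rank_eq[OF wf wM(1) wM(3)[OF s]]
      mod_rank_eq[OF wf wN(1) s_basis_map[OF wM(1) wN(1) f wM(3)[OF s]]]
    by (simp add: snd_map_sbasis)
qed

lemma carrier_based_image [simp]: "carrier (based_image N f M) = f ` carrier M"
  by (simp add: based_image_def)

lemma scl_based_image [simp]: "scl (based_image N f M) = scl N"
  by (simp add: based_image_def)

lemma sbases_based_image: "sbases (based_image N f M) = map_sbasis f ` sbases M"
  by (simp add: based_image_def)

lemma left_module_image:
  assumes M: "left_module M" and f: "f \<in> mod_hom M N"
  shows "left_module \<lparr>carrier = f ` carrier M, scl = scl N\<rparr>"
proof -
  have mul: "scl N a (f x) = f (scl M a x)" if "x \<in> carrier M" for a x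
    using mod_homD(3)[OF f that] by simp
  have add: "f x + f y = f (x + y)" if "x \<in> carrier M" "y \<in> carrier M" for x y
    using mod_homD(2)[OF f that] by simp
  have neg: "- f x = f (- x)" if "x \<in> carrier M" for x
    using mod_homD(2)[OF f that left_moduleD(3)[OF M that]] mod_hom_zero[OF M f]
    by (simp add: minus_unique)
  show ?thesis
    unfolding left_module_def partial_object.simps lmod.simps
    by (intro conjI ballI allI; (elim imageE)?; hypsubst?)
       (auto simp: mul add neg left_moduleD[OF M] mod_hom_zero[OF M f, symmetric]
         intro!: imageI left_moduleD[OF M] image_eqI[of _ _ 0])
qed

lemma based_image_iso:
  assumes M: "left_module M" and f: "f \<in> mod_hom M N" and inj: "inj_on f (carrier M)"
  shows "f \<in> mod_iso M (based_image N f M)" "left_module (based_image N f M)"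
proof -
  show "f \<in> mod_iso M (based_image N f M)"
    using mod_homD[OF f] inj unfolding mod_iso_def
    by (auto intro!: mod_homI simp: inj_on_imp_bij_betw)
  show "left_module (based_image N f M)"
    using left_module_image[OF M f]
      left_module_cong[of "based_image N f M" "\<lparr>carrier = f ` carrier M, scl = scl N\<rparr>"] by simp
qed

lemma based_module_image:
  assumes M: "weakly_based M" and f: "f \<in> mod_hom M N" and inj: "inj_on f (carrier M)"
  shows "weakly_based (based_image N f M)" "f \<in> simple_iso Z M (based_image N f M)"
    and "based_module Z M \<Longrightarrow> based_module Z (based_image N f M)"
proof -
  let ?I = "based_image N f M"
  note wM = weakly_basedD[OF M]
  note I = based_image_iso[OF wM(1) f inj]
  have zero: "f 0 = 0" by (rule mod_hom_zero[OF wM(1) f])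
  have bas: "s_basis ?I (map_sbasis f s)" if "s_basis M s" for s
    by (rule s_basis_map[OF wM(1) I(2,1) that])
  have equiv: "s_equiv Z ?I (map_sbasis f s) (map_sbasis f t)" if "s_basis M t" "s_equiv Z M s t" for s t
    by (rule s_equiv_map[OF wM(1) mod_isoD(1)[OF I(1)] that])
  show w: "weakly_based ?I"
    unfolding weakly_based_def sbases_based_image
    using I(2) wM(2,3,4,5) bas equiv
    by (auto simp: map_sbasis_stabilize[of f, OF zero, symmetric])
  obtain s where s: "s \<in> sbases M" using wM(2) by blast
  then have fs: "map_sbasis f s \<in> sbases ?I" by (simp add: sbases_based_image)
  show "f \<in> simple_iso Z M ?I"
    by (rule simple_isoI[OF M w I(1) s fs weakly_basedD(5)[OF w fs fs]])
  show "based_module Z ?I" if B: "based_module Z M"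
  proof (rule based_moduleI[OF I(2) bas[OF wM(3)[OF s]]])
    obtain g where g: "g \<in> mod_iso ?I M" "\<And>x. x \<in> carrier M \<Longrightarrow> g (f x) = x"
      "\<And>y. y \<in> carrier ?I \<Longrightarrow> f (g y) = y"
      using mod_iso_inverse[OF wM(1) I(1)] by blast
    show "sbases ?I = s_class Z ?I (map_sbasis f s)"
    proof
      show "sbases ?I \<subseteq> s_class Z ?I (map_sbasis f s)"
      proof
        fix t assume t: "t \<in> sbases ?I"
        show "t \<in> s_class Z ?I (map_sbasis f s)"
          using weakly_basedD(3)[OF w t] weakly_basedD(5)[OF w fs t] by (simp add: s_class_def)
      qed
      show "s_class Z ?I (map_sbasis f s) \<subseteq> sbases ?I"
      proof
        fix t assume "t \<in> s_class Z ?I (map_sbasis f s)"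
        then have t: "s_basis ?I t" "s_equiv Z ?I (map_sbasis f s) t" by (auto simp: s_class_def)
        have "map_sbasis g (map_sbasis f s) = s"
          unfolding map_sbasis_comp by (rule map_sbasis_id_on[OF wM(3)[OF s] g(2)])
        then have "s_equiv Z M s (map_sbasis g t)"
          using s_equiv_map[OF I(2) mod_isoD(1)[OF g(1)] t] by simp
        then have "map_sbasis g t \<in> sbases M"
          by (rule based_moduleD(2)[OF B s s_basis_map[OF I(2) wM(1) g(1) t(1)]])
        moreover have "map_sbasis f (map_sbasis g t) = t"
          unfolding map_sbasis_comp by (rule map_sbasis_id_on[OF t(1) g(3)])
        ultimately show "t \<in> sbases ?I" unfolding sbases_based_image by (metis imageI)
      qed
    qed
  qed
qed

end

section \<open>Duals\<close>

locale form_setting = torsion_subgroup Z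
  for Z :: "'a::ring_1 smat set set set" +
  fixes bar :: "'a \<Rightarrow> 'a" and \<epsilon> :: 'a
  assumes involution: "ring_involution bar"
    and weakly_finite: "weakly_finite TYPE('a)"
    and adjoint_Z: "adjoint_invariant bar Z"
    and sign: "\<epsilon> = 1 \<or> \<epsilon> = - 1"
begin

lemma bar_simps [simp]:
  "bar (a + b) = bar a + bar b" "bar (a * b) = bar b * bar a" "bar 1 = 1" "bar (bar a) = a"
  using involution by (auto simp: ring_involution_def)

lemma bar_zero [simp]: "bar 0 = 0"
  using bar_simps(1)[of 0 0] by simp

lemma bar_minus [simp]: "bar (- a) = - bar a"
  using bar_simps(1)[of a "- a"] by (simp add: minus_unique)

lemma bar_sum: "bar (\<Sum>i\<in>I. f i) = (\<Sum>i\<in>I. bar (f i))"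
  by (induction I rule: infinite_finite_induct) auto

lemma bar_eq_zero [simp]: "bar a = 0 \<longleftrightarrow> a = 0"
  by (metis bar_simps(4) bar_zero)

lemma bar_sign [simp]: "bar \<epsilon> = \<epsilon>"
  using sign by auto

lemma smat_adjoint_mult:
  assumes A: "A \<in> smat_block n" and B: "B \<in> smat_block n"
  shows "smat_adjoint bar (smat_mult A B) = smat_mult (smat_adjoint bar B) (smat_adjoint bar A)"
proof (intro ext)
  fix i j
  let ?N = "max n (Suc (max i j))"
  have B': "smat_adjoint bar B \<in> smat_block n"
    using B by (auto simp: smat_adjoint_def smat_block_def smat_one_def)
  have "smat_adjoint bar (smat_mult A B) i j = (\<Sum>k<?N. bar (B k i) * bar (A j k))"
    unfolding smat_adjoint_def
    by (subst smat_mult_eq_sum[OF A, of ?N]) (auto simp: bar_sum)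
  also have "\<dots> = smat_mult (smat_adjoint bar B) (smat_adjoint bar A) i j"
    by (subst smat_mult_eq_sum[OF B', of ?N]) (auto simp: smat_adjoint_def)
  finally show "smat_adjoint bar (smat_mult A B) i j = smat_mult (smat_adjoint bar B) (smat_adjoint bar A) i j" .
qed

lemma smat_adjoint_GL_n:
  assumes "A \<in> GL_n n"
  shows "smat_adjoint bar A \<in> GL_n n"
proof -
  obtain B where B: "B \<in> GL_n n" "smat_mult A B = smat_one" "smat_mult B A = smat_one"
    using GL_n_inverse[OF assms] .
  have block: "smat_adjoint bar C \<in> smat_block n" if "C \<in> GL_n n" for C
    using GL_n_block[OF that] by (auto simp: smat_adjoint_def smat_block_def smat_one_def)
  have one: "smat_adjoint bar smat_one = smat_one"
    by (intro ext) (simp add: smat_adjoint_def smat_one_def)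
  have "smat_mult (smat_adjoint bar A) (smat_adjoint bar B) = smat_one"
    "smat_mult (smat_adjoint bar B) (smat_adjoint bar A) = smat_one"
    using smat_adjoint_mult[OF GL_n_block[OF B(1)] GL_n_block[OF assms]]
      smat_adjoint_mult[OF GL_n_block[OF assms] GL_n_block[OF B(1)]] B one by simp_all
  then show ?thesis unfolding GL_n_def using block[OF assms] block[OF B(1)] by blast
qed

lemma dual_lmod_carrier:
  "\<phi> \<in> carrier (dual_lmod bar M) \<longleftrightarrow> (\<forall>x\<in>carrier M. \<forall>y\<in>carrier M. \<phi> (x + y) = \<phi> x + \<phi> y) \<and>
     (\<forall>a. \<forall>x\<in>carrier M. \<phi> (scl M a x) = a * \<phi> x) \<and> (\<forall>x. x \<notin> carrier M \<longrightarrow> \<phi> x = 0)"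
  by (auto simp: dual_lmod_def Hom_def mod_hom_def ring_mod_def)

lemma dual_lmodD:
  assumes "\<phi> \<in> carrier (dual_lmod bar M)"
  shows "x \<in> carrier M \<Longrightarrow> y \<in> carrier M \<Longrightarrow> \<phi> (x + y) = \<phi> x + \<phi> y"
    and "x \<in> carrier M \<Longrightarrow> \<phi> (scl M a x) = a * \<phi> x"
    and "x \<notin> carrier M \<Longrightarrow> \<phi> x = 0"
  using assms unfolding dual_lmod_carrier by blast+

lemma scl_dual_lmod [simp]: "scl (dual_lmod bar M) a \<phi> = (\<lambda>x. \<phi> x * bar a)"
  by (simp add: dual_lmod_def)

lemma carrier_dual [simp]: "carrier (dual bar M) = carrier (dual_lmod bar M)"
  by (simp add: dual_def)

lemma scl_dual [simp]: "scl (dual bar M) = scl (dual_lmod bar M)"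
  by (simp add: dual_def)

lemma left_module_dual_lmod:
  assumes M: "left_module M"
  shows "left_module (dual_lmod bar M)"
  unfolding left_module_def scl_dual_lmod
  by (intro conjI ballI allI)
     (auto simp: dual_lmod_carrier algebra_simps fun_eq_iff left_moduleD[OF M])

lemma dual_zero:
  assumes "left_module M" "\<phi> \<in> carrier (dual_lmod bar M)"
  shows "\<phi> 0 = 0"
  using dual_lmodD(1)[OF assms(2) left_moduleD(1)[OF assms(1)] left_moduleD(1)[OF assms(1)]] by simp

lemma s_pairing_add_right:
  assumes "c \<in> carrier (stab_mod (dual_lmod bar M) m)" "z \<in> carrier (stab_mod M m)" "z' \<in> carrier (stab_mod M m)"
  shows "s_pairing bar m c (z + z') = s_pairing bar m c z + s_pairing bar m c z'"
  using assms by (auto simp: s_pairing_def dual_lmodD(1)[of _ M] distrib_right sum.distrib algebra_simps)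

lemma s_pairing_scl_right:
  assumes "c \<in> carrier (stab_mod (dual_lmod bar M) m)" "z \<in> carrier (stab_mod M m)"
  shows "s_pairing bar m c (scl (stab_mod M m) a z) = a * s_pairing bar m c z"
  using assms by (auto simp: s_pairing_def dual_lmodD(2)[of _ M] distrib_left sum_distrib_left mult.assoc)

lemma s_pairing_add_left:
  "s_pairing bar m (c + c') z = s_pairing bar m c z + s_pairing bar m c' z"
  by (simp add: s_pairing_def distrib_left sum.distrib algebra_simps)

lemma s_pairing_diff_left:
  "s_pairing bar m (c - c') z = s_pairing bar m c z - s_pairing bar m c' z"
  using s_pairing_add_left[of m "c - c'" c' z] by simp

lemma s_pairing_scl_left:
  "s_pairing bar m (scl (stab_mod (dual_lmod bar M) m) a c) z = s_pairing bar m c z * bar a"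
  by (cases c) (simp add: s_pairing_def distrib_right sum_distrib_right mult.assoc)

lemma s_pairing_zero_left [simp]: "s_pairing bar m 0 z = 0"
  by (simp add: s_pairing_def)

lemma s_pairing_zero_right:
  "left_module M \<Longrightarrow> c \<in> carrier (stab_mod (dual_lmod bar M) m) \<Longrightarrow> s_pairing bar m c 0 = 0"
  by (auto simp: s_pairing_def dual_zero)

lemma s_pairing_hom:
  assumes "c \<in> carrier (stab_mod (dual_lmod bar M) m)"
  shows "s_pairing bar m c \<in> mod_hom (stab_mod M m) ring_mod"
  using s_pairing_add_right[OF assms] s_pairing_scl_right[OF assms]
  by (intro mod_homI) (auto simp: ring_mod_def simp del: carrier_mod_sum)

lemma s_pairing_lincomb_right:
  assumes M: "left_module M" and c: "c \<in> carrier (stab_mod (dual_lmod bar M) m)"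
    and b: "set b \<subseteq> carrier (stab_mod M m)"
  shows "s_pairing bar m c (lincomb (stab_mod M m) v b) = (\<Sum>i<length b. v i * s_pairing bar m c (b ! i))"
  using lincomb_hom[OF _ s_pairing_hom[OF c] b, of v] M
  by (simp add: lincomb_def ring_mod_def)

lemma s_pairing_lincomb_left:
  "s_pairing bar m (lincomb (stab_mod (dual_lmod bar M) m) v c) z =
     (\<Sum>i<length c. s_pairing bar m (c ! i) z * bar (v i))"
proof -
  have "s_pairing bar m (\<Sum>i\<in>I. f i) z = (\<Sum>i\<in>I. s_pairing bar m (f i) z)"
    for I :: "nat set" and f :: "nat \<Rightarrow> ('b \<Rightarrow> 'a) \<times> (nat \<Rightarrow> 'a)"
    by (induction I rule: infinite_finite_induct) (simp_all add: s_pairing_add_left)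
  then show ?thesis unfolding lincomb_def by (simp only: s_pairing_scl_left)
qed

text \<open>
  An element of the stabilized dual is determined by its values on a basis, because pairing
  with vectors of \<open>M\<close> recovers the functional and pairing with standard vectors recovers the coordinates.
\<close>

lemma s_pairing_nondegenerate:
  assumes M: "left_module M" and b: "is_basis (stab_mod M m) b"
    and c: "c \<in> carrier (stab_mod (dual_lmod bar M) m)"
    and zero: "\<And>j. j < length b \<Longrightarrow> s_pairing bar m c (b ! j) = 0"
  shows "c = 0"
proof -
  have SM: "left_module (stab_mod M m)" using M by simp
  have P: "s_pairing bar m c z = 0" if z: "z \<in> carrier (stab_mod M m)" for z
  proof -
    obtain v where "z = lincomb (stab_mod M m) v b" using basis_span[OF SM b z] by blast
    then show ?thesis using s_pairing_lincomb_right[OF M c basis_subset[OF b]] zero by simp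
  qed
  have "fst c x = 0" for x
  proof (cases "x \<in> carrier M")
    case True
    then show ?thesis using P[of "(x, 0)"] by (simp add: s_pairing_def)
  next
    case False
    then show ?thesis using c dual_lmodD(3)[of "fst c" M] by auto
  qed
  moreover have "snd c k = 0" for k
  proof (cases "k < m")
    case True
    have "(0, std_vec k) \<in> carrier (stab_mod M m)"
      using True left_moduleD(1)[OF M] by (simp add: carrier_free_mod std_vec_def)
    from P[OF this] have "(\<Sum>i<m. std_vec k i * bar (snd c i)) = 0"
      using \<open>\<And>x. fst c x = 0\<close> by (simp add: s_pairing_def)
    moreover have "(\<Sum>i<m. std_vec k i * bar (snd c i)) = (\<Sum>i<m. if i = k then bar (snd c k) else 0)"
      by (rule sum.cong) (auto simp: std_vec_def)
    ultimately show ?thesis using True by simp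
  next
    case False
    then show ?thesis using c by (auto simp: carrier_free_mod)
  qed
  ultimately show ?thesis by (auto simp: prod_eq_iff)
qed

definition dual_lists :: "nat \<Rightarrow> (('m::ab_group_add \<Rightarrow> 'a) \<times> (nat \<Rightarrow> 'a)) list \<Rightarrow> ('m \<times> (nat \<Rightarrow> 'a)) list \<Rightarrow> bool" where
  "dual_lists m c b \<longleftrightarrow> length b = length c \<and>
     (\<forall>i<length c. \<forall>j<length b. s_pairing bar m (c ! i) (b ! j) = (if i = j then 1 else 0))"

lemma dual_sbases:
  "(m, c) \<in> sbases (dual bar M) \<longleftrightarrow> s_basis (dual_lmod bar M) (m, c) \<and> (\<exists>b. (m, b) \<in> sbases M \<and> dual_lists m c b)"
  by (simp add: dual_def dual_lists_def)

text \<open>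
  The coefficients of \<open>y\<close> with respect to the dual basis are the conjugates of its values on the
  basis: the difference pairs trivially with all basis vectors.
\<close>

lemma dual_basisI:
  assumes M: "left_module M" and b: "is_basis (stab_mod M m) b"
    and c: "set c \<subseteq> carrier (stab_mod (dual_lmod bar M) m)" and d: "dual_lists m c b"
  shows "is_basis (stab_mod (dual_lmod bar M) m) c"
proof -
  let ?D = "stab_mod (dual_lmod bar M) m"
  have D: "left_module ?D" using left_module_dual_lmod[OF M] by simp
  have len: "length b = length c" using d by (simp add: dual_lists_def)
  have P: "s_pairing bar m (lincomb ?D w c) (b ! j) = bar (w j)" if "j < length c" for w j
  proof -
    have "s_pairing bar m (lincomb ?D w c) (b ! j) = (\<Sum>i<length c. if i = j then bar (w j) else 0)"
      unfolding s_pairing_lincomb_left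
      by (rule sum.cong) (use d that in \<open>auto simp: dual_lists_def\<close>)
    then show ?thesis using that by simp
  qed
  have "\<exists>w. y = lincomb ?D w c" if y: "y \<in> carrier ?D" for y
  proof -
    define w where "w = (\<lambda>i. bar (s_pairing bar m y (b ! i)))"
    have "y - lincomb ?D w c = 0"
      by (rule s_pairing_nondegenerate[OF M b left_module_diff[OF D y lincomb_closed[OF D c]]])
         (use len in \<open>simp add: s_pairing_diff_left P w_def\<close>)
    then show ?thesis by auto
  qed
  moreover have "w j = 0" if w: "lincomb ?D w c = 0" and j: "j < length c" for w j
    using P[OF j, of w] w by simp
  ultimately show ?thesis using c by (simp add: is_basis_iff[OF D])
qed

text \<open>
  The members of the dual basis are the coordinate functions. The functional on the free summand is
  encoded by the conjugates of its values on the standard basis.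
\<close>

lemma dual_basis_exists:
  assumes M: "left_module M" and b: "s_basis M (m, b)"
  obtains c where "s_basis (dual_lmod bar M) (m, c)" "dual_lists m c b"
proof -
  let ?S = "stab_mod M m"
  have S: "left_module ?S" using M by simp
  have b: "is_basis ?S b" using b by (simp add: s_basis_def)
  obtain g where g: "g \<in> mod_iso ?S (free_mod (length b))"
    "\<And>v. v \<in> carrier (free_mod (length b)) \<Longrightarrow> g (lincomb ?S v b) = v"
    using mod_iso_inverse[OF left_module_free_mod basis_iso[OF S b]] by blast
  note gh = mod_homD[OF mod_isoD(1)[OF g(1)]]
  define c where "c = map (\<lambda>i. (\<lambda>x. if x \<in> carrier M then g (x, 0) i else 0,
    \<lambda>k. if k < m then bar (g (0, std_vec k) i) else 0)) [0..<length b]"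
  have c_nth: "c ! i = (\<lambda>x. if x \<in> carrier M then g (x, 0) i else 0,
    \<lambda>k. if k < m then bar (g (0, std_vec k) i) else 0)" if "i < length b" for i
  proof -
    have "[0..<length b] ! i = i" using that by simp
    then show ?thesis using that by (simp only: c_def nth_map length_upt diff_zero)
  qed
  have len: "length c = length b" by (simp add: c_def)
  have sub: "set c \<subseteq> carrier (stab_mod (dual_lmod bar M) m)"
  proof
    fix y assume "y \<in> set c"
    then obtain i where i: "i < length b" "y = c ! i" using len by (metis in_set_conv_nth)
    have "(\<lambda>x. if x \<in> carrier M then g (x, 0) i else 0) \<in> carrier (dual_lmod bar M)"
      unfolding dual_lmod_carrier
    proof (intro conjI ballI allI impI)
      fix x y assume xy: "x \<in> carrier M" "y \<in> carrier M"
      have "g (x + y, 0) = g (x, 0) + g (y, 0)" using gh(2)[of "(x, 0)" "(y, 0)"] xy by simp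
      then show "(if x + y \<in> carrier M then g (x + y, 0) i else 0) =
        (if x \<in> carrier M then g (x, 0) i else 0) + (if y \<in> carrier M then g (y, 0) i else 0)"
        using xy left_moduleD(2)[OF M] by simp
    next
      fix a x assume x: "x \<in> carrier M"
      have "g (scl M a x, 0) = (\<lambda>i. a * g (x, 0) i)"
        using gh(3)[of "(x, 0)" a] x zero_fun_def[where 'a = nat and 'b = 'a, symmetric] by simp
      then show "(if scl M a x \<in> carrier M then g (scl M a x, 0) i else 0) =
        a * (if x \<in> carrier M then g (x, 0) i else 0)"
        using x left_moduleD(4)[OF M] by simp
    qed simp
    then show "y \<in> carrier (stab_mod (dual_lmod bar M) m)"
      using i by (simp add: c_nth carrier_free_mod)
  qed
  have P: "s_pairing bar m (c ! i) z = g z i" if i: "i < length b" and z: "z \<in> carrier ?S" for i z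
  proof -
    obtain x v where xv: "z = (x, v)" "x \<in> carrier M" "v \<in> carrier (free_mod m)" using z by auto
    have zv: "(0, v) \<in> carrier ?S" using xv left_moduleD(1)[OF M] by simp
    have hom: "(\<lambda>y. g (0, y)) \<in> mod_hom (free_mod m) (free_mod (length b))"
      using mod_hom_comp[OF inr_mod_hom[OF M] mod_isoD(1)[OF g(1)]] .
    have "lincomb (free_mod m) v (std_basis m) = v"
      using xv(3) by (auto simp: lincomb_std_basis carrier_free_mod)
    then have "g (0, v) = lincomb (free_mod (length b)) v (map (\<lambda>y. g (0, y)) (std_basis m))"
      using lincomb_hom[OF left_module_free_mod hom basis_subset[OF std_basis_is_basis], of v] by (simp only:)
    then have "g (0, v) i = (\<Sum>k<m. v k * g (0, std_vec k) i)"
      by (simp add: lincomb_def sum_fun_apply)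
    moreover have "g z = g (x, 0) + g (0, v)"
      using gh(2)[of "(x, 0)" "(0, v)"] xv zv by simp
    ultimately show ?thesis
      using i xv by (simp add: s_pairing_def c_nth)
  qed
  have G: "g (b ! j) i = (if i = j then 1 else 0)" if "j < length b" for i j
  proof -
    have "g (b ! j) = std_vec j"
      using g(2)[of "std_vec j"] lincomb_unit[OF S basis_subset[OF b] that] that
      by (simp add: std_vec_def carrier_free_mod)
    then show ?thesis by (simp add: std_vec_def)
  qed
  have d: "dual_lists m c b"
    unfolding dual_lists_def
  proof (intro conjI allI impI)
    fix i j assume ij: "i < length c" "j < length b"
    have "b ! j \<in> carrier ?S" by (rule subsetD[OF basis_subset[OF b] nth_mem[OF ij(2)]])
    then show "s_pairing bar m (c ! i) (b ! j) = (if i = j then 1 else 0)"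
      using P[of i "b ! j"] G[OF ij(2), of i] ij(1) len by (simp only:)
  qed (simp add: len)
  show ?thesis
    using that[of c] d dual_basisI[OF M b sub d] by (simp add: s_basis_def)
qed

text \<open>
  If \<open>b\<close> is obtained from \<open>b'\<close> by a matrix, then \<open>c'\<close> is obtained from \<open>c\<close> by its adjoint, as pairing
  with \<open>b\<close> shows. This is the place where \<open>Z\<close> has to be invariant under adjoints.
\<close>

lemma dual_lists_zrel:
  assumes M: "left_module M"
    and b: "is_basis (stab_mod M m) b" "is_basis (stab_mod M m) b'"
    and c: "set c \<subseteq> carrier (stab_mod (dual_lmod bar M) m)" "set c' \<subseteq> carrier (stab_mod (dual_lmod bar M) m)"
    and d: "dual_lists m c b" "dual_lists m c' b'"
    and rel: "zrel (stab_mod M m) b b'"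
  shows "zrel (stab_mod (dual_lmod bar M) m) c' c"
proof -
  let ?D = "stab_mod (dual_lmod bar M) m"
  have D: "left_module ?D" using left_module_dual_lmod[OF M] by simp
  obtain A where A: "expressed_by (stab_mod M m) A b b'" "torsion A \<in> Z" using rel by (auto simp: zrel_def)
  note A' = expressed_byD[OF A(1)]
  define n where "n = length c"
  have len: "length c = n" "length c' = n" "length b = n" "length b' = n"
    using A'(1) d by (auto simp: dual_lists_def n_def)
  have "c' ! i = lincomb ?D (smat_adjoint bar A i) c" if i: "i < n" for i
  proof -
    have ci: "c' ! i \<in> carrier ?D" by (rule subsetD[OF c(2) nth_mem]) (simp add: i len)
    have "c' ! i - lincomb ?D (smat_adjoint bar A i) c = 0"
    proof (rule s_pairing_nondegenerate[OF M b(1) left_module_diff[OF D ci lincomb_closed[OF D c(1)]]])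
      fix j assume "j < length b"
      then have j: "j < n" using len by simp
      have "s_pairing bar m (c' ! i) (b ! j) = (\<Sum>k<n. A j k * s_pairing bar m (c' ! i) (b' ! k))"
        using A'(3)[of j] j len s_pairing_lincomb_right[OF M ci basis_subset[OF b(2)]] by simp
      also have "\<dots> = (\<Sum>k<n. if k = i then A j i else 0)"
        by (rule sum.cong) (use d(2) i len in \<open>auto simp: dual_lists_def\<close>)
      finally have 1: "s_pairing bar m (c' ! i) (b ! j) = A j i" using i by simp
      have "s_pairing bar m (lincomb ?D (smat_adjoint bar A i) c) (b ! j) =
          (\<Sum>k<n. s_pairing bar m (c ! k) (b ! j) * A k i)"
        unfolding s_pairing_lincomb_left len by (simp add: smat_adjoint_def)
      also have "\<dots> = (\<Sum>k<n. if k = j then A j i else 0)"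
        by (rule sum.cong) (use d(1) j len in \<open>auto simp: dual_lists_def\<close>)
      finally have 2: "s_pairing bar m (lincomb ?D (smat_adjoint bar A i) c) (b ! j) = A j i"
        using j by simp
      show "s_pairing bar m (c' ! i - lincomb ?D (smat_adjoint bar A i) c) (b ! j) = 0"
        by (simp only: s_pairing_diff_left 1 2 diff_self)
    qed
    then show ?thesis by simp
  qed
  then have "expressed_by ?D (smat_adjoint bar A) c' c"
    using smat_adjoint_GL_n[OF A'(2)] len by (simp add: expressed_by_lincomb)
  moreover have "torsion (smat_adjoint bar A) \<in> Z"
    using adjoint_Z A(2) A'(2) by (auto simp: adjoint_invariant_def carrier_GL)
  ultimately show ?thesis by (auto simp: zrel_def)
qed

lemma dual_lists_map:
  assumes "dual_lists m c b"
    and "\<And>p y. p \<in> set c \<Longrightarrow> y \<in> set b \<Longrightarrow> s_pairing bar n (f p) (g y) = s_pairing bar m p y"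
  shows "dual_lists n (map f c) (map g b)"
  using assms nth_mem by (auto simp: dual_lists_def)

lemma dual_lists_append:
  assumes "dual_lists m c b" "dual_lists m c' b'"
    and "\<And>y z. y \<in> set c \<Longrightarrow> z \<in> set b' \<Longrightarrow> s_pairing bar m y z = 0"
    and "\<And>y z. y \<in> set c' \<Longrightarrow> z \<in> set b \<Longrightarrow> s_pairing bar m y z = 0"
  shows "dual_lists m (c @ c') (b @ b')"
  unfolding dual_lists_def
proof (intro conjI allI impI)
  have len: "length b = length c" "length b' = length c'" using assms by (auto simp: dual_lists_def)
  then show "length (b @ b') = length (c @ c')" by simp
  fix i j assume ij: "i < length (c @ c')" "j < length (b @ b')"
  show "s_pairing bar m ((c @ c') ! i) ((b @ b') ! j) = (if i = j then 1 else 0)"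
  proof (cases "i < length c"; cases "j < length c")
    assume "i < length c" "j < length c"
    then show ?thesis using assms(1) len by (simp add: dual_lists_def nth_append)
  next
    assume "i < length c" "\<not> j < length c"
    then show ?thesis using assms(3) ij len by (auto simp: nth_append)
  next
    assume "\<not> i < length c" "j < length c"
    then show ?thesis using assms(4) ij len by (auto simp: nth_append)
  next
    assume i: "\<not> i < length c" and j: "\<not> j < length c"
    then have "i - length c = j - length c \<longleftrightarrow> i = j" by auto
    moreover have "i - length c < length c'" "j - length c < length b'" using i j ij len by auto
    ultimately show ?thesis using assms(2) i j len by (simp add: dual_lists_def nth_append)
  qed
qed

lemma dual_lists_stabilize:
  assumes M: "left_module M" and c: "set c \<subseteq> carrier (stab_mod (dual_lmod bar M) m)"
    and b: "set b \<subseteq> carrier (stab_mod M m)" and d: "dual_lists m c b"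
  shows "dual_lists (m + k) (snd (stabilize k (m, c))) (snd (stabilize k (m, b)))"
  unfolding snd_stabilize fst_conv snd_conv
proof (rule dual_lists_append)
  have mono: "s_pairing bar (m + k) y z = s_pairing bar m y z" if "y \<in> set c" for y z
  proof -
    have "(\<Sum>i<m + k. snd z i * bar (snd y i)) = (\<Sum>i<m. snd z i * bar (snd y i))"
      by (rule sum.mono_neutral_right) (use c that in \<open>auto simp: carrier_free_mod\<close>)
    then show ?thesis by (simp add: s_pairing_def)
  qed
  show "dual_lists (m + k) c b"
    using d nth_mem by (auto simp: dual_lists_def mono)
  have std: "s_pairing bar (m + k) y (0, std_vec i) = fst y 0 + bar (snd y i)" if "i < m + k" for y i
  proof -
    have "(\<Sum>j<m + k. std_vec i j * bar (snd y j)) = (\<Sum>j<m + k. if j = i then bar (snd y i) else 0)"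
      by (rule sum.cong) (auto simp: std_vec_def)
    then show ?thesis using that by (simp add: s_pairing_def)
  qed
  show "dual_lists (m + k) (map (\<lambda>i. (0, std_vec i)) [m..<m + k]) (map (\<lambda>i. (0, std_vec i)) [m..<m + k])"
    by (auto simp: dual_lists_def std) (auto simp: std_vec_def)
  show "s_pairing bar (m + k) y z = 0" if y: "y \<in> set c" and "z \<in> set (map (\<lambda>i. (0, std_vec i)) [m..<m + k])" for y z
  proof -
    obtain i where "m \<le> i" "i < m + k" "z = (0, std_vec i)" using \<open>z \<in> _\<close> by auto
    moreover have "fst y 0 = 0" "snd y i = 0" if "m \<le> i" for i
      using c y that dual_zero[OF M, of "fst y"] by (auto simp: carrier_free_mod)
    ultimately show ?thesis by (simp add: std)
  qed
  show "s_pairing bar (m + k) y z = 0" if z: "z \<in> set b" and "y \<in> set (map (\<lambda>i. (0, std_vec i)) [m..<m + k])" for y z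
  proof -
    obtain i where i: "m \<le> i" "i < m + k" "y = (0, std_vec i)" using \<open>y \<in> _\<close> by auto
    have "(\<Sum>j<m + k. snd z j * bar (std_vec i j)) = 0"
      by (rule sum.neutral) (use i b z in \<open>auto simp: std_vec_def carrier_free_mod\<close>)
    then show ?thesis using i by (simp add: s_pairing_def)
  qed
qed

lemma weakly_based_dual:
  assumes M: "weakly_based M"
  shows "weakly_based (dual bar M)"
proof -
  note wM = weakly_basedD[OF M]
  let ?D = "dual_lmod bar M"
  have D: "left_module ?D" by (rule left_module_dual_lmod[OF wM(1)])
  have bas_eq: "s_basis (dual bar M) s \<longleftrightarrow> s_basis ?D s" for s by (rule s_basis_cong) simp_all
  have equiv_eq: "s_equiv Z (dual bar M) s t \<longleftrightarrow> s_equiv Z ?D s t" for s t by (rule s_equiv_cong) simp_all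
  show ?thesis
    unfolding weakly_based_def
  proof (intro conjI ballI allI)
    show "left_module (dual bar M)" using D left_module_cong[of "dual bar M" ?D] by simp
    obtain m b where b: "(m, b) \<in> sbases M" using wM(2) by (metis prod.collapse)
    obtain c where "s_basis ?D (m, c)" "dual_lists m c b"
      using dual_basis_exists[OF wM(1) wM(3)[OF b]] .
    then have "(m, c) \<in> sbases (dual bar M)" using b dual_sbases by blast
    then show "sbases (dual bar M) \<noteq> {}" by blast
  next
    fix s assume s: "s \<in> sbases (dual bar M)"
    then obtain b where b: "(fst s, b) \<in> sbases M" "dual_lists (fst s) (snd s) b" and sb: "s_basis ?D s"
      using dual_sbases[of "fst s" "snd s" M] by auto
    show "s_basis (dual bar M) s" using sb bas_eq by simp
    show "stabilize k s \<in> sbases (dual bar M)" for k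
    proof -
      have "dual_lists (fst s + k) (snd (stabilize k (fst s, snd s))) (snd (stabilize k (fst s, b)))"
        using s_basis_subset[OF sb] s_basis_subset[OF wM(3)[OF b(1)]] b(2)
        by (intro dual_lists_stabilize[OF wM(1)]) (simp_all del: carrier_mod_sum)
      moreover have "(fst s + k, snd (stabilize k (fst s, b))) \<in> sbases M"
        using wM(4)[OF b(1), of k] by (metis fst_stabilize fst_conv prod.collapse)
      ultimately have "(fst s + k, snd (stabilize k s)) \<in> sbases (dual bar M)"
        using s_basis_stabilize[OF D sb, of k] unfolding dual_sbases
        by (metis fst_stabilize prod.collapse)
      then show ?thesis by (metis fst_stabilize prod.collapse)
    qed
    fix t assume t: "t \<in> sbases (dual bar M)"
    then obtain b' where b': "(fst t, b') \<in> sbases M" "dual_lists (fst t) (snd t) b'" and tb: "s_basis ?D t"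
      using dual_sbases[of "fst t" "snd t" M] by auto
    obtain k l where kl: "fst t + k = fst s + l"
      "zrel (stab_mod M (fst t + k)) (snd (stabilize k (fst t, b'))) (snd (stabilize l (fst s, b)))"
      using wM(5)[OF b'(1) b(1)] by (auto simp: s_equiv_iff)
    have bb: "is_basis (stab_mod M (fst t + k)) (snd (stabilize k (fst t, b')))"
      "is_basis (stab_mod M (fst t + k)) (snd (stabilize l (fst s, b)))"
      using s_basis_stabilize[OF wM(1) wM(3)[OF b'(1)], of k] s_basis_stabilize[OF wM(1) wM(3)[OF b(1)], of l] kl(1)
      by (simp_all add: s_basis_def)
    have cc: "set (snd (stabilize k t)) \<subseteq> carrier (stab_mod ?D (fst t + k))"
      "set (snd (stabilize l s)) \<subseteq> carrier (stab_mod ?D (fst t + k))"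
      using s_basis_subset[OF s_basis_stabilize[OF D tb, of k]] s_basis_subset[OF s_basis_stabilize[OF D sb, of l]] kl(1)
      by (simp_all del: carrier_mod_sum)
    have dd: "dual_lists (fst t + k) (snd (stabilize k t)) (snd (stabilize k (fst t, b')))"
      "dual_lists (fst t + k) (snd (stabilize l s)) (snd (stabilize l (fst s, b)))"
      using dual_lists_stabilize[OF wM(1) _ _ b'(2), of k] dual_lists_stabilize[OF wM(1) _ _ b(2), of l]
        s_basis_subset[OF sb] s_basis_subset[OF wM(3)[OF b(1)]] s_basis_subset[OF tb]
        s_basis_subset[OF wM(3)[OF b'(1)]] kl(1)
      by (simp_all del: carrier_mod_sum)
    have "zrel (stab_mod ?D (fst t + k)) (snd (stabilize l s)) (snd (stabilize k t))"
      by (rule dual_lists_zrel[OF wM(1) bb cc dd kl(2)])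
    then have "s_equiv Z ?D s t" unfolding s_equiv_iff using kl(1) by metis
    then show "s_equiv Z (dual bar M) s t" by (simp add: equiv_eq)
  qed
qed

lemma dual_length:
  assumes "(m, c) \<in> sbases (dual bar M)"
  obtains b where "(m, b) \<in> sbases M" "length b = length c"
  using assms unfolding dual_sbases dual_lists_def by blast

lemma mod_rank_dual:
  assumes M: "weakly_based M"
  shows "mod_rank (dual bar M) = mod_rank M"
proof -
  note wM = weakly_basedD[OF M] and wD = weakly_basedD[OF weakly_based_dual[OF M]]
  obtain m c where c: "(m, c) \<in> sbases (dual bar M)" using wD(2) by (metis prod.collapse)
  obtain b where b: "(m, b) \<in> sbases M" "length b = length c" using dual_length[OF c] .
  show ?thesis
    using mod_rank_eq[OF weakly_finite wD(1) wD(3)[OF c]] mod_rank_eq[OF weakly_finite wM(1) wM(3)[OF b(1)]] b(2)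
    by simp
qed

text \<open>
  The functional is cut off outside the carrier, as for all members of the dual module.
\<close>

definition dual_map ::
  "('a, 'm::ab_group_add, 'z) lmod_scheme \<Rightarrow> ('m \<Rightarrow> 'n) \<Rightarrow> ('n \<Rightarrow> 'a) \<Rightarrow> 'm \<Rightarrow> 'a" where
  "dual_map M f \<phi> = (\<lambda>x. if x \<in> carrier M then \<phi> (f x) else 0)"

lemma dual_map_hom:
  assumes M: "left_module M" and f: "f \<in> mod_hom M N"
  shows "dual_map M f \<in> mod_hom (dual_lmod bar N) (dual_lmod bar M)"
proof (rule mod_homI)
  fix \<phi> assume "\<phi> \<in> carrier (dual_lmod bar N)"
  then show "dual_map M f \<phi> \<in> carrier (dual_lmod bar M)"
    unfolding dual_lmod_carrier[of _ M] dual_map_def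
    using mod_homD[OF f] left_moduleD(2,4)[OF M] dual_lmodD(1,2)[of \<phi> N] by simp
qed (auto simp: dual_map_def fun_eq_iff)

lemma dual_map_iso:
  assumes M: "left_module M" and N: "left_module N" and f: "f \<in> mod_iso M N"
  shows "dual_map M f \<in> mod_iso (dual_lmod bar N) (dual_lmod bar M)"
proof -
  obtain g where g: "g \<in> mod_iso N M" "\<And>x. x \<in> carrier M \<Longrightarrow> g (f x) = x"
    "\<And>y. y \<in> carrier N \<Longrightarrow> f (g y) = y"
    using mod_iso_inverse[OF M f] by blast
  note gc = mod_homD(1)[OF mod_isoD(1)[OF g(1)]] and fc = mod_homD(1)[OF mod_isoD(1)[OF f]]
  show ?thesis
  proof (rule mod_isoI_inverse[OF dual_map_hom[OF M mod_isoD(1)[OF f]], where g = "dual_map N g"])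
    fix \<phi> assume "\<phi> \<in> carrier (dual_lmod bar M)"
    then show "dual_map N g \<phi> \<in> carrier (dual_lmod bar N)" "dual_map M f (dual_map N g \<phi>) = \<phi>"
      using mod_homD(1)[OF dual_map_hom[OF N mod_isoD(1)[OF g(1)]]] fc g(2) dual_lmodD(3)[of \<phi> M]
      by (auto simp: dual_map_def fun_eq_iff)
  next
    fix \<phi> assume "\<phi> \<in> carrier (dual_lmod bar N)"
    then show "dual_map N g (dual_map M f \<phi>) = \<phi>"
      using gc g(3) dual_lmodD(3)[of \<phi> N] by (auto simp: dual_map_def fun_eq_iff)
  qed
qed

text \<open>
  The dual of the image of a basis is mapped to the dual of that basis.
\<close>

lemma dual_map_simple:
  assumes M: "weakly_based M" and N: "based_module Z N" and f: "f \<in> simple_iso Z M N"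
  shows "dual_map M f \<in> simple_iso Z (dual bar N) (dual bar M)"
proof -
  note wM = weakly_basedD[OF M] and wN = weakly_basedD[OF based_moduleD(1)[OF N]]
  note fD = simple_isoD[OF M based_moduleD(1)[OF N] f]
  note dM = weakly_based_dual[OF M] and dN = weakly_based_dual[OF based_moduleD(1)[OF N]]
  have iso: "dual_map M f \<in> mod_iso (dual_lmod bar N) (dual_lmod bar M)"
    by (rule dual_map_iso[OF wM(1) wN(1) fD(1)])
  obtain m b where b: "(m, b) \<in> sbases M" using wM(2) by (metis prod.collapse)
  have fb: "(m, map (map_prod f id) b) \<in> sbases N"
    using simple_iso_mem_sbases[OF M N f b] by (simp add: map_sbasis_def)
  obtain c where c: "s_basis (dual_lmod bar N) (m, c)" "dual_lists m c (map (map_prod f id) b)"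
    using dual_basis_exists[OF wN(1) wN(3)[OF fb]] .
  then have c_mem: "(m, c) \<in> sbases (dual bar N)" using fb dual_sbases by blast
  let ?c = "map_sbasis (dual_map M f) (m, c)"
  have bas: "s_basis (dual_lmod bar M) ?c"
    by (rule s_basis_map[OF left_module_dual_lmod[OF wN(1)] left_module_dual_lmod[OF wM(1)] iso c(1)])
  have "dual_lists m (snd ?c) b"
  proof -
    have "s_pairing bar m (map_prod (dual_map M f) id y) z = s_pairing bar m y (map_prod f id z)"
      if "z \<in> set b" for y z
    proof -
      have "fst z \<in> carrier M" using s_basis_subset[OF wM(3)[OF b]] that by auto
      then show ?thesis by (simp add: s_pairing_def dual_map_def)
    qed
    then show ?thesis using c(2) by (auto simp: dual_lists_def snd_map_sbasis)
  qed
  then have mem: "?c \<in> sbases (dual bar M)"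
    using dual_sbases[of m "snd ?c" M] b bas by (metis fst_map_sbasis fst_conv prod.collapse)
  have "dual_map M f \<in> mod_iso (dual bar N) (dual bar M)"
    using iso mod_iso_cong[of "dual bar N" "dual_lmod bar N" "dual bar M" "dual_lmod bar M"] by simp
  then show ?thesis
    by (rule simple_isoI[OF dN dM _ c_mem mem weakly_basedD(5)[OF dM mem mem]])
qed

definition dual_of_sum ::
  "('a, 'm::ab_group_add, 'z) lmod_scheme \<Rightarrow> ('a, 'n::ab_group_add, 'w) lmod_scheme \<Rightarrow>
    ('m \<Rightarrow> 'a) \<times> ('n \<Rightarrow> 'a) \<Rightarrow> 'm \<times> 'n \<Rightarrow> 'a" where
  "dual_of_sum M N = (\<lambda>(\<phi>, \<chi>) (x, y). if x \<in> carrier M \<and> y \<in> carrier N then \<phi> x + \<chi> y else 0)"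

lemma dual_of_sum_iso:
  assumes M: "left_module M" and N: "left_module N"
  shows "dual_of_sum M N \<in> mod_iso (mod_sum (dual_lmod bar M) (dual_lmod bar N)) (dual_lmod bar (mod_sum M N))"
proof (rule mod_isoI_inverse[where g = "\<lambda>\<phi>. (\<lambda>x. \<phi> (x, 0), \<lambda>y. \<phi> (0, y))"])
  let ?D = "mod_sum (dual_lmod bar M) (dual_lmod bar N)" and ?T = "dual_lmod bar (mod_sum M N)"
  show "dual_of_sum M N \<in> mod_hom ?D ?T"
  proof (rule mod_homI)
    fix z assume "z \<in> carrier ?D"
    then obtain \<phi> \<chi> where z: "z = (\<phi>, \<chi>)" "\<phi> \<in> carrier (dual_lmod bar M)" "\<chi> \<in> carrier (dual_lmod bar N)"
      by auto
    show "dual_of_sum M N z \<in> carrier ?T"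
      unfolding dual_lmod_carrier dual_of_sum_def z(1)
      using dual_lmodD[OF z(2)] dual_lmodD[OF z(3)] left_moduleD(2,4)[OF M] left_moduleD(2,4)[OF N]
      by (auto simp: distrib_left)
  next
    fix z w assume "z \<in> carrier ?D" "w \<in> carrier ?D"
    show "dual_of_sum M N (z + w) = dual_of_sum M N z + dual_of_sum M N w"
      by (cases z; cases w) (auto simp: dual_of_sum_def fun_eq_iff algebra_simps)
  next
    fix a z
    show "dual_of_sum M N (scl ?D a z) = scl ?T a (dual_of_sum M N z)"
      by (auto simp: dual_of_sum_def fun_eq_iff distrib_right split: prod.splits)
  qed
next
  fix \<phi> assume p: "\<phi> \<in> carrier (dual_lmod bar (mod_sum M N))"
  note pD = dual_lmodD[OF p]
  have zero: "0 \<in> carrier M" "0 \<in> carrier N" using left_moduleD(1) M N by auto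
  show "(\<lambda>x. \<phi> (x, 0), \<lambda>y. \<phi> (0, y)) \<in> carrier (mod_sum (dual_lmod bar M) (dual_lmod bar N))"
    unfolding carrier_mod_sum mem_Times_iff fst_conv snd_conv dual_lmod_carrier
  proof (intro conjI ballI allI impI)
    show "\<phi> (x + y, 0) = \<phi> (x, 0) + \<phi> (y, 0)" if "x \<in> carrier M" "y \<in> carrier M" for x y
      using pD(1)[of "(x, 0)" "(y, 0)"] that zero by simp
    show "\<phi> (0, x + y) = \<phi> (0, x) + \<phi> (0, y)" if "x \<in> carrier N" "y \<in> carrier N" for x y
      using pD(1)[of "(0, x)" "(0, y)"] that zero by simp
    show "\<phi> (scl M a x, 0) = a * \<phi> (x, 0)" if "x \<in> carrier M" for a x
      using pD(2)[of "(x, 0)" a] that zero scl_zero_right[OF N] by simp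
    show "\<phi> (0, scl N a x) = a * \<phi> (0, x)" if "x \<in> carrier N" for a x
      using pD(2)[of "(0, x)" a] that zero scl_zero_right[OF M] by simp
    show "\<phi> (x, 0) = 0" if "x \<notin> carrier M" for x using pD(3)[of "(x, 0)"] that by simp
    show "\<phi> (0, x) = 0" if "x \<notin> carrier N" for x using pD(3)[of "(0, x)"] that by simp
  qed
  show "dual_of_sum M N (\<lambda>x. \<phi> (x, 0), \<lambda>y. \<phi> (0, y)) = \<phi>"
  proof
    fix z
    have "\<phi> (x, 0) + \<phi> (0, y) = \<phi> (x, y)" if "x \<in> carrier M" "y \<in> carrier N" for x y
      using pD(1)[of "(x, 0)" "(0, y)"] that zero by simp
    then show "dual_of_sum M N (\<lambda>x. \<phi> (x, 0), \<lambda>y. \<phi> (0, y)) z = \<phi> z"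
      using pD(3)[of z] by (cases z) (auto simp: dual_of_sum_def)
  qed
next
  fix z assume "z \<in> carrier (mod_sum (dual_lmod bar M) (dual_lmod bar N))"
  then obtain \<phi> \<chi> where z: "z = (\<phi>, \<chi>)" "\<phi> \<in> carrier (dual_lmod bar M)" "\<chi> \<in> carrier (dual_lmod bar N)"
    by auto
  show "(\<lambda>x. dual_of_sum M N z (x, 0), \<lambda>y. dual_of_sum M N z (0, y)) = z"
    using dual_lmodD(3)[OF z(2)] dual_lmodD(3)[OF z(3)] dual_zero[OF M z(2)] dual_zero[OF N z(3)]
      left_moduleD(1)[OF M] left_moduleD(1)[OF N]
    by (auto simp: z(1) dual_of_sum_def fun_eq_iff)
qed

lemma s_pairing_sum:
  assumes M: "left_module M" and N: "left_module N"
    and xv: "(x, v) \<in> carrier (stab_mod M m)" and yw: "(y, w) \<in> carrier (stab_mod N n)"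
    and v': "v' \<in> carrier (free_mod m)"
  shows "s_pairing bar (m + n) (dual_of_sum M N (\<phi>, \<chi>), v' + shift_vec m w') ((x, y), v + shift_vec m w) =
    s_pairing bar m (\<phi>, v') (x, v) + s_pairing bar n (\<chi>, w') (y, w)"
proof -
  let ?f = "\<lambda>k. (v + shift_vec m w) k * bar ((v' + shift_vec m w') k)"
  have "(\<Sum>k<m + n. ?f k) = (\<Sum>k<m. ?f k) + (\<Sum>k=m..<m + n. ?f k)"
    by (simp add: lessThan_atLeast0 sum.atLeastLessThan_concat)
  also have "(\<Sum>k<m. ?f k) = (\<Sum>k<m. v k * bar (v' k))"
    by (rule sum.cong) (auto simp: shift_vec_def)
  also have "(\<Sum>k=m..<m + n. ?f k) = (\<Sum>k<n. ?f (m + k))"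
    using sum.shift_bounds_nat_ivl[of ?f 0 m n] by (simp add: lessThan_atLeast0 add.commute)
  also have "\<dots> = (\<Sum>k<n. w k * bar (w' k))"
    by (rule sum.cong) (use xv v' in \<open>auto simp: shift_vec_def carrier_free_mod\<close>)
  finally show ?thesis using xv yw by (simp add: s_pairing_def dual_of_sum_def)
qed

text \<open>
  The dual basis of the sum of two stable bases is the sum of their dual bases, with the same
  arrangement of the free coordinates.
\<close>

lemma dual_of_sum_simple:
  fixes M :: "('a, 'm::ab_group_add) based" and N :: "('a, 'n::ab_group_add) based"
  assumes M: "weakly_based M" and N: "weakly_based N"
  shows "dual_of_sum M N \<in> simple_iso Z (based_sum Z (dual bar M) (dual bar N)) (dual bar (based_sum Z M N))"
    (is "?h \<in> simple_iso Z ?D ?T")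
proof -
  note wM = weakly_basedD[OF M] and wN = weakly_basedD[OF N] and S = weakly_based_sum[OF M N]
  note dM = weakly_based_dual[OF M] and dN = weakly_based_dual[OF N]
  have D: "weakly_based ?D" and T: "weakly_based ?T"
    by (rule weakly_based_sum[OF dM dN]) (rule weakly_based_dual[OF S])
  have Teq: "dual_lmod bar (based_sum Z M N) = dual_lmod bar (mod_sum M N)"
    by (simp add: dual_lmod_def Hom_def mod_hom_def)
  have iso: "?h \<in> mod_iso ?D ?T"
    using dual_of_sum_iso[OF wM(1) wN(1)] Teq
      mod_iso_cong[of ?D "mod_sum (dual_lmod bar M) (dual_lmod bar N)" ?T "dual_lmod bar (mod_sum M N)"]
    by (simp add: mod_sum_def)
  obtain m c where c: "(m, c) \<in> sbases (dual bar M)" using weakly_basedD(2)[OF dM] by (metis prod.collapse)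
  then obtain b where b: "(m, b) \<in> sbases M" "dual_lists m c b" and cb: "s_basis (dual_lmod bar M) (m, c)"
    unfolding dual_sbases by blast
  obtain n c' where c': "(n, c') \<in> sbases (dual bar N)" using weakly_basedD(2)[OF dN] by (metis prod.collapse)
  then obtain b' where b': "(n, b') \<in> sbases N" "dual_lists n c' b'" and cb': "s_basis (dual_lmod bar N) (n, c')"
    unfolding dual_sbases by blast
  let ?s = "sum_sbasis (m, c) (n, c')" and ?t = "sum_sbasis (m, b) (n, b')"
  have s: "?s \<in> sbases ?D" by (rule based_module_sum(2)[OF dM dN c c'])
  have t: "?t \<in> sbases (based_sum Z M N)" by (rule based_module_sum(2)[OF M N b(1) b'(1)])
  have bas: "s_basis ?T (map_sbasis ?h ?s)"
    by (rule s_basis_map[OF weakly_basedD(1)[OF D] weakly_basedD(1)[OF T] iso weakly_basedD(3)[OF D s]])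
  define k where "k = (\<lambda>((\<phi>, v), (\<chi>, w :: nat \<Rightarrow> 'a)). (?h (\<phi>, \<chi>), v + shift_vec m w))"
  define l where "l = (\<lambda>((x :: 'm, v), (y :: 'n, w :: nat \<Rightarrow> 'a)). ((x, y), v + shift_vec m w))"
  have eqs: "snd (map_sbasis ?h ?s) = map k (map (\<lambda>z. (z, 0)) c) @ map k (map (\<lambda>z. (0, z)) c')"
    "snd ?t = map l (map (\<lambda>z. (z, 0)) b) @ map l (map (\<lambda>z. (0, z)) b')"
    by (simp_all add: snd_map_sbasis sum_sbasis_eq_map case_prod_unfold k_def l_def)
  have sub: "set c \<subseteq> carrier (stab_mod (dual_lmod bar M) m)" "set c' \<subseteq> carrier (stab_mod (dual_lmod bar N) n)"
    "set b \<subseteq> carrier (stab_mod M m)" "set b' \<subseteq> carrier (stab_mod N n)"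
    using s_basis_subset[OF cb] s_basis_subset[OF cb'] s_basis_subset[OF wM(3)[OF b(1)]]
      s_basis_subset[OF wN(3)[OF b'(1)]] by (simp_all del: carrier_mod_sum)
  have P: "s_pairing bar (m + n) (k (p, q)) (l (y, z)) = s_pairing bar m p y + s_pairing bar n q z"
    if "p \<in> carrier (stab_mod (dual_lmod bar M) m)" "y \<in> carrier (stab_mod M m)" "z \<in> carrier (stab_mod N n)"
    for p q y z
    using s_pairing_sum[OF wM(1) wN(1), of "fst y" "snd y" m "fst z" "snd z" n "snd p" "fst p" "fst q" "snd q"] that
    by (simp add: case_prod_unfold mem_Times_iff k_def l_def)
  have zero: "0 \<in> carrier (stab_mod (dual_lmod bar M) m)" "0 \<in> carrier (stab_mod M m)" "0 \<in> carrier (stab_mod N n)"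
    using left_moduleD(1)[OF left_module_mod_sum[OF left_module_dual_lmod[OF wM(1)] left_module_free_mod]]
      left_moduleD(1)[OF left_module_mod_sum[OF wM(1) left_module_free_mod]]
      left_moduleD(1)[OF left_module_mod_sum[OF wN(1) left_module_free_mod]] by blast+
  have "dual_lists (m + n) (snd (map_sbasis ?h ?s)) (snd ?t)"
    unfolding eqs
  proof (rule dual_lists_append)
    have Pl: "s_pairing bar (m + n) (k (p, 0)) (l (y, 0)) = s_pairing bar m p y" if "p \<in> set c" "y \<in> set b" for p y
      using P[OF subsetD[OF sub(1) that(1)] subsetD[OF sub(3) that(2)] zero(3), of 0] by (simp only: s_pairing_zero_left add_0_right)
    have Pr: "s_pairing bar (m + n) (k (0, q)) (l (0, z)) = s_pairing bar n q z" if "q \<in> set c'" "z \<in> set b'" for q z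
      using P[OF zero(1,2) subsetD[OF sub(4) that(2)], of q] by (simp only: s_pairing_zero_left add_0_left)
    show "dual_lists (m + n) (map k (map (\<lambda>z. (z, 0)) c)) (map l (map (\<lambda>z. (z, 0)) b))"
      unfolding map_map by (rule dual_lists_map[OF b(2)]) (simp only: comp_apply Pl)
    show "dual_lists (m + n) (map k (map (\<lambda>z. (0, z)) c')) (map l (map (\<lambda>z. (0, z)) b'))"
      unfolding map_map by (rule dual_lists_map[OF b'(2)]) (simp only: comp_apply Pr)
  next
    fix y z assume y: "y \<in> set (map k (map (\<lambda>z. (z, 0)) c))" and z: "z \<in> set (map l (map (\<lambda>z. (0, z)) b'))"
    obtain p where p: "p \<in> set c" "y = k (p, 0)" using y by auto
    obtain u where u: "u \<in> set b'" "z = l (0, u)" using z by auto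
    show "s_pairing bar (m + n) y z = 0"
      unfolding p(2) u(2) P[OF subsetD[OF sub(1) p(1)] zero(2) subsetD[OF sub(4) u(1)]]
        s_pairing_zero_right[OF wM(1) subsetD[OF sub(1) p(1)]] by simp
  next
    fix y z assume y: "y \<in> set (map k (map (\<lambda>z. (0, z)) c'))" and z: "z \<in> set (map l (map (\<lambda>z. (z, 0)) b))"
    obtain q where q: "q \<in> set c'" "y = k (0, q)" using y by auto
    obtain u where u: "u \<in> set b" "z = l (u, 0)" using z by auto
    show "s_pairing bar (m + n) y z = 0"
      unfolding q(2) u(2) P[OF zero(1) subsetD[OF sub(3) u(1)] zero(3)]
        s_pairing_zero_right[OF wN(1) subsetD[OF sub(2) q(1)]] by simp
  qed
  moreover have "s_basis (dual_lmod bar (based_sum Z M N)) (map_sbasis ?h ?s)"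
    using bas s_basis_cong[of ?T "dual_lmod bar (based_sum Z M N)"] by simp
  ultimately have mem: "map_sbasis ?h ?s \<in> sbases ?T"
  proof -
    have pair: "(m + n, snd (map_sbasis ?h ?s)) = map_sbasis ?h ?s" "(m + n, snd ?t) = ?t"
      by (simp_all add: prod_eq_iff)
    assume "dual_lists (m + n) (snd (map_sbasis ?h ?s)) (snd ?t)"
      and "s_basis (dual_lmod bar (based_sum Z M N)) (map_sbasis ?h ?s)"
    then show ?thesis
      using dual_sbases[of "m + n" "snd (map_sbasis ?h ?s)" "based_sum Z M N"] t pair by metis
  qed
  show ?thesis
    by (rule simple_isoI[OF D T iso s mem weakly_basedD(5)[OF T mem mem]])
qed

end

section \<open>Quadratic forms\<close>

lemma Hom_dual_cong:
  "carrier M = carrier M' \<Longrightarrow> scl M = scl M' \<Longrightarrow> Hom M (dual_lmod bar M) = Hom M' (dual_lmod bar M')"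
  by (simp add: Hom_def mod_hom_def dual_lmod_def)

lemma Q_class_cong:
  "carrier M = carrier M' \<Longrightarrow> scl M = scl M' \<Longrightarrow> Q_class bar \<epsilon> M = Q_class bar \<epsilon> M'"
  using Hom_dual_cong[of M M' bar] by (auto simp: Q_class_def Q_rel_def fun_eq_iff)

lemma Q_group_cong:
  "carrier M = carrier M' \<Longrightarrow> scl M = scl M' \<Longrightarrow> Q_group bar \<epsilon> M = Q_group bar \<epsilon> M'"
  using Hom_dual_cong[of M M' bar] by (simp add: Q_group_def Q_rel_def)

lemma zero_ext_cong: "carrier M = carrier M' \<Longrightarrow> zero_ext M = zero_ext M'"
  by (simp add: zero_ext_def fun_eq_iff)

definition pull_form ::
  "('a::ring_1, 'm::ab_group_add, 'z) lmod_scheme \<Rightarrow> ('m \<Rightarrow> 'n) \<Rightarrow> ('n \<Rightarrow> 'n \<Rightarrow> 'a) \<Rightarrow> 'm \<Rightarrow> 'm \<Rightarrow> 'a" where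
  "pull_form M f \<phi> = zero_ext M (\<lambda>x y. \<phi> (f x) (f y))"

definition sum_form ::
  "('a::ring_1, 'm::ab_group_add, 'z) lmod_scheme \<Rightarrow> ('a, 'n::ab_group_add, 'w) lmod_scheme \<Rightarrow>
     ('m \<Rightarrow> 'm \<Rightarrow> 'a) \<Rightarrow> ('n \<Rightarrow> 'n \<Rightarrow> 'a) \<Rightarrow> 'm \<times> 'n \<Rightarrow> 'm \<times> 'n \<Rightarrow> 'a" where
  "sum_form M N \<phi> \<phi>' = zero_ext (mod_sum M N) (\<lambda>(x, x') (y, y'). \<phi> x y + \<phi>' x' y')"

context form_setting
begin

abbreviation sesq :: "('a, 'm::ab_group_add, 'z) lmod_scheme \<Rightarrow> ('m \<Rightarrow> 'm \<Rightarrow> 'a) set" where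
  "sesq M \<equiv> Hom M (dual_lmod bar M)"

text \<open>
  The homomorphisms to the dual module are exactly the sesquilinear forms.
\<close>

lemma sesqI:
  assumes M: "left_module M"
    and "\<And>x x' y. x \<in> carrier M \<Longrightarrow> x' \<in> carrier M \<Longrightarrow> y \<in> carrier M \<Longrightarrow> \<phi> (x + x') y = \<phi> x y + \<phi> x' y"
    and "\<And>x y y'. x \<in> carrier M \<Longrightarrow> y \<in> carrier M \<Longrightarrow> y' \<in> carrier M \<Longrightarrow> \<phi> x (y + y') = \<phi> x y + \<phi> x y'"
    and "\<And>a x y. x \<in> carrier M \<Longrightarrow> y \<in> carrier M \<Longrightarrow> \<phi> (scl M a x) y = \<phi> x y * bar a"
    and "\<And>a x y. x \<in> carrier M \<Longrightarrow> y \<in> carrier M \<Longrightarrow> \<phi> x (scl M a y) = a * \<phi> x y"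
    and zero: "\<And>x y. x \<notin> carrier M \<or> y \<notin> carrier M \<Longrightarrow> \<phi> x y = 0"
  shows "\<phi> \<in> sesq M"
  unfolding Hom_def
proof (intro CollectI conjI allI impI)
  show "\<phi> \<in> mod_hom M (dual_lmod bar M)"
  proof (rule mod_homI)
    fix x assume "x \<in> carrier M"
    then show "\<phi> x \<in> carrier (dual_lmod bar M)"
      using assms(3,5) zero by (simp add: dual_lmod_carrier)
  next
    fix x y assume "x \<in> carrier M" "y \<in> carrier M"
    then show "\<phi> (x + y) = \<phi> x + \<phi> y"
      using assms(2) zero by (intro ext) (metis add.right_neutral plus_fun_apply)
  next
    fix a x assume "x \<in> carrier M"
    then show "\<phi> (scl M a x) = scl (dual_lmod bar M) a (\<phi> x)"
      unfolding scl_dual_lmod using assms(4) zero by (intro ext) (metis mult_zero_left)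
  qed
  show "\<phi> x = 0" if "x \<notin> carrier M" for x using zero that by (intro ext) simp
qed

lemma sesqD:
  assumes "\<phi> \<in> sesq M"
  shows "x \<in> carrier M \<Longrightarrow> x' \<in> carrier M \<Longrightarrow> \<phi> (x + x') y = \<phi> x y + \<phi> x' y"
    and "x \<in> carrier M \<Longrightarrow> y \<in> carrier M \<Longrightarrow> y' \<in> carrier M \<Longrightarrow> \<phi> x (y + y') = \<phi> x y + \<phi> x y'"
    and "x \<in> carrier M \<Longrightarrow> \<phi> (scl M a x) y = \<phi> x y * bar a"
    and "x \<in> carrier M \<Longrightarrow> y \<in> carrier M \<Longrightarrow> \<phi> x (scl M a y) = a * \<phi> x y"
    and "x \<notin> carrier M \<or> y \<notin> carrier M \<Longrightarrow> \<phi> x y = 0"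
    and "x \<in> carrier M \<Longrightarrow> \<phi> x \<in> carrier (dual_lmod bar M)"
proof -
  have h: "\<phi> \<in> mod_hom M (dual_lmod bar M)" and z: "\<And>x. x \<notin> carrier M \<Longrightarrow> \<phi> x = 0"
    using assms by (auto simp: Hom_def)
  note hD = mod_homD[OF h]
  show "\<phi> (x + x') y = \<phi> x y + \<phi> x' y" if "x \<in> carrier M" "x' \<in> carrier M"
    using hD(2)[OF that] by simp
  show "\<phi> x (y + y') = \<phi> x y + \<phi> x y'" if "x \<in> carrier M" "y \<in> carrier M" "y' \<in> carrier M"
    using dual_lmodD(1)[OF hD(1)] that by simp
  show "\<phi> (scl M a x) y = \<phi> x y * bar a" if "x \<in> carrier M" using hD(3)[OF that] by simp
  show "\<phi> x (scl M a y) = a * \<phi> x y" if "x \<in> carrier M" "y \<in> carrier M"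
    using dual_lmodD(2)[OF hD(1)] that by simp
  show "\<phi> x y = 0" if "x \<notin> carrier M \<or> y \<notin> carrier M"
    using z[of x] dual_lmodD(3)[OF hD(1), of x y] that by (cases "x \<in> carrier M") auto
  show "\<phi> x \<in> carrier (dual_lmod bar M)" if "x \<in> carrier M" using hD(1)[OF that] .
qed

lemma T_op_sesq:
  assumes M: "left_module M" and \<phi>: "\<phi> \<in> sesq M"
  shows "T_op bar \<epsilon> \<phi> \<in> sesq M"
proof -
  have comm: "\<epsilon> * (a * b) = a * (\<epsilon> * b)" for a b using sign by auto
  show ?thesis
  proof (rule sesqI[OF M])
    show "T_op bar \<epsilon> \<phi> x y = 0" if "x \<notin> carrier M \<or> y \<notin> carrier M" for x y
      using sesqD(5)[OF \<phi>, of y x] that by (auto simp: T_op_def)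
  qed (simp_all add: T_op_def sesqD(1-4)[OF \<phi>] distrib_left mult.assoc comm)
qed

lemma sesq_zero: "left_module M \<Longrightarrow> 0 \<in> sesq M"
  by (rule sesqI) auto

lemma sesq_add: "left_module M \<Longrightarrow> \<phi> \<in> sesq M \<Longrightarrow> \<phi>' \<in> sesq M \<Longrightarrow> \<phi> + \<phi>' \<in> sesq M"
  by (rule sesqI) (simp_all add: sesqD(1-4)[of _ M] sesqD(5)[of \<phi> M] sesqD(5)[of \<phi>' M] algebra_simps)

lemma sesq_uminus: "left_module M \<Longrightarrow> \<phi> \<in> sesq M \<Longrightarrow> - \<phi> \<in> sesq M"
  by (rule sesqI) (simp_all add: sesqD(1-4)[of _ M] sesqD(5)[of \<phi> M])

lemma T_op_add: "T_op bar \<epsilon> (\<theta> + \<theta>') = T_op bar \<epsilon> \<theta> + T_op bar \<epsilon> \<theta>'"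
  by (simp add: T_op_def fun_eq_iff distrib_left)

lemma T_op_uminus: "T_op bar \<epsilon> (- \<theta>) = - T_op bar \<epsilon> \<theta>"
  by (simp add: T_op_def fun_eq_iff)

lemma T_op_zero: "T_op bar \<epsilon> 0 = 0"
  by (simp add: T_op_def fun_eq_iff)

lemma T_op_T_op: "T_op bar \<epsilon> (T_op bar \<epsilon> \<theta>) = \<theta>"
proof -
  have "\<epsilon> * (a * \<epsilon>) = a" for a using sign by auto
  then show ?thesis by (simp add: T_op_def fun_eq_iff)
qed

lemma Q_class_mem:
  "\<phi>' \<in> Q_class bar \<epsilon> M \<phi> \<longleftrightarrow> \<phi> \<in> sesq M \<and> \<phi>' \<in> sesq M \<and> (\<exists>\<theta>\<in>sesq M. \<phi>' - \<phi> = \<theta> - T_op bar \<epsilon> \<theta>)"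
  by (auto simp: Q_class_def Q_rel_def)

lemma Q_class_self: "left_module M \<Longrightarrow> \<phi> \<in> sesq M \<Longrightarrow> \<phi> \<in> Q_class bar \<epsilon> M \<phi>"
  unfolding Q_class_mem using sesq_zero[of M] T_op_zero by (metis diff_self)

lemma Q_class_eqI:
  assumes M: "left_module M" and "\<phi> \<in> sesq M" "\<phi>' \<in> sesq M" "\<theta> \<in> sesq M"
    and eq: "\<phi>' - \<phi> = \<theta> - T_op bar \<epsilon> \<theta>"
  shows "Q_class bar \<epsilon> M \<phi>' = Q_class bar \<epsilon> M \<phi>"
proof -
  have "(\<exists>\<eta>\<in>sesq M. \<chi> - \<phi>' = \<eta> - T_op bar \<epsilon> \<eta>) \<longleftrightarrow> (\<exists>\<eta>\<in>sesq M. \<chi> - \<phi> = \<eta> - T_op bar \<epsilon> \<eta>)" for \<chi>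
  proof
    assume "\<exists>\<eta>\<in>sesq M. \<chi> - \<phi>' = \<eta> - T_op bar \<epsilon> \<eta>"
    then obtain \<eta> where \<eta>: "\<eta> \<in> sesq M" "\<chi> - \<phi>' = \<eta> - T_op bar \<epsilon> \<eta>" by blast
    have "\<chi> - \<phi> = (\<chi> - \<phi>') + (\<phi>' - \<phi>)" by simp
    also have "\<dots> = (\<eta> + \<theta>) - T_op bar \<epsilon> (\<eta> + \<theta>)" unfolding \<eta>(2) eq T_op_add by (simp add: algebra_simps)
    finally show "\<exists>\<eta>\<in>sesq M. \<chi> - \<phi> = \<eta> - T_op bar \<epsilon> \<eta>"
      using sesq_add[OF M \<eta>(1) assms(4)] by blast
  next
    assume "\<exists>\<eta>\<in>sesq M. \<chi> - \<phi> = \<eta> - T_op bar \<epsilon> \<eta>"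
    then obtain \<eta> where \<eta>: "\<eta> \<in> sesq M" "\<chi> - \<phi> = \<eta> - T_op bar \<epsilon> \<eta>" by blast
    have "\<chi> - \<phi>' = (\<chi> - \<phi>) - (\<phi>' - \<phi>)" by simp
    also have "\<dots> = (\<eta> + - \<theta>) - T_op bar \<epsilon> (\<eta> + - \<theta>)"
      unfolding \<eta>(2) eq T_op_add T_op_uminus by (simp add: algebra_simps)
    finally show "\<exists>\<eta>\<in>sesq M. \<chi> - \<phi>' = \<eta> - T_op bar \<epsilon> \<eta>"
      using sesq_add[OF M \<eta>(1) sesq_uminus[OF M assms(4)]] by blast
  qed
  then show ?thesis using assms(2,3) by (auto simp: Q_class_mem)
qed

lemma Q_group_iff: "\<psi> \<in> Q_group bar \<epsilon> M \<longleftrightarrow> (\<exists>\<phi>\<in>sesq M. \<psi> = Q_class bar \<epsilon> M \<phi>)"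
  by (auto simp: Q_group_def quotient_def Q_class_def)

text \<open>
  Operations on quadratic forms are defined as unions over all representatives of a class. This is
  the principle by which they reduce to one representative.
\<close>

lemma Q_class_UN:
  assumes M: "left_module M" and \<phi>: "\<phi> \<in> sesq M"
    and "\<And>\<phi>' \<theta>. \<phi>' \<in> sesq M \<Longrightarrow> \<theta> \<in> sesq M \<Longrightarrow> \<phi>' - \<phi> = \<theta> - T_op bar \<epsilon> \<theta> \<Longrightarrow> G \<phi>' = G \<phi>"
  shows "(\<Union>\<phi>'\<in>Q_class bar \<epsilon> M \<phi>. G \<phi>') = G \<phi>"
proof
  show "(\<Union>\<phi>'\<in>Q_class bar \<epsilon> M \<phi>. G \<phi>') \<subseteq> G \<phi>"
  proof (rule UN_least)
    fix \<phi>' assume "\<phi>' \<in> Q_class bar \<epsilon> M \<phi>"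
    then obtain \<theta> where "\<phi>' \<in> sesq M" "\<theta> \<in> sesq M" "\<phi>' - \<phi> = \<theta> - T_op bar \<epsilon> \<theta>"
      unfolding Q_class_mem by blast
    from assms(3)[OF this] show "G \<phi>' \<subseteq> G \<phi>" by (rule equalityD1)
  qed
  show "G \<phi> \<subseteq> (\<Union>\<phi>'\<in>Q_class bar \<epsilon> M \<phi>. G \<phi>')" using Q_class_self[OF M \<phi>] by blast
qed

lemma Q_symm_class:
  assumes M: "left_module M" and \<phi>: "\<phi> \<in> sesq M"
  shows "Q_symm bar \<epsilon> (Q_class bar \<epsilon> M \<phi>) = \<phi> + T_op bar \<epsilon> \<phi>"
proof -
  have "\<phi>' + T_op bar \<epsilon> \<phi>' = \<phi> + T_op bar \<epsilon> \<phi>" if \<phi>': "\<phi>' \<in> Q_class bar \<epsilon> M \<phi>" for \<phi>'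
  proof -
    obtain \<theta> where "\<phi>' - \<phi> = \<theta> - T_op bar \<epsilon> \<theta>" using \<phi>' by (auto simp: Q_class_mem)
    then have eq: "\<phi>' = \<phi> + (\<theta> + - T_op bar \<epsilon> \<theta>)" by (simp add: algebra_simps)
    show ?thesis unfolding eq T_op_add T_op_uminus T_op_T_op by (simp add: algebra_simps)
  qed
  then have "(\<lambda>\<phi>. \<phi> + T_op bar \<epsilon> \<phi>) ` Q_class bar \<epsilon> M \<phi> = {\<phi> + T_op bar \<epsilon> \<phi>}"
    using Q_class_self[OF M \<phi>] by blast
  then show ?thesis unfolding Q_symm_def by simp
qed

lemma Q_symm_sesq:
  assumes M: "left_module M" and "\<psi> \<in> Q_group bar \<epsilon> M"
  shows "Q_symm bar \<epsilon> \<psi> \<in> sesq M"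
  using assms Q_symm_class[OF M] sesq_add[OF M _ T_op_sesq[OF M]] by (auto simp: Q_group_iff)

lemma pull_form_sesq:
  assumes M: "left_module M" and f: "f \<in> mod_hom M N" and \<phi>: "\<phi> \<in> sesq N"
  shows "pull_form M f \<phi> \<in> sesq M"
  unfolding pull_form_def
  by (rule sesqI[OF M])
     (auto simp: zero_ext_def left_moduleD[OF M] mod_homD[OF f] sesqD[OF \<phi>])

lemma pull_form_T_op:
  "pull_form M f (\<theta> - T_op bar \<epsilon> \<theta>) = pull_form M f \<theta> - T_op bar \<epsilon> (pull_form M f \<theta>)"
  by (auto simp: pull_form_def zero_ext_def T_op_def fun_eq_iff)

lemma pull_form_diff: "pull_form M f (\<phi> - \<phi>') = pull_form M f \<phi> - pull_form M f \<phi>'"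
  by (auto simp: pull_form_def zero_ext_def fun_eq_iff)

lemma Q_pull_class:
  assumes M: "left_module M" and N: "left_module N" and f: "f \<in> mod_hom M N" and \<phi>: "\<phi> \<in> sesq N"
  shows "Q_pull bar \<epsilon> M f (Q_class bar \<epsilon> N \<phi>) = Q_class bar \<epsilon> M (pull_form M f \<phi>)"
  unfolding Q_pull_def pull_form_def[symmetric]
proof (rule Q_class_UN[OF N \<phi>])
  fix \<phi>' \<theta> assume "\<phi>' \<in> sesq N" "\<theta> \<in> sesq N" and eq: "\<phi>' - \<phi> = \<theta> - T_op bar \<epsilon> \<theta>"
  then show "Q_class bar \<epsilon> M (pull_form M f \<phi>') = Q_class bar \<epsilon> M (pull_form M f \<phi>)"
    by (intro Q_class_eqI[OF M, where \<theta> = "pull_form M f \<theta>"] pull_form_sesq[OF M f] \<phi>)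
       (simp_all add: pull_form_diff[symmetric] pull_form_T_op[symmetric])
qed

lemma Q_pull_group:
  assumes M: "left_module M" and N: "left_module N" and f: "f \<in> mod_hom M N" and "\<psi> \<in> Q_group bar \<epsilon> N"
  shows "Q_pull bar \<epsilon> M f \<psi> \<in> Q_group bar \<epsilon> M"
  using assms(4) Q_pull_class[OF M N f] pull_form_sesq[OF M f] by (auto simp: Q_group_iff)

lemma Q_pull_comp:
  assumes M: "left_module M" and N: "left_module N" and P: "left_module P"
    and f: "f \<in> mod_hom M N" and g: "g \<in> mod_hom N P" and "\<psi> \<in> Q_group bar \<epsilon> P"
  shows "Q_pull bar \<epsilon> M f (Q_pull bar \<epsilon> N g \<psi>) = Q_pull bar \<epsilon> M (\<lambda>x. g (f x)) \<psi>"
proof -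
  obtain \<phi> where \<phi>: "\<phi> \<in> sesq P" "\<psi> = Q_class bar \<epsilon> P \<phi>" using assms(6) by (auto simp: Q_group_iff)
  have "pull_form M f (pull_form N g \<phi>) = pull_form M (\<lambda>x. g (f x)) \<phi>"
    using mod_homD(1)[OF f] by (auto simp: pull_form_def zero_ext_def fun_eq_iff)
  then show ?thesis
    using Q_pull_class[OF N P g \<phi>(1)] Q_pull_class[OF M N f pull_form_sesq[OF N g \<phi>(1)]]
      Q_pull_class[OF M P mod_hom_comp[OF f g] \<phi>(1)] \<phi>(2) by simp
qed

lemma Q_pull_cong:
  fixes f g :: "'m::ab_group_add \<Rightarrow> 'n"
  assumes "\<And>x. x \<in> carrier M \<Longrightarrow> f x = g x"
  shows "Q_pull bar \<epsilon> M f \<psi> = Q_pull bar \<epsilon> M g \<psi>"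
proof -
  have "zero_ext M (\<lambda>x y. \<phi> (f x) (f y)) = zero_ext M (\<lambda>x y. \<phi> (g x) (g y))" for \<phi> :: "'n \<Rightarrow> 'n \<Rightarrow> 'a"
    using assms by (auto simp: zero_ext_def fun_eq_iff)
  then show ?thesis by (simp add: Q_pull_def)
qed

lemma Q_pull_id:
  assumes M: "left_module M" and "\<psi> \<in> Q_group bar \<epsilon> M" and "\<And>x. x \<in> carrier M \<Longrightarrow> f x = x"
  shows "Q_pull bar \<epsilon> M f \<psi> = \<psi>"
proof -
  obtain \<phi> where \<phi>: "\<phi> \<in> sesq M" "\<psi> = Q_class bar \<epsilon> M \<phi>" using assms(2) by (auto simp: Q_group_iff)
  have "pull_form M (\<lambda>x. x) \<phi> = \<phi>"
    using sesqD(5)[OF \<phi>(1)] by (auto simp: pull_form_def zero_ext_def fun_eq_iff)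
  moreover have "(\<lambda>x. x) \<in> mod_hom M M" by (rule mod_homI) auto
  ultimately show ?thesis
    using Q_pull_class[OF M M _ \<phi>(1), of "\<lambda>x. x"] Q_pull_cong[of M f "\<lambda>x. x" \<psi>] assms(3) \<phi>(2) by simp
qed

lemma Q_symm_pull:
  assumes M: "left_module M" and N: "left_module N" and f: "f \<in> mod_hom M N" and "\<psi> \<in> Q_group bar \<epsilon> N"
    and "x \<in> carrier M" "y \<in> carrier M"
  shows "Q_symm bar \<epsilon> (Q_pull bar \<epsilon> M f \<psi>) x y = Q_symm bar \<epsilon> \<psi> (f x) (f y)"
proof -
  obtain \<phi> where \<phi>: "\<phi> \<in> sesq N" "\<psi> = Q_class bar \<epsilon> N \<phi>" using assms(4) by (auto simp: Q_group_iff)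
  show ?thesis
    unfolding \<phi>(2) Q_pull_class[OF M N f \<phi>(1)] Q_symm_class[OF N \<phi>(1)]
      Q_symm_class[OF M pull_form_sesq[OF M f \<phi>(1)]]
    using assms(5,6) by (simp add: pull_form_def zero_ext_def T_op_def)
qed

lemma sum_form_sesq:
  assumes M: "left_module M" and N: "left_module N" and \<phi>: "\<phi> \<in> sesq M" and \<phi>': "\<phi>' \<in> sesq N"
  shows "sum_form M N \<phi> \<phi>' \<in> sesq (mod_sum M N)"
  unfolding sum_form_def
  by (rule sesqI)
     (auto simp: zero_ext_def left_moduleD[OF M] left_moduleD[OF N] sesqD[OF \<phi>] sesqD[OF \<phi>'] M N
       distrib_left distrib_right)

lemma Q_sum_class:
  assumes M: "left_module M" and N: "left_module N" and \<phi>: "\<phi> \<in> sesq M" and \<chi>: "\<chi> \<in> sesq N"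
  shows "Q_sum bar \<epsilon> M N (Q_class bar \<epsilon> M \<phi>) (Q_class bar \<epsilon> N \<chi>) = Q_class bar \<epsilon> (mod_sum M N) (sum_form M N \<phi> \<chi>)"
proof -
  have S: "left_module (mod_sum M N)" using M N by simp
  have eq: "Q_class bar \<epsilon> (mod_sum M N) (sum_form M N \<phi>' \<chi>') = Q_class bar \<epsilon> (mod_sum M N) (sum_form M N \<phi> \<chi>)"
    if "\<phi> \<in> sesq M" "\<phi>' \<in> sesq M" "\<theta> \<in> sesq M" "\<phi>' - \<phi> = \<theta> - T_op bar \<epsilon> \<theta>"
      "\<chi> \<in> sesq N" "\<chi>' \<in> sesq N" "\<eta> \<in> sesq N" "\<chi>' - \<chi> = \<eta> - T_op bar \<epsilon> \<eta>" for \<phi> \<phi>' \<theta> \<chi> \<chi>' \<eta>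
  proof (rule Q_class_eqI[OF S, where \<theta> = "sum_form M N \<theta> \<eta>"])
    have "\<phi>' x y - \<phi> x y = \<theta> x y - T_op bar \<epsilon> \<theta> x y" "\<chi>' x' y' - \<chi> x' y' = \<eta> x' y' - T_op bar \<epsilon> \<eta> x' y'" for x y x' y'
      using fun_cong[OF fun_cong[OF that(4)]] fun_cong[OF fun_cong[OF that(8)]] by simp_all
    then show "sum_form M N \<phi>' \<chi>' - sum_form M N \<phi> \<chi> = sum_form M N \<theta> \<eta> - T_op bar \<epsilon> (sum_form M N \<theta> \<eta>)"
      by (auto simp: sum_form_def zero_ext_def T_op_def fun_eq_iff distrib_left algebra_simps)
  qed (intro sum_form_sesq M N that)+
  have "(\<Union>\<chi>'\<in>Q_class bar \<epsilon> N \<chi>. Q_class bar \<epsilon> (mod_sum M N) (sum_form M N \<phi>' \<chi>')) =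
      Q_class bar \<epsilon> (mod_sum M N) (sum_form M N \<phi>' \<chi>)" if "\<phi>' \<in> sesq M" for \<phi>'
    by (rule Q_class_UN[OF N \<chi>], rule eq[OF that that sesq_zero[OF M]]) (simp_all add: T_op_zero \<chi>)
  then have "(\<Union>\<chi>'\<in>Q_class bar \<epsilon> N \<chi>. Q_class bar \<epsilon> (mod_sum M N) (sum_form M N \<phi>' \<chi>')) =
      Q_class bar \<epsilon> (mod_sum M N) (sum_form M N \<phi>' \<chi>)" if "\<phi>' \<in> Q_class bar \<epsilon> M \<phi>" for \<phi>'
    using that by (simp add: Q_class_mem)
  moreover have "(\<Union>\<phi>'\<in>Q_class bar \<epsilon> M \<phi>. Q_class bar \<epsilon> (mod_sum M N) (sum_form M N \<phi>' \<chi>)) =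
      Q_class bar \<epsilon> (mod_sum M N) (sum_form M N \<phi> \<chi>)"
    by (rule Q_class_UN[OF M \<phi>], rule eq[OF \<phi> _ _ _ \<chi> \<chi> sesq_zero[OF N]]) (simp_all add: T_op_zero)
  ultimately show ?thesis unfolding Q_sum_def sum_form_def[symmetric] by simp
qed

lemma Q_sum_group:
  assumes M: "left_module M" and N: "left_module N"
    and "\<psi> \<in> Q_group bar \<epsilon> M" "\<chi> \<in> Q_group bar \<epsilon> N"
  shows "Q_sum bar \<epsilon> M N \<psi> \<chi> \<in> Q_group bar \<epsilon> (mod_sum M N)"
  using assms(3,4) Q_sum_class[OF M N] sum_form_sesq[OF M N] by (fastforce simp: Q_group_iff)

lemma Q_pull_sum:
  assumes M: "left_module M" and N: "left_module N" and M': "left_module M'" and N': "left_module N'"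
    and f: "f \<in> mod_hom M M'" and g: "g \<in> mod_hom N N'"
    and "\<psi> \<in> Q_group bar \<epsilon> M'" "\<chi> \<in> Q_group bar \<epsilon> N'"
  shows "Q_pull bar \<epsilon> (mod_sum M N) (map_prod f g) (Q_sum bar \<epsilon> M' N' \<psi> \<chi>) =
    Q_sum bar \<epsilon> M N (Q_pull bar \<epsilon> M f \<psi>) (Q_pull bar \<epsilon> N g \<chi>)"
proof -
  obtain \<phi> \<phi>' where \<phi>: "\<phi> \<in> sesq M'" "\<psi> = Q_class bar \<epsilon> M' \<phi>" "\<phi>' \<in> sesq N'" "\<chi> = Q_class bar \<epsilon> N' \<phi>'"
    using assms(7,8) by (auto simp: Q_group_iff)
  have hom: "map_prod f g \<in> mod_hom (mod_sum M N) (mod_sum M' N')"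
    by (rule mod_homI) (auto simp: mod_homD[OF f] mod_homD[OF g])
  have "pull_form (mod_sum M N) (map_prod f g) (sum_form M' N' \<phi> \<phi>') =
      sum_form M N (pull_form M f \<phi>) (pull_form N g \<phi>')"
    using mod_homD(1)[OF f] mod_homD(1)[OF g]
    by (auto simp: pull_form_def sum_form_def zero_ext_def fun_eq_iff)
  then show ?thesis
    unfolding \<phi> Q_sum_class[OF M' N' \<phi>(1,3)] Q_pull_class[OF M M' f \<phi>(1)] Q_pull_class[OF N N' g \<phi>(3)]
      Q_sum_class[OF M N pull_form_sesq[OF M f \<phi>(1)] pull_form_sesq[OF N g \<phi>(3)]]
    using Q_pull_class[OF _ _ hom sum_form_sesq[OF M' N' \<phi>(1,3)]] M N M' N' by simp
qed

lemma Q_pull_swap: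
  assumes M: "left_module M" and N: "left_module N"
    and "\<psi> \<in> Q_group bar \<epsilon> M" "\<chi> \<in> Q_group bar \<epsilon> N"
  shows "Q_pull bar \<epsilon> (mod_sum M N) prod.swap (Q_sum bar \<epsilon> N M \<chi> \<psi>) = Q_sum bar \<epsilon> M N \<psi> \<chi>"
proof -
  obtain \<phi> \<phi>' where \<phi>: "\<phi> \<in> sesq M" "\<psi> = Q_class bar \<epsilon> M \<phi>" "\<phi>' \<in> sesq N" "\<chi> = Q_class bar \<epsilon> N \<phi>'"
    using assms(3,4) by (auto simp: Q_group_iff)
  have hom: "prod.swap \<in> mod_hom (mod_sum M N) (mod_sum N M)"
    by (rule mod_homI) auto
  have "pull_form (mod_sum M N) prod.swap (sum_form N M \<phi>' \<phi>) = sum_form M N \<phi> \<phi>'"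
    by (auto simp: pull_form_def sum_form_def zero_ext_def fun_eq_iff add.commute)
  then show ?thesis
    unfolding \<phi> Q_sum_class[OF M N \<phi>(1,3)] Q_sum_class[OF N M \<phi>(3,1)]
    using Q_pull_class[OF _ _ hom sum_form_sesq[OF N M \<phi>(3,1)]] M N by simp
qed

lemma Q_symm_sum:
  assumes M: "left_module M" and N: "left_module N"
    and "\<psi> \<in> Q_group bar \<epsilon> M" "\<chi> \<in> Q_group bar \<epsilon> N"
    and "x \<in> carrier M" "x' \<in> carrier N" "y \<in> carrier M" "y' \<in> carrier N"
  shows "Q_symm bar \<epsilon> (Q_sum bar \<epsilon> M N \<psi> \<chi>) (x, x') (y, y') = Q_symm bar \<epsilon> \<psi> x y + Q_symm bar \<epsilon> \<chi> x' y'"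
proof -
  obtain \<phi> \<phi>' where \<phi>: "\<phi> \<in> sesq M" "\<psi> = Q_class bar \<epsilon> M \<phi>" "\<phi>' \<in> sesq N" "\<chi> = Q_class bar \<epsilon> N \<phi>'"
    using assms(3,4) by (auto simp: Q_group_iff)
  have S: "left_module (mod_sum M N)" using M N by simp
  show ?thesis
    unfolding \<phi> Q_sum_class[OF M N \<phi>(1,3)] Q_symm_class[OF S sum_form_sesq[OF M N \<phi>(1,3)]]
      Q_symm_class[OF M \<phi>(1)] Q_symm_class[OF N \<phi>(3)]
    using assms(5-8) by (simp add: sum_form_def zero_ext_def T_op_def distrib_left algebra_simps)
qed

end

section \<open>Isomorphisms of quasi-formations\<close>

context form_setting
begin

lemma Q_pull_based_sum: "Q_pull bar \<epsilon> (based_sum Z M N) = Q_pull bar \<epsilon> (mod_sum M N)"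
proof -
  have "Q_class bar \<epsilon> (based_sum Z M N) = Q_class bar \<epsilon> (mod_sum M N)" by (rule Q_class_cong) simp_all
  moreover have "zero_ext (based_sum Z M N) = zero_ext (mod_sum M N)" by (rule zero_ext_cong) simp
  ultimately show ?thesis by (intro ext) (simp only: Q_pull_def)
qed

lemma isometry_comp:
  assumes M: "weakly_based M" and N: "weakly_based N" and P: "weakly_based P"
    and \<chi>: "\<chi> \<in> Q_group bar \<epsilon> P"
    and f: "f \<in> isometry bar \<epsilon> Z M \<phi> N \<psi>" and g: "g \<in> isometry bar \<epsilon> Z N \<psi> P \<chi>"
  shows "(\<lambda>x. g (f x)) \<in> isometry bar \<epsilon> Z M \<phi> P \<chi>"
proof -
  have fs: "f \<in> simple_iso Z M N" and gs: "g \<in> simple_iso Z N P"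
    and fq: "Q_pull bar \<epsilon> M f \<psi> = \<phi>" and gq: "Q_pull bar \<epsilon> N g \<chi> = \<psi>"
    using f g by (auto simp: isometry_def)
  note wM = weakly_basedD[OF M] and wN = weakly_basedD[OF N] and wP = weakly_basedD[OF P]
  have "Q_pull bar \<epsilon> M (\<lambda>x. g (f x)) \<chi> = \<phi>"
    using Q_pull_comp[OF wM(1) wN(1) wP(1) mod_isoD(1)[OF simple_isoD(1)[OF M N fs]]
        mod_isoD(1)[OF simple_isoD(1)[OF N P gs]] \<chi>] fq gq by simp
  then show ?thesis using simple_iso_comp[OF M N P fs gs] by (simp add: isometry_def)
qed

lemma isometry_inverse:
  assumes M: "weakly_based M" and N: "weakly_based N" and \<psi>: "\<psi> \<in> Q_group bar \<epsilon> N"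
    and f: "f \<in> isometry bar \<epsilon> Z M \<phi> N \<psi>"
  obtains g where "g \<in> isometry bar \<epsilon> Z N \<psi> M \<phi>"
    "\<And>x. x \<in> carrier M \<Longrightarrow> g (f x) = x" "\<And>y. y \<in> carrier N \<Longrightarrow> f (g y) = y"
proof -
  have fs: "f \<in> simple_iso Z M N" and fq: "Q_pull bar \<epsilon> M f \<psi> = \<phi>"
    using f by (auto simp: isometry_def)
  obtain g where g: "g \<in> simple_iso Z N M" "\<And>x. x \<in> carrier M \<Longrightarrow> g (f x) = x"
    "\<And>y. y \<in> carrier N \<Longrightarrow> f (g y) = y"
    using simple_iso_inverse[OF M N fs] by blast
  note wM = weakly_basedD[OF M] and wN = weakly_basedD[OF N]
  have "Q_pull bar \<epsilon> N g \<phi> = Q_pull bar \<epsilon> N (\<lambda>y. f (g y)) \<psi>"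
    unfolding fq[symmetric]
    by (rule Q_pull_comp[OF wN(1) wM(1) wN(1) mod_isoD(1)[OF simple_isoD(1)[OF N M g(1)]]
        mod_isoD(1)[OF simple_isoD(1)[OF M N fs]] \<psi>])
  also have "\<dots> = \<psi>" by (rule Q_pull_id[OF wN(1) \<psi> g(3)])
  finally have "g \<in> isometry bar \<epsilon> Z N \<psi> M \<phi>" using g(1) by (simp add: isometry_def)
  then show ?thesis using that g(2,3) by blast
qed

lemma isometry_sum:
  assumes M: "weakly_based M" and M': "weakly_based M'" and N: "weakly_based N" and N': "weakly_based N'"
    and \<psi>: "\<psi>' \<in> Q_group bar \<epsilon> M'" and \<chi>: "\<chi>' \<in> Q_group bar \<epsilon> N'"
    and f: "f \<in> isometry bar \<epsilon> Z M \<psi> M' \<psi>'" and g: "g \<in> isometry bar \<epsilon> Z N \<chi> N' \<chi>'"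
  shows "map_prod f g \<in> isometry bar \<epsilon> Z (based_sum Z M N) (Q_sum bar \<epsilon> M N \<psi> \<chi>)
    (based_sum Z M' N') (Q_sum bar \<epsilon> M' N' \<psi>' \<chi>')"
proof -
  have fs: "f \<in> simple_iso Z M M'" and gs: "g \<in> simple_iso Z N N'"
    and fq: "Q_pull bar \<epsilon> M f \<psi>' = \<psi>" and gq: "Q_pull bar \<epsilon> N g \<chi>' = \<chi>"
    using f g by (auto simp: isometry_def)
  note hom = mod_isoD(1)[OF simple_isoD(1)[OF M M' fs]] mod_isoD(1)[OF simple_isoD(1)[OF N N' gs]]
  have "Q_pull bar \<epsilon> (mod_sum M N) (map_prod f g) (Q_sum bar \<epsilon> M' N' \<psi>' \<chi>') = Q_sum bar \<epsilon> M N \<psi> \<chi>"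
    using Q_pull_sum[OF weakly_basedD(1)[OF M] weakly_basedD(1)[OF N] weakly_basedD(1)[OF M']
        weakly_basedD(1)[OF N'] hom \<psi> \<chi>] fq gq by simp
  then show ?thesis
    using simple_iso_sum[OF M M' N N' fs gs] by (simp add: isometry_def Q_pull_based_sum)
qed

text \<open>
  The part of the definition of a quasi-formation which is needed for calculating with
  isomorphisms. Unlike quasi-formations themselves it is immediately inherited by sums, and it holds for
  trivial formations without discussing their Lagrangians.
\<close>

definition pre_quasi :: "('a, 'm::ab_group_add) quasi \<Rightarrow> bool" where
  "pre_quasi x \<longleftrightarrow> weakly_based (qmod x) \<and> weakly_based (qlag x) \<and> weakly_based (qsub x) \<and>
     qform x \<in> Q_group bar \<epsilon> (qmod x) \<and> submodule (qlag x) (qmod x) \<and> submodule (qsub x) (qmod x)"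

lemma submoduleD:
  assumes "submodule L M"
  shows "left_module L" "x \<in> carrier L \<Longrightarrow> x \<in> carrier M"
    and "x \<in> carrier L \<Longrightarrow> scl L a x = scl M a x"
  using assms unfolding submodule_def by blast+

lemma submodule_hom:
  assumes L: "submodule L M" and f: "f \<in> mod_hom M N"
  shows "f \<in> mod_hom L N"
  by (rule mod_homI) (simp_all add: submoduleD(2,3)[OF L] mod_homD[OF f])

lemma pre_quasiD:
  assumes "pre_quasi x"
  shows "weakly_based (qmod x)" "weakly_based (qlag x)" "weakly_based (qsub x)"
    "qform x \<in> Q_group bar \<epsilon> (qmod x)"
    "submodule (qlag x) (qmod x)" "submodule (qsub x) (qmod x)"
  using assms by (auto simp: pre_quasi_def)

lemma simple_iso_image:
  assumes "weakly_based M" "weakly_based N" "f \<in> simple_iso Z M N"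
  shows "f ` carrier M = carrier N"
  using mod_isoD(2)[OF simple_isoD(1)[OF assms]] by (simp add: bij_betw_def)

lemma quasi_isoI:
  assumes "pre_quasi x" "pre_quasi y"
    and "f \<in> isometry bar \<epsilon> Z (qmod x) (qform x) (qmod y) (qform y)"
    and "f \<in> simple_iso Z (qlag x) (qlag y)" "f \<in> simple_iso Z (qsub x) (qsub y)"
  shows "quasi_iso bar \<epsilon> Z x y"
  unfolding quasi_iso_def
  using assms(3-5) simple_iso_image[OF pre_quasiD(2)[OF assms(1)] pre_quasiD(2)[OF assms(2)]]
    simple_iso_image[OF pre_quasiD(3)[OF assms(1)] pre_quasiD(3)[OF assms(2)]] by blast

lemma quasi_isoE:
  assumes "quasi_iso bar \<epsilon> Z x y"
  obtains f where "f \<in> isometry bar \<epsilon> Z (qmod x) (qform x) (qmod y) (qform y)"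
    "f \<in> simple_iso Z (qlag x) (qlag y)" "f \<in> simple_iso Z (qsub x) (qsub y)"
  using assms unfolding quasi_iso_def by blast

lemma quasi_iso_refl:
  assumes x: "pre_quasi x"
  shows "quasi_iso bar \<epsilon> Z x x"
proof (rule quasi_isoI[OF x x, where f = "\<lambda>z. z"])
  note X = pre_quasiD[OF x]
  show "(\<lambda>z. z) \<in> isometry bar \<epsilon> Z (qmod x) (qform x) (qmod x) (qform x)"
    using simple_iso_id[OF X(1)] Q_pull_id[OF weakly_basedD(1)[OF X(1)] X(4)] by (simp add: isometry_def)
qed (intro simple_iso_id pre_quasiD[OF x] HOL.refl)+

lemma quasi_iso_sym:
  assumes x: "pre_quasi x" and y: "pre_quasi y" and xy: "quasi_iso bar \<epsilon> Z x y"
  shows "quasi_iso bar \<epsilon> Z y x"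
proof -
  note X = pre_quasiD[OF x] and Y = pre_quasiD[OF y]
  obtain f where f: "f \<in> isometry bar \<epsilon> Z (qmod x) (qform x) (qmod y) (qform y)"
    "f \<in> simple_iso Z (qlag x) (qlag y)" "f \<in> simple_iso Z (qsub x) (qsub y)"
    using quasi_isoE[OF xy] .
  obtain g where g: "g \<in> isometry bar \<epsilon> Z (qmod y) (qform y) (qmod x) (qform x)"
    "\<And>z. z \<in> carrier (qmod x) \<Longrightarrow> g (f z) = z"
    using isometry_inverse[OF X(1) Y(1,4) f(1)] by blast
  \<comment> \<open>On \<open>L'\<close> the inverse of the restriction of \<open>f\<close> coincides with the restriction of the inverse \<open>g\<close>.\<close>
  have restrict: "g \<in> simple_iso Z L' L"
    if L: "weakly_based L" and L': "weakly_based L'" and sub: "submodule L (qmod x)" and fL: "f \<in> simple_iso Z L L'" for L L'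
  proof -
    obtain h where h: "h \<in> simple_iso Z L' L" "\<And>y. y \<in> carrier L' \<Longrightarrow> f (h y) = y"
      using simple_iso_inverse[OF L L' fL] by blast
    have "h y = g y" if y: "y \<in> carrier L'" for y
    proof -
      have "h y \<in> carrier L" using mod_homD(1)[OF mod_isoD(1)[OF simple_isoD(1)[OF L' L h(1)]] y] .
      then have "g (f (h y)) = h y" by (rule g(2)[OF submoduleD(2)[OF sub]])
      then show ?thesis using h(2)[OF y] by simp
    qed
    then show ?thesis by (rule simple_iso_cong[OF L' L h(1)])
  qed
  show ?thesis
    by (rule quasi_isoI[OF y x g(1) restrict[OF X(2) Y(2) X(5) f(2)] restrict[OF X(3) Y(3) X(6) f(3)]])
qed

lemma quasi_iso_trans:
  assumes x: "pre_quasi x" and y: "pre_quasi y" and z: "pre_quasi z"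
    and xy: "quasi_iso bar \<epsilon> Z x y" and yz: "quasi_iso bar \<epsilon> Z y z"
  shows "quasi_iso bar \<epsilon> Z x z"
proof -
  note X = pre_quasiD[OF x] and Y = pre_quasiD[OF y] and W = pre_quasiD[OF z]
  obtain f where f: "f \<in> isometry bar \<epsilon> Z (qmod x) (qform x) (qmod y) (qform y)"
    "f \<in> simple_iso Z (qlag x) (qlag y)" "f \<in> simple_iso Z (qsub x) (qsub y)"
    using quasi_isoE[OF xy] .
  obtain g where g: "g \<in> isometry bar \<epsilon> Z (qmod y) (qform y) (qmod z) (qform z)"
    "g \<in> simple_iso Z (qlag y) (qlag z)" "g \<in> simple_iso Z (qsub y) (qsub z)"
    using quasi_isoE[OF yz] .
  show ?thesis
    by (rule quasi_isoI[OF x z isometry_comp[OF X(1) Y(1) W(1,4) f(1) g(1)]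
        simple_iso_comp[OF X(2) Y(2) W(2) f(2) g(2)] simple_iso_comp[OF X(3) Y(3) W(3) f(3) g(3)]])
qed

lemma submodule_sum:
  assumes "submodule L M" "submodule K N"
  shows "submodule (based_sum Z L K) (based_sum Z M N)"
  using submoduleD[OF assms(1)] submoduleD[OF assms(2)] left_module_mod_sum[of L K]
  unfolding submodule_def by (auto simp: based_sum_as_mod_sum mod_sum_def)

lemma quasi_sum_simps [simp]:
  "qmod (quasi_sum bar \<epsilon> Z x y) = based_sum Z (qmod x) (qmod y)"
  "qform (quasi_sum bar \<epsilon> Z x y) = Q_sum bar \<epsilon> (qmod x) (qmod y) (qform x) (qform y)"
  "qlag (quasi_sum bar \<epsilon> Z x y) = based_sum Z (qlag x) (qlag y)"
  "qsub (quasi_sum bar \<epsilon> Z x y) = based_sum Z (qsub x) (qsub y)"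
  by (simp_all add: quasi_sum_def)

lemma Q_sum_group_based:
  assumes "weakly_based M" "weakly_based N" "\<psi> \<in> Q_group bar \<epsilon> M" "\<chi> \<in> Q_group bar \<epsilon> N"
  shows "Q_sum bar \<epsilon> M N \<psi> \<chi> \<in> Q_group bar \<epsilon> (based_sum Z M N)"
  using Q_sum_group[OF weakly_basedD(1)[OF assms(1)] weakly_basedD(1)[OF assms(2)] assms(3,4)]
    Q_group_cong[of "based_sum Z M N" "mod_sum M N"] by simp

lemma pre_quasi_sum:
  assumes x: "pre_quasi x" and y: "pre_quasi y"
  shows "pre_quasi (quasi_sum bar \<epsilon> Z x y)"
  unfolding pre_quasi_def quasi_sum_simps
  by (intro conjI weakly_based_sum submodule_sum Q_sum_group_based pre_quasiD[OF x] pre_quasiD[OF y])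

lemma quasi_iso_sum:
  assumes x: "pre_quasi x" and x': "pre_quasi x'" and y: "pre_quasi y" and y': "pre_quasi y'"
    and xx: "quasi_iso bar \<epsilon> Z x x'" and yy: "quasi_iso bar \<epsilon> Z y y'"
  shows "quasi_iso bar \<epsilon> Z (quasi_sum bar \<epsilon> Z x y) (quasi_sum bar \<epsilon> Z x' y')"
proof -
  note X = pre_quasiD[OF x] and X' = pre_quasiD[OF x'] and Y = pre_quasiD[OF y] and Y' = pre_quasiD[OF y']
  obtain f where f: "f \<in> isometry bar \<epsilon> Z (qmod x) (qform x) (qmod x') (qform x')"
    "f \<in> simple_iso Z (qlag x) (qlag x')" "f \<in> simple_iso Z (qsub x) (qsub x')"
    using quasi_isoE[OF xx] .
  obtain g where g: "g \<in> isometry bar \<epsilon> Z (qmod y) (qform y) (qmod y') (qform y')"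
    "g \<in> simple_iso Z (qlag y) (qlag y')" "g \<in> simple_iso Z (qsub y) (qsub y')"
    using quasi_isoE[OF yy] .
  show ?thesis
    by (rule quasi_isoI[OF pre_quasi_sum[OF x y] pre_quasi_sum[OF x' y'], where f = "map_prod f g"];
        unfold quasi_sum_simps;
        intro isometry_sum simple_iso_sum X X' Y Y' f g)
qed

lemma quasi_iso_swap:
  assumes x: "pre_quasi x" and y: "pre_quasi y"
  shows "quasi_iso bar \<epsilon> Z (quasi_sum bar \<epsilon> Z x y) (quasi_sum bar \<epsilon> Z y x)"
proof (rule quasi_isoI[OF pre_quasi_sum[OF x y] pre_quasi_sum[OF y x], where f = prod.swap]; unfold quasi_sum_simps)
  note X = pre_quasiD[OF x] and Y = pre_quasiD[OF y]
  show "prod.swap \<in> isometry bar \<epsilon> Z (based_sum Z (qmod x) (qmod y))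
     (Q_sum bar \<epsilon> (qmod x) (qmod y) (qform x) (qform y)) (based_sum Z (qmod y) (qmod x))
     (Q_sum bar \<epsilon> (qmod y) (qmod x) (qform y) (qform x))"
    using simple_iso_swap[OF X(1) Y(1)]
      Q_pull_swap[OF weakly_basedD(1)[OF X(1)] weakly_basedD(1)[OF Y(1)] X(4) Y(4)]
    by (simp add: isometry_def Q_pull_based_sum)
qed (intro simple_iso_swap pre_quasiD[OF x] pre_quasiD[OF y])+

section \<open>Transport of quasi-formations\<close>

lemma inclusion_hom: "submodule L M \<Longrightarrow> (\<lambda>x. x) \<in> mod_hom L M"
  by (rule mod_homI) (simp_all add: submoduleD)

lemma direct_summandD: "direct_summand L M \<Longrightarrow> submodule L M"
  by (simp add: direct_summand_def)

lemma direct_summand_iso: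
  fixes M :: "('a, 'm::ab_group_add, 'z) lmod_scheme" and M' :: "('a, 'n::ab_group_add, 'w) lmod_scheme"
  assumes L: "direct_summand L M" and f: "f \<in> mod_iso M M'" and L': "submodule L' M'"
    and im: "f ` carrier L = carrier L'" and M: "left_module M"
  shows "direct_summand L' M'"
proof -
  obtain C :: "('a, 'm) lmod" where C: "submodule C M" "carrier L \<inter> carrier C = {0}"
    "\<And>x. x \<in> carrier M \<Longrightarrow> \<exists>y\<in>carrier L. \<exists>z\<in>carrier C. x = y + z"
    using L unfolding direct_summand_def by blast
  note fh = mod_isoD(1)[OF f] and fb = mod_isoD(2)[OF f]
  have Lsub: "submodule L M" using L by (rule direct_summandD)
  define C' :: "('a, 'n) lmod" where "C' = \<lparr>carrier = f ` carrier C, scl = scl M'\<rparr>"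
  have car: "carrier C' = f ` carrier C" and sclC: "scl C' = scl M'" by (simp_all add: C'_def)
  have "left_module C'"
    unfolding C'_def by (rule left_module_image[OF submoduleD(1)[OF C(1)] submodule_hom[OF C(1) fh]])
  then have "submodule C' M'"
    unfolding submodule_def using car sclC mod_homD(1)[OF fh] submoduleD(2)[OF C(1)] by auto
  moreover have "carrier L' \<inter> carrier C' = {0}"
  proof -
    have "f ` carrier L \<inter> f ` carrier C = f ` (carrier L \<inter> carrier C)"
      using fb submoduleD(2)[OF Lsub] submoduleD(2)[OF C(1)]
      by (intro inj_on_image_Int[symmetric, of f "carrier M"]) (auto simp: bij_betw_def)
    then show ?thesis using C(2) im car mod_hom_zero[OF M fh] by simp
  qed
  moreover have "\<exists>y\<in>carrier L'. \<exists>z\<in>carrier C'. w = y + z" if w: "w \<in> carrier M'" for w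
  proof -
    obtain x where x: "x \<in> carrier M" "w = f x" using fb w by (auto simp: bij_betw_def)
    obtain y z where yz: "y \<in> carrier L" "z \<in> carrier C" "x = y + z" using C(3)[OF x(1)] by blast
    have "w = f y + f z"
      using mod_homD(2)[OF fh submoduleD(2)[OF Lsub yz(1)] submoduleD(2)[OF C(1) yz(2)]] x(2) yz(3) by simp
    moreover have "f y \<in> carrier L'" "f z \<in> carrier C'" using yz im car by auto
    ultimately show ?thesis by blast
  qed
  ultimately show ?thesis using L' unfolding direct_summand_def by blast
qed

lemma direct_summand_sum:
  fixes M :: "('a, 'm::ab_group_add) based" and N :: "('a, 'n::ab_group_add) based"
  assumes L: "direct_summand L M" and K: "direct_summand K N"
  shows "direct_summand (based_sum Z L K) (based_sum Z M N)"
proof -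
  obtain C :: "('a, 'm) lmod" where C: "submodule C M" "carrier L \<inter> carrier C = {0}"
    "\<And>x. x \<in> carrier M \<Longrightarrow> \<exists>y\<in>carrier L. \<exists>z\<in>carrier C. x = y + z"
    using L unfolding direct_summand_def by blast
  obtain D :: "('a, 'n) lmod" where D: "submodule D N" "carrier K \<inter> carrier D = {0}"
    "\<And>x. x \<in> carrier N \<Longrightarrow> \<exists>y\<in>carrier K. \<exists>z\<in>carrier D. x = y + z"
    using K unfolding direct_summand_def by blast
  have "submodule (mod_sum C D) (based_sum Z M N)"
    using submoduleD[OF C(1)] submoduleD[OF D(1)] left_module_mod_sum[of C D]
    unfolding submodule_def by (auto simp: mod_sum_def)
  moreover have "carrier (based_sum Z L K) \<inter> carrier (mod_sum C D) = {0}"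
    using C(2) D(2) by (auto simp: zero_prod_def)
  moreover have "\<exists>y\<in>carrier (based_sum Z L K). \<exists>z\<in>carrier (mod_sum C D). x = y + z"
    if "x \<in> carrier (based_sum Z M N)" for x
  proof -
    obtain a b where ab: "x = (a, b)" "a \<in> carrier M" "b \<in> carrier N" using \<open>x \<in> _\<close> by auto
    obtain y z where "y \<in> carrier L" "z \<in> carrier C" "a = y + z" using C(3)[OF ab(2)] by blast
    moreover obtain u v where "u \<in> carrier K" "v \<in> carrier D" "b = u + v" using D(3)[OF ab(3)] by blast
    ultimately show ?thesis
      using ab(1) by (intro bexI[of _ "(y, u)"] bexI[of _ "(z, v)"]) auto
  qed
  ultimately show ?thesis
    using submodule_sum[OF direct_summandD[OF L] direct_summandD[OF K]] unfolding direct_summand_def by blast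
qed

text \<open>
  The projection of the sequence associated with a Lagrangian: the adjoint of the symmetrized form,
  restricted to \<open>L\<close>.
\<close>

definition lag_proj ::
  "('m \<Rightarrow> 'm \<Rightarrow> 'a) set \<Rightarrow> ('a, 'm::ab_group_add) based \<Rightarrow> 'm \<Rightarrow> 'm \<Rightarrow> 'a" where
  "lag_proj \<psi> L = (\<lambda>x y. if y \<in> carrier L then Q_symm bar \<epsilon> \<psi> x y else 0)"

lemma lag_proj_hom:
  assumes M: "left_module M" and L: "submodule L M" and \<psi>: "\<psi> \<in> Q_group bar \<epsilon> M"
  shows "lag_proj \<psi> L \<in> mod_hom M (dual_lmod bar L)"
proof (rule mod_homI)
  note S = sesqD[OF Q_symm_sesq[OF M \<psi>]] and LD = submoduleD[OF L]
  fix x assume x: "x \<in> carrier M"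
  show "lag_proj \<psi> L x \<in> carrier (dual_lmod bar L)"
    unfolding dual_lmod_carrier lag_proj_def
    using left_moduleD(2,4)[OF LD(1)] S(2,4)[OF x] LD(2,3) by simp
  show "lag_proj \<psi> L (x + y) = lag_proj \<psi> L x + lag_proj \<psi> L y" if "y \<in> carrier M" for y
    using S(1)[OF x that] by (auto simp: lag_proj_def fun_eq_iff)
  show "lag_proj \<psi> L (scl M a x) = scl (dual_lmod bar L) a (lag_proj \<psi> L x)" for a
    using S(3)[OF x] by (auto simp: lag_proj_def fun_eq_iff)
qed

text \<open>
  For a Lagrangian the exactness of the sequence is automatic; what remains of simplicity is the
  existence of a section of the projection with simple associated isomorphism.
\<close>

lemma simple_lagrangian_iff:
  assumes M: "left_module M" and \<psi>: "\<psi> \<in> Q_group bar \<epsilon> M"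
  shows "simple_lagrangian bar \<epsilon> Z M \<psi> L \<longleftrightarrow> lagrangian bar \<epsilon> Z M \<psi> L \<and>
    (\<exists>s\<in>mod_hom (dual_lmod bar L) M. (\<forall>\<phi>\<in>carrier (dual_lmod bar L). lag_proj \<psi> L (s \<phi>) = \<phi>) \<and>
        (\<lambda>(x, \<phi>). x + s \<phi>) \<in> simple_iso Z (based_sum Z L (dual bar L)) M)"
proof -
  have hom: "mod_hom (dual bar L) M = mod_hom (dual_lmod bar L) M" "mod_hom M (dual bar L) = mod_hom M (dual_lmod bar L)"
    by (rule mod_hom_cong; simp)+
  have "based_exact Z (\<lambda>x. x) (lag_proj \<psi> L) L M (dual bar L) \<longleftrightarrow>
      (\<exists>s\<in>mod_hom (dual_lmod bar L) M. (\<forall>\<phi>\<in>carrier (dual_lmod bar L). lag_proj \<psi> L (s \<phi>) = \<phi>) \<and>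
        (\<lambda>(x, \<phi>). x + s \<phi>) \<in> simple_iso Z (based_sum Z L (dual bar L)) M)" (is "_ \<longleftrightarrow> ?R")
    if lag: "lagrangian bar \<epsilon> Z M \<psi> L"
  proof
    assume ?R
    then obtain s where s: "s \<in> mod_hom (dual_lmod bar L) M"
      "\<And>\<phi>. \<phi> \<in> carrier (dual_lmod bar L) \<Longrightarrow> lag_proj \<psi> L (s \<phi>) = \<phi>" by blast
    have sub: "submodule L M" using lag by (auto simp: lagrangian_def intro: direct_summandD)
    note p = lag_proj_hom[OF M sub \<psi>]
    have "lag_proj \<psi> L ` carrier M = carrier (dual_lmod bar L)"
    proof
      show "lag_proj \<psi> L ` carrier M \<subseteq> carrier (dual_lmod bar L)" using mod_homD(1)[OF p] by blast
      show "carrier (dual_lmod bar L) \<subseteq> lag_proj \<psi> L ` carrier M"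
        using s(2) mod_homD(1)[OF s(1)] by (metis imageI subsetI)
    qed
    moreover have "carrier L = {x \<in> carrier M. lag_proj \<psi> L x = 0}"
    proof -
      have "carrier L = perp bar \<epsilon> M \<psi> (carrier L)" using lag by (simp add: lagrangian_def)
      also have "\<dots> = {x \<in> carrier M. lag_proj \<psi> L x = 0}"
        by (auto simp: perp_def lag_proj_def fun_eq_iff)
      finally show ?thesis .
    qed
    ultimately show "based_exact Z (\<lambda>x. x) (lag_proj \<psi> L) L M (dual bar L)"
      using p inclusion_hom[OF sub] \<open>?R\<close> unfolding based_exact_def hom by simp
  qed (auto simp: based_exact_def hom)
  then show ?thesis unfolding simple_lagrangian_def lag_proj_def by blast
qed


lemma lagrangianD:
  assumes "lagrangian bar \<epsilon> Z M \<psi> L"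
  shows "based_module Z L" "weakly_based L" "direct_summand L M" "submodule L M"
    "carrier L = perp bar \<epsilon> M \<psi> (carrier L)" "Q_restrict bar \<epsilon> L \<psi> = Q_class bar \<epsilon> L 0"
  using assms based_moduleD(1)[of L] by (auto simp: lagrangian_def intro: direct_summandD)

lemma lagrangian_iso:
  assumes M: "weakly_based M" and M': "weakly_based M'" and \<psi>': "\<psi>' \<in> Q_group bar \<epsilon> M'"
    and f: "f \<in> isometry bar \<epsilon> Z M \<psi> M' \<psi>'" and L': "based_module Z L'" "submodule L' M'"
    and fL: "f \<in> simple_iso Z L L'" and lag: "lagrangian bar \<epsilon> Z M \<psi> L"
  shows "lagrangian bar \<epsilon> Z M' \<psi>' L'"
proof -
  note LD = lagrangianD[OF lag] and wM = weakly_basedD(1)[OF M] and wM' = weakly_basedD(1)[OF M']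
  note wL' = based_moduleD(1)[OF L'(1)]
  note lL = weakly_basedD(1)[OF LD(2)] and lL' = weakly_basedD(1)[OF wL']
  have fs: "f \<in> simple_iso Z M M'" and fq: "Q_pull bar \<epsilon> M f \<psi>' = \<psi>" using f by (auto simp: isometry_def)
  note fi = simple_isoD(1)[OF M M' fs] and fLi = simple_isoD(1)[OF LD(2) wL' fL]
  note fh = mod_isoD(1)[OF fi]
  have im: "f ` carrier L = carrier L'" by (rule simple_iso_image[OF LD(2) wL' fL])
  have imM: "f ` carrier M = carrier M'" by (rule simple_iso_image[OF M M' fs])
  have symm: "Q_symm bar \<epsilon> \<psi>' (f x) (f y) = Q_symm bar \<epsilon> \<psi> x y" if "x \<in> carrier M" "y \<in> carrier M" for x y
    using Q_symm_pull[OF wM wM' fh \<psi>' that] fq by simp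
  show ?thesis
    unfolding lagrangian_def
  proof (intro conjI)
    show "based_module Z L'" by (rule L'(1))
    show "direct_summand L' M'" by (rule direct_summand_iso[OF LD(3) fi L'(2) im wM])
    show "carrier L' = perp bar \<epsilon> M' \<psi>' (carrier L')"
    proof -
      have "perp bar \<epsilon> M' \<psi>' (carrier L') = f ` perp bar \<epsilon> M \<psi> (carrier L)"
        unfolding perp_def im[symmetric] imM[symmetric]
        using symm submoduleD(2)[OF LD(4)] by (auto simp: image_iff)
      then show ?thesis using LD(5) im by simp
    qed
    obtain g where g: "g \<in> mod_iso L' L" "\<And>y. y \<in> carrier L' \<Longrightarrow> f (g y) = y"
      using mod_iso_inverse[OF lL fLi] by blast
    have "Q_restrict bar \<epsilon> L' \<psi>' = Q_pull bar \<epsilon> L' (\<lambda>y. f (g y)) \<psi>'"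
      by (rule Q_pull_cong) (simp add: g(2))
    also have "\<dots> = Q_pull bar \<epsilon> L' g (Q_pull bar \<epsilon> L f \<psi>')"
      by (rule Q_pull_comp[OF lL' lL wM' mod_isoD(1)[OF g(1)] submodule_hom[OF LD(4) fh] \<psi>', symmetric])
    also have "Q_pull bar \<epsilon> L f \<psi>' = Q_restrict bar \<epsilon> L \<psi>"
      unfolding fq[symmetric]
      by (rule Q_pull_comp[OF lL wM wM' inclusion_hom[OF LD(4)] fh \<psi>', symmetric])
    also have "Q_pull bar \<epsilon> L' g (Q_restrict bar \<epsilon> L \<psi>) = Q_class bar \<epsilon> L' (pull_form L' g 0)"
      unfolding LD(6) by (rule Q_pull_class[OF lL' lL mod_isoD(1)[OF g(1)] sesq_zero[OF lL]])
    also have "pull_form L' g 0 = 0" by (simp add: pull_form_def zero_ext_def fun_eq_iff)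
    finally show "Q_restrict bar \<epsilon> L' \<psi>' = Q_class bar \<epsilon> L' 0" .
  qed
qed

text \<open>
  A section \<open>s\<close> of the projection for \<open>L\<close> is transported to the composite of \<open>f\<close>, \<open>s\<close> and the dual
  of the restriction of \<open>f\<close>. The isomorphism which it defines is conjugate to that of \<open>s\<close> by simple
  isomorphisms.
\<close>

lemma simple_lagrangian_iso:
  assumes M: "weakly_based M" and M': "weakly_based M'" and \<psi>': "\<psi>' \<in> Q_group bar \<epsilon> M'"
    and f: "f \<in> isometry bar \<epsilon> Z M \<psi> M' \<psi>'" and L': "based_module Z L'" "submodule L' M'"
    and fL: "f \<in> simple_iso Z L L'" and lag: "simple_lagrangian bar \<epsilon> Z M \<psi> L"
  shows "simple_lagrangian bar \<epsilon> Z M' \<psi>' L'"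
proof -
  note wM = weakly_basedD(1)[OF M] and wM' = weakly_basedD(1)[OF M']
  have fs: "f \<in> simple_iso Z M M'" and fq: "Q_pull bar \<epsilon> M f \<psi>' = \<psi>" using f by (auto simp: isometry_def)
  note fh = mod_isoD(1)[OF simple_isoD(1)[OF M M' fs]]
  have \<psi>: "\<psi> \<in> Q_group bar \<epsilon> M" using Q_pull_group[OF wM wM' fh \<psi>'] fq by simp
  obtain s where lag0: "lagrangian bar \<epsilon> Z M \<psi> L" and s: "s \<in> mod_hom (dual_lmod bar L) M"
    "\<And>\<phi>. \<phi> \<in> carrier (dual_lmod bar L) \<Longrightarrow> lag_proj \<psi> L (s \<phi>) = \<phi>"
    "(\<lambda>(x, \<phi>). x + s \<phi>) \<in> simple_iso Z (based_sum Z L (dual bar L)) M"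
    using lag unfolding simple_lagrangian_iff[OF wM \<psi>] by blast
  note LD = lagrangianD[OF lag0]
  note wL' = based_moduleD(1)[OF L'(1)]
  note lL = weakly_basedD(1)[OF LD(2)] and lL' = weakly_basedD(1)[OF wL']
  note fLi = simple_isoD(1)[OF LD(2) wL' fL]
  have im: "f ` carrier L = carrier L'" by (rule simple_iso_image[OF LD(2) wL' fL])
  define s' where "s' = (\<lambda>\<phi>. f (s (dual_map L f \<phi>)))"
  have dh: "dual_map L f \<in> mod_hom (dual_lmod bar L') (dual_lmod bar L)"
    by (rule dual_map_hom[OF lL mod_isoD(1)[OF fLi]])
  have s'h: "s' \<in> mod_hom (dual_lmod bar L') M'"
    unfolding s'_def by (rule mod_hom_comp[OF mod_hom_comp[OF dh s(1)] fh])
  have "lag_proj \<psi>' L' (s' \<phi>) = \<phi>" if \<phi>: "\<phi> \<in> carrier (dual_lmod bar L')" for \<phi>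
  proof
    fix y
    show "lag_proj \<psi>' L' (s' \<phi>) y = \<phi> y"
    proof (cases "y \<in> carrier L'")
      case True
      then obtain x where x: "x \<in> carrier L" "y = f x" using im by auto
      note d\<phi> = mod_homD(1)[OF dh \<phi>]
      have "lag_proj \<psi>' L' (s' \<phi>) y = Q_symm bar \<epsilon> \<psi>' (f (s (dual_map L f \<phi>))) (f x)"
        using True x(2) by (simp add: lag_proj_def s'_def)
      also have "\<dots> = Q_symm bar \<epsilon> \<psi> (s (dual_map L f \<phi>)) x"
        using Q_symm_pull[OF wM wM' fh \<psi>' mod_homD(1)[OF s(1) d\<phi>] submoduleD(2)[OF LD(4) x(1)]] fq by simp
      also have "\<dots> = lag_proj \<psi> L (s (dual_map L f \<phi>)) x" using x(1) by (simp add: lag_proj_def)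
      also have "\<dots> = dual_map L f \<phi> x" by (simp only: s(2)[OF d\<phi>])
      finally show ?thesis using x by (simp add: dual_map_def)
    next
      case False
      then show ?thesis using dual_lmodD(3)[OF \<phi>] by (simp add: lag_proj_def)
    qed
  qed
  moreover have "(\<lambda>(x, \<phi>). x + s' \<phi>) \<in> simple_iso Z (based_sum Z L' (dual bar L')) M'"
  proof -
    obtain g where g: "g \<in> simple_iso Z L' L" "\<And>y. y \<in> carrier L' \<Longrightarrow> f (g y) = y"
      using simple_iso_inverse[OF LD(2) wL' fL] by blast
    note dL = weakly_based_dual[OF LD(2)] and dL' = weakly_based_dual[OF wL']
    note S = weakly_based_sum[OF LD(2) dL] and S' = weakly_based_sum[OF wL' dL']
    have 1: "map_prod g (dual_map L f) \<in> simple_iso Z (based_sum Z L' (dual bar L')) (based_sum Z L (dual bar L))"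
      by (rule simple_iso_sum[OF wL' LD(2) dL' dL g(1) dual_map_simple[OF LD(2) L'(1) fL]])
    show ?thesis
    proof (rule simple_iso_cong[OF S' M' simple_iso_comp[OF S' M M' simple_iso_comp[OF S' S M 1 s(3)] fs]])
      fix z assume "z \<in> carrier (based_sum Z L' (dual bar L'))"
      then obtain x \<phi> where z: "z = (x, \<phi>)" "x \<in> carrier L'" "\<phi> \<in> carrier (dual_lmod bar L')" by auto
      have "g x \<in> carrier M"
        using submoduleD(2)[OF LD(4) mod_homD(1)[OF mod_isoD(1)[OF simple_isoD(1)[OF wL' LD(2) g(1)]] z(2)]] .
      then have "f (g x + s (dual_map L f \<phi>)) = f (g x) + f (s (dual_map L f \<phi>))"
        by (rule mod_homD(2)[OF fh _ mod_homD(1)[OF s(1) mod_homD(1)[OF dh z(3)]]])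
      then show "f ((\<lambda>(x, \<phi>). x + s \<phi>) (map_prod g (dual_map L f) z)) = (\<lambda>(x, \<phi>). x + s' \<phi>) z"
        using g(2)[OF z(2)] by (simp add: z(1) s'_def)
    qed
  qed
  ultimately show ?thesis
    unfolding simple_lagrangian_iff[OF wM' \<psi>']
    using lagrangian_iso[OF M M' \<psi>' f L' fL lag0] s'h by blast
qed

text \<open>
  The adjoint of the transported form is the composite of the adjoint of \<open>\<psi>\<close> with the inverse \<open>g\<close>
  of \<open>f\<close> and with the dual of \<open>g\<close>.
\<close>

lemma simple_form_iso:
  assumes M: "based_module Z M" and M': "based_module Z M'" and \<psi>': "\<psi>' \<in> Q_group bar \<epsilon> M'"
    and f: "f \<in> isometry bar \<epsilon> Z M \<psi> M' \<psi>'" and form: "simple_form bar \<epsilon> Z M \<psi>"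
  shows "simple_form bar \<epsilon> Z M' \<psi>'"
proof -
  note wM = based_moduleD(1)[OF M] and wM' = based_moduleD(1)[OF M']
  note lM = weakly_basedD(1)[OF wM] and lM' = weakly_basedD(1)[OF wM']
  have fs: "f \<in> simple_iso Z M M'" and fq: "Q_pull bar \<epsilon> M f \<psi>' = \<psi>" using f by (auto simp: isometry_def)
  note fh = mod_isoD(1)[OF simple_isoD(1)[OF wM wM' fs]]
  obtain g where g: "g \<in> simple_iso Z M' M" "\<And>y. y \<in> carrier M' \<Longrightarrow> f (g y) = y"
    using simple_iso_inverse[OF wM wM' fs] by blast
  note gc = mod_homD(1)[OF mod_isoD(1)[OF simple_isoD(1)[OF wM' wM g(1)]]]
  have form': "Q_symm bar \<epsilon> \<psi> \<in> simple_iso Z M (dual bar M)" using form by (simp add: simple_form_def)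
  note dM = weakly_based_dual[OF wM] and dM' = weakly_based_dual[OF wM']
  have "Q_symm bar \<epsilon> \<psi>' \<in> simple_iso Z M' (dual bar M')"
  proof (rule simple_iso_cong[OF wM' dM' simple_iso_comp[OF wM' dM dM'
          simple_iso_comp[OF wM' wM dM g(1) form'] dual_map_simple[OF wM' M g(1)]]])
    fix x assume x: "x \<in> carrier M'"
    show "dual_map M' g (Q_symm bar \<epsilon> \<psi> (g x)) = Q_symm bar \<epsilon> \<psi>' x"
    proof
      fix y
      show "dual_map M' g (Q_symm bar \<epsilon> \<psi> (g x)) y = Q_symm bar \<epsilon> \<psi>' x y"
      proof (cases "y \<in> carrier M'")
        case True
        then show ?thesis
          using Q_symm_pull[OF lM lM' fh \<psi>' gc[OF x] gc[OF True]] fq g(2)[OF x] g(2)[OF True]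
          by (simp add: dual_map_def)
      next
        case False
        then show ?thesis
          using sesqD(5)[OF Q_symm_sesq[OF lM' \<psi>'], of x y] by (simp add: dual_map_def)
      qed
    qed
  qed
  then show ?thesis using M' \<psi>' by (simp add: simple_form_def quadratic_form_def)
qed

lemma simple_formD:
  assumes "simple_form bar \<epsilon> Z M \<psi>"
  shows "based_module Z M" "weakly_based M" "\<psi> \<in> Q_group bar \<epsilon> M" "Q_symm bar \<epsilon> \<psi> \<in> simple_iso Z M (dual bar M)"
  using assms based_moduleD(1)[of M] by (auto simp: simple_form_def quadratic_form_def)

lemma quasi_formationD:
  assumes "quasi_formation bar \<epsilon> Z x"
  shows "simple_form bar \<epsilon> Z (qmod x) (qform x)"
    "simple_lagrangian bar \<epsilon> Z (qmod x) (qform x) (qlag x)" "lagrangian bar \<epsilon> Z (qmod x) (qform x) (qlag x)"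
    "based_module Z (qsub x)" "direct_summand (qsub x) (qmod x)"
    "2 * mod_rank (qsub x) = mod_rank (qmod x)"
  using assms by (auto simp: quasi_formation_def simple_lagrangian_def)

lemma quasi_formation_pre:
  assumes "quasi_formation bar \<epsilon> Z x"
  shows "pre_quasi x"
  unfolding pre_quasi_def
  using quasi_formationD[OF assms] simple_formD[of "qmod x" "qform x"] lagrangianD[of "qmod x" "qform x" "qlag x"]
    based_moduleD(1)[of "qsub x"] direct_summandD[of "qsub x" "qmod x"] by blast

lemma quasi_formation_iso:
  assumes x: "quasi_formation bar \<epsilon> Z x"
    and based: "based_module Z (qmod y)" "based_module Z (qlag y)" "based_module Z (qsub y)"
    and form: "qform y \<in> Q_group bar \<epsilon> (qmod y)"
    and sub: "submodule (qlag y) (qmod y)" "submodule (qsub y) (qmod y)"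
    and iso: "quasi_iso bar \<epsilon> Z x y"
  shows "quasi_formation bar \<epsilon> Z y" "simple_formation bar \<epsilon> Z x \<Longrightarrow> simple_formation bar \<epsilon> Z y"
proof -
  note X = quasi_formationD[OF x] and P = pre_quasiD[OF quasi_formation_pre[OF x]]
  note wy = based[THEN based_moduleD(1)]
  obtain f where f: "f \<in> isometry bar \<epsilon> Z (qmod x) (qform x) (qmod y) (qform y)"
    "f \<in> simple_iso Z (qlag x) (qlag y)" "f \<in> simple_iso Z (qsub x) (qsub y)"
    using quasi_isoE[OF iso] .
  have fs: "f \<in> simple_iso Z (qmod x) (qmod y)" using f(1) by (simp add: isometry_def)
  have "mod_rank (qsub x) = mod_rank (qsub y)" "mod_rank (qmod x) = mod_rank (qmod y)"
    using mod_rank_iso[OF weakly_finite P(3) wy(3) simple_isoD(1)[OF P(3) wy(3) f(3)]]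
      mod_rank_iso[OF weakly_finite P(1) wy(1) simple_isoD(1)[OF P(1) wy(1) fs]] by auto
  then show y: "quasi_formation bar \<epsilon> Z y"
    unfolding quasi_formation_def
    using simple_form_iso[OF simple_formD(1)[OF X(1)] based(1) form f(1) X(1)]
      simple_lagrangian_iso[OF P(1) wy(1) form f(1) based(2) sub(1) f(2) X(2)]
      direct_summand_iso[OF X(5) simple_isoD(1)[OF P(1) wy(1) fs] sub(2) simple_iso_image[OF P(3) wy(3) f(3)]
        weakly_basedD(1)[OF P(1)]] based(3) X(6) by simp
  show "simple_formation bar \<epsilon> Z y" if "simple_formation bar \<epsilon> Z x"
    using y simple_lagrangian_iso[OF P(1) wy(1) form f(1) based(3) sub(2) f(3)] that
    by (simp add: simple_formation_def)
qed

text \<open>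
  The module is isomorphic to the sum of \<open>L\<close> and its dual, which have equal ranks.
\<close>

lemma simple_lagrangian_half_rank:
  assumes M: "weakly_based M" and \<psi>: "\<psi> \<in> Q_group bar \<epsilon> M" and lag: "simple_lagrangian bar \<epsilon> Z M \<psi> L"
  shows "2 * mod_rank L = mod_rank M"
proof -
  obtain s where lag0: "lagrangian bar \<epsilon> Z M \<psi> L"
    and s: "(\<lambda>(x, \<phi>). x + s \<phi>) \<in> simple_iso Z (based_sum Z L (dual bar L)) M"
    using lag unfolding simple_lagrangian_iff[OF weakly_basedD(1)[OF M] \<psi>] by blast
  note L = lagrangianD(2)[OF lag0]
  note S = weakly_based_sum[OF L weakly_based_dual[OF L]]
  show ?thesis
    using mod_rank_iso[OF weakly_finite S M simple_isoD(1)[OF S M s]]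
      mod_rank_sum[OF weakly_finite L weakly_based_dual[OF L]] mod_rank_dual[OF L] by simp
qed

lemma simple_formationI:
  assumes form: "simple_form bar \<epsilon> Z M \<psi>" and K: "simple_lagrangian bar \<epsilon> Z M \<psi> K"
    and L: "simple_lagrangian bar \<epsilon> Z M \<psi> L"
  shows "simple_formation bar \<epsilon> Z \<lparr>qmod = M, qform = \<psi>, qlag = K, qsub = L\<rparr>"
proof -
  have "lagrangian bar \<epsilon> Z M \<psi> L" using L by (simp add: simple_lagrangian_def)
  note LD = lagrangianD[OF this]
  show ?thesis
    using assms simple_lagrangian_half_rank[OF simple_formD(2,3)[OF form] L] LD(1,3)
    by (simp add: simple_formation_def quasi_formation_def)
qed

section \<open>Sums of quasi-formations\<close>

text \<open>
  The adjoint of the sum is the sum of the adjoints, followed by the identification of the sum of the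
  duals with the dual of the sum.
\<close>

lemma simple_form_sum:
  assumes M: "simple_form bar \<epsilon> Z M \<psi>" and N: "simple_form bar \<epsilon> Z N \<chi>"
  shows "simple_form bar \<epsilon> Z (based_sum Z M N) (Q_sum bar \<epsilon> M N \<psi> \<chi>)"
proof -
  note MD = simple_formD[OF M] and ND = simple_formD[OF N]
  note lM = weakly_basedD(1)[OF MD(2)] and lN = weakly_basedD(1)[OF ND(2)]
  note dM = weakly_based_dual[OF MD(2)] and dN = weakly_based_dual[OF ND(2)]
  let ?S = "based_sum Z M N"
  note S = weakly_based_sum[OF MD(2) ND(2)]
  have group: "Q_sum bar \<epsilon> M N \<psi> \<chi> \<in> Q_group bar \<epsilon> ?S"
    by (rule Q_sum_group_based[OF MD(2) ND(2) MD(3) ND(3)])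
  have "Q_symm bar \<epsilon> (Q_sum bar \<epsilon> M N \<psi> \<chi>) \<in> simple_iso Z ?S (dual bar ?S)"
  proof (rule simple_iso_cong[OF S weakly_based_dual[OF S] simple_iso_comp[OF S weakly_based_sum[OF dM dN]
          weakly_based_dual[OF S] simple_iso_sum[OF MD(2) dM ND(2) dN MD(4) ND(4)]
          dual_of_sum_simple[OF MD(2) ND(2)]]])
    fix z assume "z \<in> carrier ?S"
    then obtain x x' where z: "z = (x, x')" "x \<in> carrier M" "x' \<in> carrier N" by auto
    show "dual_of_sum M N (map_prod (Q_symm bar \<epsilon> \<psi>) (Q_symm bar \<epsilon> \<chi>) z) = Q_symm bar \<epsilon> (Q_sum bar \<epsilon> M N \<psi> \<chi>) z"
    proof
      fix w :: "'b \<times> 'c"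
      obtain y y' where w: "w = (y, y')" by (cases w)
      show "dual_of_sum M N (map_prod (Q_symm bar \<epsilon> \<psi>) (Q_symm bar \<epsilon> \<chi>) z) w = Q_symm bar \<epsilon> (Q_sum bar \<epsilon> M N \<psi> \<chi>) z w"
      proof (cases "y \<in> carrier M \<and> y' \<in> carrier N")
        case True
        then show ?thesis
          using Q_symm_sum[OF lM lN MD(3) ND(3) z(2,3)] by (simp add: w z(1) dual_of_sum_def)
      next
        case False
        then show ?thesis
          using sesqD(5)[OF Q_symm_sesq[OF weakly_basedD(1)[OF S] group], of z w]
          by (auto simp: w z(1) dual_of_sum_def)
      qed
    qed
  qed
  then show ?thesis
    using based_module_sum(1)[OF MD(2) ND(2)] group by (simp add: simple_form_def quadratic_form_def)
qed

lemma lagrangian_sum: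
  assumes M: "weakly_based M" "\<psi> \<in> Q_group bar \<epsilon> M" and N: "weakly_based N" "\<chi> \<in> Q_group bar \<epsilon> N"
    and L: "lagrangian bar \<epsilon> Z M \<psi> L" and K: "lagrangian bar \<epsilon> Z N \<chi> K"
  shows "lagrangian bar \<epsilon> Z (based_sum Z M N) (Q_sum bar \<epsilon> M N \<psi> \<chi>) (based_sum Z L K)"
  unfolding lagrangian_def
proof (intro conjI)
  note LD = lagrangianD[OF L] and KD = lagrangianD[OF K]
  note lM = weakly_basedD(1)[OF M(1)] and lN = weakly_basedD(1)[OF N(1)]
  note lL = weakly_basedD(1)[OF LD(2)] and lK = weakly_basedD(1)[OF KD(2)]
  show "based_module Z (based_sum Z L K)" by (rule based_module_sum(1)[OF LD(2) KD(2)])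
  show "direct_summand (based_sum Z L K) (based_sum Z M N)" by (rule direct_summand_sum[OF LD(3) KD(3)])
  have zero: "Q_symm bar \<epsilon> \<psi> x 0 = 0" "Q_symm bar \<epsilon> \<chi> x' 0 = 0" if "x \<in> carrier M" "x' \<in> carrier N" for x x'
    using dual_zero[OF lM sesqD(6)[OF Q_symm_sesq[OF lM M(2)] that(1)]]
      dual_zero[OF lN sesqD(6)[OF Q_symm_sesq[OF lN N(2)] that(2)]] by auto
  have symm: "Q_symm bar \<epsilon> (Q_sum bar \<epsilon> M N \<psi> \<chi>) (x, x') (y, y') = Q_symm bar \<epsilon> \<psi> x y + Q_symm bar \<epsilon> \<chi> x' y'"
    if "x \<in> carrier M" "x' \<in> carrier N" "y \<in> carrier L" "y' \<in> carrier K" for x x' y y'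
    using Q_symm_sum[OF lM lN M(2) N(2) that(1,2) submoduleD(2)[OF LD(4) that(3)] submoduleD(2)[OF KD(4) that(4)]] .
  have "perp bar \<epsilon> (based_sum Z M N) (Q_sum bar \<epsilon> M N \<psi> \<chi>) (carrier L \<times> carrier K) =
      perp bar \<epsilon> M \<psi> (carrier L) \<times> perp bar \<epsilon> N \<chi> (carrier K)"
  proof -
    have E: "(\<forall>z\<in>carrier L \<times> carrier K. Q_symm bar \<epsilon> (Q_sum bar \<epsilon> M N \<psi> \<chi>) (x, x') z = 0) \<longleftrightarrow>
      (\<forall>y\<in>carrier L. Q_symm bar \<epsilon> \<psi> x y = 0) \<and> (\<forall>y\<in>carrier K. Q_symm bar \<epsilon> \<chi> x' y = 0)" (is "?A \<longleftrightarrow> ?B")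
      if x: "x \<in> carrier M" "x' \<in> carrier N" for x x'
    proof
      assume A: ?A
      have "Q_symm bar \<epsilon> \<psi> x y = 0" if "y \<in> carrier L" for y
        using bspec[OF A, of "(y, 0)"] symm[OF x that left_moduleD(1)[OF lK]] zero[OF x] left_moduleD(1)[OF lK] that by simp
      moreover have "Q_symm bar \<epsilon> \<chi> x' y = 0" if "y \<in> carrier K" for y
        using bspec[OF A, of "(0, y)"] symm[OF x left_moduleD(1)[OF lL] that] zero[OF x] left_moduleD(1)[OF lL] that by simp
      ultimately show ?B by blast
    next
      assume ?B
      then show ?A using symm[OF x] by auto
    qed
    show ?thesis
    proof (rule Set.set_eqI)
      fix z :: "'b \<times> 'c"
      obtain x x' where z: "z = (x, x')" by (cases z)
      show "z \<in> perp bar \<epsilon> (based_sum Z M N) (Q_sum bar \<epsilon> M N \<psi> \<chi>) (carrier L \<times> carrier K) \<longleftrightarrow>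
          z \<in> perp bar \<epsilon> M \<psi> (carrier L) \<times> perp bar \<epsilon> N \<chi> (carrier K)"
        unfolding z perp_def carrier_based_sum mem_Sigma_iff mem_Collect_eq
        by (cases "x \<in> carrier M"; cases "x' \<in> carrier N"; simp only: E simp_thms)
    qed
  qed
  then show "carrier (based_sum Z L K) = perp bar \<epsilon> (based_sum Z M N) (Q_sum bar \<epsilon> M N \<psi> \<chi>) (carrier (based_sum Z L K))"
    using LD(5) KD(5) by simp
  have id: "(\<lambda>z :: 'b \<times> 'c. z) = map_prod (\<lambda>x. x) (\<lambda>x. x)" by auto
  have "Q_restrict bar \<epsilon> (based_sum Z L K) (Q_sum bar \<epsilon> M N \<psi> \<chi>) =
      Q_sum bar \<epsilon> L K (Q_class bar \<epsilon> L 0) (Q_class bar \<epsilon> K 0)"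
    unfolding Q_pull_based_sum id LD(6)[symmetric] KD(6)[symmetric]
    by (rule Q_pull_sum[OF lL lK lM lN inclusion_hom[OF LD(4)] inclusion_hom[OF KD(4)] M(2) N(2)])
  also have "\<dots> = Q_class bar \<epsilon> (mod_sum L K) (sum_form L K 0 0)"
    by (rule Q_sum_class[OF lL lK sesq_zero[OF lL] sesq_zero[OF lK]])
  also have "sum_form L K 0 0 = 0" by (auto simp: sum_form_def zero_ext_def fun_eq_iff)
  also have "Q_class bar \<epsilon> (mod_sum L K) = Q_class bar \<epsilon> (based_sum Z L K)"
    by (rule Q_class_cong) simp_all
  finally show "Q_restrict bar \<epsilon> (based_sum Z L K) (Q_sum bar \<epsilon> M N \<psi> \<chi>) = Q_class bar \<epsilon> (based_sum Z L K) 0" .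
qed

text \<open>
  The sum of two splittings, precomposed with the identification of duals and the exchange of the
  middle terms, is a splitting for the sum.
\<close>

lemma simple_lagrangian_sum:
  assumes M: "weakly_based M" "\<psi> \<in> Q_group bar \<epsilon> M" and N: "weakly_based N" "\<chi> \<in> Q_group bar \<epsilon> N"
    and L: "simple_lagrangian bar \<epsilon> Z M \<psi> L" and K: "simple_lagrangian bar \<epsilon> Z N \<chi> K"
  shows "simple_lagrangian bar \<epsilon> Z (based_sum Z M N) (Q_sum bar \<epsilon> M N \<psi> \<chi>) (based_sum Z L K)"
proof -
  note lM = weakly_basedD(1)[OF M(1)] and lN = weakly_basedD(1)[OF N(1)]
  obtain s where L0: "lagrangian bar \<epsilon> Z M \<psi> L" and s: "s \<in> mod_hom (dual_lmod bar L) M"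
    "\<And>\<phi>. \<phi> \<in> carrier (dual_lmod bar L) \<Longrightarrow> lag_proj \<psi> L (s \<phi>) = \<phi>"
    "(\<lambda>(x, \<phi>). x + s \<phi>) \<in> simple_iso Z (based_sum Z L (dual bar L)) M"
    using L unfolding simple_lagrangian_iff[OF lM M(2)] by blast
  obtain t where K0: "lagrangian bar \<epsilon> Z N \<chi> K" and t: "t \<in> mod_hom (dual_lmod bar K) N"
    "\<And>\<phi>. \<phi> \<in> carrier (dual_lmod bar K) \<Longrightarrow> lag_proj \<chi> K (t \<phi>) = \<phi>"
    "(\<lambda>(x, \<phi>). x + t \<phi>) \<in> simple_iso Z (based_sum Z K (dual bar K)) N"
    using K unfolding simple_lagrangian_iff[OF lN N(2)] by blast
  note LD = lagrangianD[OF L0] and KD = lagrangianD[OF K0]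
  note lL = weakly_basedD(1)[OF LD(2)] and lK = weakly_basedD(1)[OF KD(2)]
  note dL = weakly_based_dual[OF LD(2)] and dK = weakly_based_dual[OF KD(2)]
  let ?S = "based_sum Z M N" and ?L = "based_sum Z L K" and ?D = "based_sum Z (dual bar L) (dual bar K)"
  note S = weakly_based_sum[OF M(1) N(1)] and SL = weakly_based_sum[OF LD(2) KD(2)]
  note D = weakly_based_sum[OF dL dK] and dSL = weakly_based_dual[OF SL]
  have group: "Q_sum bar \<epsilon> M N \<psi> \<chi> \<in> Q_group bar \<epsilon> ?S"
    by (rule Q_sum_group_based[OF M(1) N(1) M(2) N(2)])
  obtain h where h: "h \<in> simple_iso Z (dual bar ?L) ?D"
    "\<And>\<phi>. \<phi> \<in> carrier (dual bar ?L) \<Longrightarrow> dual_of_sum L K (h \<phi>) = \<phi>"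
    using simple_iso_inverse[OF D dSL dual_of_sum_simple[OF LD(2) KD(2)]] by blast
  note hh = mod_isoD(1)[OF simple_isoD(1)[OF dSL D h(1)]]
  define u where "u = (\<lambda>\<phi>. map_prod s t (h \<phi>))"
  have hom: "mod_hom ?D ?S = mod_hom (mod_sum (dual_lmod bar L) (dual_lmod bar K)) (mod_sum M N)"
    "mod_hom (dual bar ?L) ?S = mod_hom (dual_lmod bar ?L) ?S"
    by (rule mod_hom_cong; simp add: mod_sum_def)+
  have "map_prod s t \<in> mod_hom ?D ?S"
    unfolding hom by (rule mod_homI) (auto simp: mod_homD[OF s(1)] mod_homD[OF t(1)] simp del: scl_dual_lmod)
  then have uh: "u \<in> mod_hom (dual_lmod bar ?L) ?S"
    unfolding u_def hom(2)[symmetric] by (rule mod_hom_comp[OF hh])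
  have "lag_proj (Q_sum bar \<epsilon> M N \<psi> \<chi>) ?L (u \<phi>) = \<phi>" if \<phi>: "\<phi> \<in> carrier (dual_lmod bar ?L)" for \<phi>
  proof
    fix w :: "'b \<times> 'c"
    obtain y y' where w: "w = (y, y')" by (cases w)
    obtain \<alpha> \<beta> where ab: "h \<phi> = (\<alpha>, \<beta>)" by (cases "h \<phi>")
    have abc: "\<alpha> \<in> carrier (dual_lmod bar L)" "\<beta> \<in> carrier (dual_lmod bar K)"
      using mod_homD(1)[OF hh, of \<phi>] \<phi> by (auto simp: ab)
    show "lag_proj (Q_sum bar \<epsilon> M N \<psi> \<chi>) ?L (u \<phi>) w = \<phi> w"
    proof (cases "y \<in> carrier L \<and> y' \<in> carrier K")
      case True
      have "lag_proj (Q_sum bar \<epsilon> M N \<psi> \<chi>) ?L (u \<phi>) w = Q_symm bar \<epsilon> \<psi> (s \<alpha>) y + Q_symm bar \<epsilon> \<chi> (t \<beta>) y'"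
        using Q_symm_sum[OF lM lN M(2) N(2) mod_homD(1)[OF s(1) abc(1)] mod_homD(1)[OF t(1) abc(2)]
            submoduleD(2)[OF LD(4)] submoduleD(2)[OF KD(4)]] True
        by (simp add: lag_proj_def u_def ab w)
      also have "\<dots> = lag_proj \<psi> L (s \<alpha>) y + lag_proj \<chi> K (t \<beta>) y'"
        using True by (simp add: lag_proj_def)
      also have "\<dots> = \<alpha> y + \<beta> y'" by (simp only: s(2)[OF abc(1)] t(2)[OF abc(2)])
      also have "\<dots> = dual_of_sum L K (h \<phi>) w" using True by (simp add: ab w dual_of_sum_def)
      finally show ?thesis using h(2)[of \<phi>] \<phi> by simp
    next
      case False
      then show ?thesis using dual_lmodD(3)[OF \<phi>, of w] by (auto simp: lag_proj_def w)
    qed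
  qed
  moreover have "(\<lambda>(x, \<phi>). x + u \<phi>) \<in> simple_iso Z (based_sum Z ?L (dual bar ?L)) ?S"
  proof -
    note T1 = weakly_based_sum[OF SL dSL] and T2 = weakly_based_sum[OF SL D]
    note T3 = weakly_based_sum[OF weakly_based_sum[OF LD(2) dL] weakly_based_sum[OF KD(2) dK]]
    have 1: "map_prod (\<lambda>x. x) h \<in> simple_iso Z (based_sum Z ?L (dual bar ?L)) (based_sum Z ?L ?D)"
      by (rule simple_iso_sum[OF SL SL dSL D simple_iso_id[OF SL] h(1)]) simp
    have 2: "map_prod (\<lambda>(x, \<phi>). x + s \<phi>) (\<lambda>(x, \<phi>). x + t \<phi>) \<in>
        simple_iso Z (based_sum Z (based_sum Z L (dual bar L)) (based_sum Z K (dual bar K))) ?S"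
      by (rule simple_iso_sum[OF weakly_based_sum[OF LD(2) dL] M(1) weakly_based_sum[OF KD(2) dK] N(1) s(3) t(3)])
    show ?thesis
      by (rule simple_iso_cong[OF T1 S simple_iso_comp[OF T1 T3 S simple_iso_comp[OF T1 T2 T3 1
            simple_iso_middle_swap[OF LD(2) KD(2) dL dK]] 2]])
         (simp add: case_prod_unfold u_def map_prod_def prod_eq_iff)
  qed
  ultimately show ?thesis
    unfolding simple_lagrangian_iff[OF weakly_basedD(1)[OF S] group]
    using lagrangian_sum[OF M N L0 K0] uh by blast
qed

lemma quasi_formation_sum:
  assumes x: "quasi_formation bar \<epsilon> Z x" and y: "quasi_formation bar \<epsilon> Z y"
  shows "quasi_formation bar \<epsilon> Z (quasi_sum bar \<epsilon> Z x y)"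
proof -
  note X = quasi_formationD[OF x] and Y = quasi_formationD[OF y]
  note XD = simple_formD[OF X(1)] and YD = simple_formD[OF Y(1)]
  note wx = based_moduleD(1)[OF X(4)] and wy = based_moduleD(1)[OF Y(4)]
  show ?thesis
    unfolding quasi_formation_def quasi_sum_simps
    using simple_form_sum[OF X(1) Y(1)] simple_lagrangian_sum[OF XD(2,3) YD(2,3) X(2) Y(2)]
      based_module_sum(1)[OF wx wy] direct_summand_sum[OF X(5) Y(5)]
      mod_rank_sum[OF weakly_finite wx wy] mod_rank_sum[OF weakly_finite XD(2) YD(2)] X(6) Y(6)
    by simp
qed

end

section \<open>Representatives and the monoid of stable classes\<close>

text \<open>
  Everything is moved by one and the same map, so that quasi-formations which share their form or a
  submodule have images with the same property.
\<close>

definition transport_quasi ::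
  "('a::ring_1 \<Rightarrow> 'a) \<Rightarrow> 'a \<Rightarrow> ('a, 'n::ab_group_add, 'z) lmod_scheme \<Rightarrow> ('m \<Rightarrow> 'n) \<Rightarrow>
    ('a, 'm::ab_group_add) quasi \<Rightarrow> ('a, 'n) quasi" where
  "transport_quasi bar \<epsilon> N e x =
    \<lparr>qmod = based_image N e (qmod x),
     qform = Q_pull bar \<epsilon> (based_image N e (qmod x)) (inv_into (carrier (qmod x)) e) (qform x),
     qlag = based_image N e (qlag x), qsub = based_image N e (qsub x)\<rparr>"

context form_setting
begin

lemma image_submodule:
  assumes "left_module L" "f \<in> mod_hom L N" "inj_on f (carrier L)"
  shows "submodule (based_image N f L) N"
  unfolding submodule_def using based_image_iso(2)[OF assms] mod_homD(1)[OF assms(2)] by auto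

lemma submodule_based_image:
  assumes L: "submodule L M" and e: "e \<in> mod_hom M N" and inj: "inj_on e (carrier M)"
  shows "submodule (based_image N e L) (based_image N e M)"
proof -
  have sub: "carrier L \<subseteq> carrier M" using submoduleD(2)[OF L] by auto
  show ?thesis
    unfolding submodule_def
    using based_image_iso(2)[OF submoduleD(1)[OF L] submodule_hom[OF L e] inj_on_subset[OF inj sub]] sub by auto
qed

lemma quasi_formation_transport:
  assumes x: "quasi_formation bar \<epsilon> Z x"
    and e: "e \<in> mod_hom (qmod x) N" and inj: "inj_on e (carrier (qmod x))"
  shows "quasi_iso bar \<epsilon> Z x (transport_quasi bar \<epsilon> N e x)"
    "quasi_formation bar \<epsilon> Z (transport_quasi bar \<epsilon> N e x)"
    "simple_formation bar \<epsilon> Z x \<Longrightarrow> simple_formation bar \<epsilon> Z (transport_quasi bar \<epsilon> N e x)"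
proof -
  let ?y = "transport_quasi bar \<epsilon> N e x"
  let ?I = "based_image N e (qmod x)" and ?g = "inv_into (carrier (qmod x)) e"
  have px: "pre_quasi x" by (rule quasi_formation_pre[OF x])
  note X = quasi_formationD[OF x] and P = pre_quasiD[OF px]
  have lag_sub: "carrier (qlag x) \<subseteq> carrier (qmod x)" and sub_sub: "carrier (qsub x) \<subseteq> carrier (qmod x)"
    using submoduleD(2)[OF P(5)] submoduleD(2)[OF P(6)] by auto
  note l = weakly_basedD(1)[OF P(1)]
  note eh = submodule_hom[OF P(5) e] submodule_hom[OF P(6) e]
  note ei = inj_on_subset[OF inj lag_sub] inj_on_subset[OF inj sub_sub]
  have based: "based_module Z ?I" "based_module Z (based_image N e (qlag x))" "based_module Z (based_image N e (qsub x))"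
    using based_module_image(3)[OF P(1) e inj simple_formD(1)[OF X(1)]] based_module_image(3)[OF P(2) eh(1) ei(1) lagrangianD(1)[OF X(3)]]
      based_module_image(3)[OF P(3) eh(2) ei(2) X(4)] by auto
  have simps: "qmod ?y = ?I" "qlag ?y = based_image N e (qlag x)" "qsub ?y = based_image N e (qsub x)"
    "qform ?y = Q_pull bar \<epsilon> ?I ?g (qform x)" by (simp_all add: transport_quasi_def)
  have lI: "left_module ?I" by (rule based_image_iso(2)[OF l e inj])
  note ii = based_image_iso(1)[OF l e inj]
  obtain g where g: "g \<in> mod_iso ?I (qmod x)" "\<And>z. z \<in> carrier (qmod x) \<Longrightarrow> g (e z) = z"
    using mod_iso_inverse[OF l ii] by blast
  have pull: "Q_pull bar \<epsilon> ?I ?g (qform x) = Q_pull bar \<epsilon> ?I g (qform x)"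
    by (rule Q_pull_cong) (use inj g(2) in auto)
  have form: "qform ?y \<in> Q_group bar \<epsilon> (qmod ?y)"
    unfolding simps pull by (rule Q_pull_group[OF lI l mod_isoD(1)[OF g(1)] P(4)])
  have sub: "submodule (qlag ?y) (qmod ?y)" "submodule (qsub ?y) (qmod ?y)"
    unfolding simps by (rule submodule_based_image[OF P(5) e inj], rule submodule_based_image[OF P(6) e inj])
  have py: "pre_quasi ?y"
    using based[THEN based_moduleD(1)] form sub by (simp add: pre_quasi_def simps)
  have "Q_pull bar \<epsilon> (qmod x) e (qform ?y) = Q_pull bar \<epsilon> (qmod x) (\<lambda>z. g (e z)) (qform x)"
    unfolding simps pull by (rule Q_pull_comp[OF l lI l mod_isoD(1)[OF ii] mod_isoD(1)[OF g(1)] P(4)])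
  also have "\<dots> = qform x" by (rule Q_pull_id[OF l P(4) g(2)])
  finally have "e \<in> isometry bar \<epsilon> Z (qmod x) (qform x) (qmod ?y) (qform ?y)"
    using based_module_image(2)[OF P(1) e inj] by (simp add: isometry_def simps(1))
  then show iso: "quasi_iso bar \<epsilon> Z x ?y"
    by (rule quasi_isoI[OF px py]) (use based_module_image(2)[OF P(2) eh(1) ei(1)] based_module_image(2)[OF P(3) eh(2) ei(2)] in \<open>simp_all add: simps\<close>)
  show "quasi_formation bar \<epsilon> Z ?y" "simple_formation bar \<epsilon> Z x \<Longrightarrow> simple_formation bar \<epsilon> Z ?y"
    using quasi_formation_iso[OF x _ _ _ form sub iso] based by (simp_all add: simps)
qed

text \<open>
  A stable basis identifies the stabilized module with a standard free module, and the module itself is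
  a submodule of its stabilization.
\<close>

lemma embedding_exists:
  fixes M :: "('a, 'm::ab_group_add) based"
  assumes M: "weakly_based M"
  obtains e n where "e \<in> mod_hom M (free_mod n :: ('a, nat \<Rightarrow> 'a) lmod)" "inj_on e (carrier M)"
proof -
  note wM = weakly_basedD[OF M]
  obtain s where s: "s \<in> sbases M" using wM(2) by blast
  have S: "left_module (stab_mod M (fst s))" using wM(1) by simp
  have b: "is_basis (stab_mod M (fst s)) (snd s)" using wM(3)[OF s] by (simp add: s_basis_def)
  obtain g where g: "g \<in> mod_iso (stab_mod M (fst s)) (free_mod (length (snd s)) :: ('a, nat \<Rightarrow> 'a) lmod)"
    using mod_iso_inverse[OF left_module_free_mod basis_iso[OF S b]] by blast
  have "(\<lambda>x. g (x, 0)) \<in> mod_hom M (free_mod (length (snd s)))"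
    by (rule mod_hom_comp[OF inl_mod_hom[OF left_module_free_mod] mod_isoD(1)[OF g]])
  moreover have "inj_on (\<lambda>x. g (x, 0)) (carrier M)"
  proof (rule inj_onI)
    fix x y assume xy: "x \<in> carrier M" "y \<in> carrier M" "g (x, 0) = g (y, 0)"
    have "inj_on g (carrier (stab_mod M (fst s)))" using mod_isoD(2)[OF g] by (rule bij_betw_imp_inj_on)
    from inj_onD[OF this xy(3)] show "x = y" using xy(1,2) by (simp add: carrier_free_mod)
  qed
  ultimately show ?thesis using that by blast
qed

lemma representative_exists:
  assumes x: "quasi_formation bar \<epsilon> Z x"
  obtains x' :: "('a, nat \<Rightarrow> 'a) quasi"
  where "quasi_formation bar \<epsilon> Z x'" "quasi_iso bar \<epsilon> Z x x'"
proof -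
  obtain e n where e: "e \<in> mod_hom (qmod x) (free_mod n :: ('a, nat \<Rightarrow> 'a) lmod)" "inj_on e (carrier (qmod x))"
    using embedding_exists[OF pre_quasiD(1)[OF quasi_formation_pre[OF x]]] .
  show ?thesis by (rule that[OF quasi_formation_transport(2,1)[OF x e]])
qed

text \<open>
  Trivial formations occur only as auxiliary summands: an isomorphism becomes a stable isomorphism by
  adding the identity of one of them.
\<close>

lemma pre_quasi_trivial:
  assumes P: "based_module Z P"
  shows "pre_quasi (trivial_formation bar \<epsilon> Z P)"
proof -
  note wP = based_moduleD(1)[OF P] and dP = weakly_based_dual[OF based_moduleD(1)[OF P]]
  let ?H = "hyp_mod bar Z P"
  have H: "weakly_based ?H" unfolding hyp_mod_def by (rule weakly_based_sum[OF wP dP])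
  note lP = weakly_basedD(1)[OF wP] and lH = weakly_basedD(1)[OF H]
  have homs: "mod_hom P ?H = mod_hom P (mod_sum P (dual_lmod bar P))"
    "mod_hom (dual bar P) ?H = mod_hom (dual_lmod bar P) (mod_sum P (dual_lmod bar P))"
    by (rule mod_hom_cong; simp add: hyp_mod_def mod_sum_def)+
  have inl: "(\<lambda>x. (x, 0)) \<in> mod_hom P ?H" "inj_on (\<lambda>x. (x, 0 :: 'b \<Rightarrow> 'a)) (carrier P)"
    unfolding homs by (rule inl_mod_hom[OF left_module_dual_lmod[OF lP]]) (simp add: inj_on_def)
  have inr: "(\<lambda>\<phi>. (0, \<phi>)) \<in> mod_hom (dual bar P) ?H" "inj_on (\<lambda>\<phi>. (0 :: 'b, \<phi>)) (carrier (dual bar P))"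
    unfolding homs by (rule inr_mod_hom[OF lP]) (simp add: inj_on_def)
  have form: "zero_ext ?H (\<lambda>(x, \<phi>) (y, \<chi>). \<phi> y) \<in> sesq ?H"
  proof (rule sesqI[OF lH])
    fix x x' y assume "x \<in> carrier ?H" "x' \<in> carrier ?H" "y \<in> carrier ?H"
    then show "zero_ext ?H (\<lambda>(x, \<phi>) (y, \<chi>). \<phi> y) (x + x') y =
      zero_ext ?H (\<lambda>(x, \<phi>) (y, \<chi>). \<phi> y) x y + zero_ext ?H (\<lambda>(x, \<phi>) (y, \<chi>). \<phi> y) x' y"
      using left_moduleD(2)[OF lH, of x x'] by (simp add: zero_ext_def case_prod_unfold)
  next
    fix x y y' assume "x \<in> carrier ?H" "y \<in> carrier ?H" "y' \<in> carrier ?H"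
    moreover from this have "snd x (fst y + fst y') = snd x (fst y) + snd x (fst y')"
      by (intro dual_lmodD(1)[of _ P]) (auto simp: hyp_mod_def)
    ultimately show "zero_ext ?H (\<lambda>(x, \<phi>) (y, \<chi>). \<phi> y) x (y + y') =
      zero_ext ?H (\<lambda>(x, \<phi>) (y, \<chi>). \<phi> y) x y + zero_ext ?H (\<lambda>(x, \<phi>) (y, \<chi>). \<phi> y) x y'"
      using left_moduleD(2)[OF lH, of y y'] by (simp add: zero_ext_def case_prod_unfold)
  next
    fix a x y assume "x \<in> carrier ?H" "y \<in> carrier ?H"
    moreover have "snd (scl ?H a x) = (\<lambda>z. snd x z * bar a)" by (cases x) (simp add: hyp_mod_def)
    ultimately show "zero_ext ?H (\<lambda>(x, \<phi>) (y, \<chi>). \<phi> y) (scl ?H a x) y =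
      zero_ext ?H (\<lambda>(x, \<phi>) (y, \<chi>). \<phi> y) x y * bar a"
      using left_moduleD(4)[OF lH, of x a] by (simp add: zero_ext_def case_prod_unfold)
  next
    fix a x y assume "x \<in> carrier ?H" "y \<in> carrier ?H"
    moreover from this have "snd x (scl P a (fst y)) = a * snd x (fst y)"
      by (intro dual_lmodD(2)[of _ P]) (auto simp: hyp_mod_def)
    moreover have "fst (scl ?H a y) = scl P a (fst y)" by (cases y) (simp add: hyp_mod_def)
    ultimately show "zero_ext ?H (\<lambda>(x, \<phi>) (y, \<chi>). \<phi> y) x (scl ?H a y) =
      a * zero_ext ?H (\<lambda>(x, \<phi>) (y, \<chi>). \<phi> y) x y"
      using left_moduleD(4)[OF lH, of y a] by (simp add: zero_ext_def case_prod_unfold)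
  qed (auto simp: zero_ext_def)
  show ?thesis
    unfolding pre_quasi_def trivial_formation_def quasi.simps hyp_lag_def hyp_dual_lag_def hyp_form_def Q_group_iff
    using H based_module_image(1)[OF wP inl] based_module_image(1)[OF dP inr] form
      image_submodule[OF lP inl] image_submodule[OF weakly_basedD(1)[OF dP] inr] by blast
qed

lemma l_equiv_quasi_formation:
  assumes "l_equiv bar \<epsilon> Z x y"
  shows "quasi_formation bar \<epsilon> Z x \<and> quasi_formation bar \<epsilon> Z y"
  using assms
proof (induction rule: l_equiv.induct)
  case (compose M \<psi> K L V x)
  then show ?case by (simp add: quasi_formation_def)
qed auto

text \<open>
  Any trivial formation may be added on both sides; the one on the underlying module of \<open>x\<close>
  is at hand on the correct type.
\<close>

lemma l_equiv_iso:
  assumes x: "quasi_formation bar \<epsilon> Z x" and y: "quasi_formation bar \<epsilon> Z y" and iso: "quasi_iso bar \<epsilon> Z x y"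
  shows "l_equiv bar \<epsilon> Z x y"
proof (rule l_equiv.stable[OF x y])
  have P: "based_module Z (qmod x)" using simple_formD(1)[OF quasi_formationD(1)[OF x]] .
  note T = pre_quasi_trivial[OF P]
  show "stably_iso bar \<epsilon> Z x y"
    unfolding stably_iso_def
    using P quasi_iso_sum[OF quasi_formation_pre[OF x] quasi_formation_pre[OF y] T T iso quasi_iso_refl[OF T]]
    by blast
qed

text \<open>
  The class of a quasi-formation on an arbitrary type is a full equivalence class, namely that of any
  of its representatives.
\<close>

lemma l_class_eq:
  assumes x: "quasi_formation bar \<epsilon> Z x" and x': "quasi_formation bar \<epsilon> Z x'" and iso: "quasi_iso bar \<epsilon> Z x x'"
  shows "l_class bar \<epsilon> Z x = {y. l_equiv bar \<epsilon> Z x' y}"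
proof
  show "{y. l_equiv bar \<epsilon> Z x' y} \<subseteq> l_class bar \<epsilon> Z x"
    unfolding l_class_def using x' iso by blast
  show "l_class bar \<epsilon> Z x \<subseteq> {y. l_equiv bar \<epsilon> Z x' y}"
  proof
    fix y assume "y \<in> l_class bar \<epsilon> Z x"
    then obtain x'' where x'': "quasi_formation bar \<epsilon> Z x''" "quasi_iso bar \<epsilon> Z x x''" "l_equiv bar \<epsilon> Z x'' y"
      by (auto simp: l_class_def)
    note pre = quasi_formation_pre[OF x] quasi_formation_pre[OF x'] quasi_formation_pre[OF x''(1)]
    have "quasi_iso bar \<epsilon> Z x' x''"
      by (rule quasi_iso_trans[OF pre(2,1,3) quasi_iso_sym[OF pre(1,2) iso] x''(2)])
    then show "y \<in> {y. l_equiv bar \<epsilon> Z x' y}"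
      using l_equiv.trans[OF l_equiv_iso[OF x' x''(1)] x''(3)] by simp
  qed
qed

text \<open>
  The relation is only required to be compatible with adding a fixed summand on the right. The left
  summand is replaced first; exchanging the summands then brings the other one to the left.
\<close>

lemma l_equiv_sum:
  assumes aa: "l_equiv bar \<epsilon> Z a a'" and bb: "l_equiv bar \<epsilon> Z b b'"
    and r: "quasi_formation bar \<epsilon> Z r" "quasi_iso bar \<epsilon> Z (quasi_sum bar \<epsilon> Z a b) r"
    and r': "quasi_formation bar \<epsilon> Z r'" "quasi_iso bar \<epsilon> Z (quasi_sum bar \<epsilon> Z a' b') r'"
  shows "l_equiv bar \<epsilon> Z r r'"
proof -
  have qf: "quasi_formation bar \<epsilon> Z a" "quasi_formation bar \<epsilon> Z a'" "quasi_formation bar \<epsilon> Z b" "quasi_formation bar \<epsilon> Z b'"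
    using l_equiv_quasi_formation[OF aa] l_equiv_quasi_formation[OF bb] by auto
  note pre = qf[THEN quasi_formation_pre]
  obtain t :: "('a, nat \<Rightarrow> 'a) quasi"
    where t: "quasi_formation bar \<epsilon> Z t" "quasi_iso bar \<epsilon> Z (quasi_sum bar \<epsilon> Z a' b) t"
    using representative_exists[OF quasi_formation_sum[OF qf(2,3)]] .
  have "l_equiv bar \<epsilon> Z r t"
    by (rule l_equiv.add[OF aa qf(3) r(1) t(1) r(2) t(2)])
  moreover have "l_equiv bar \<epsilon> Z t r'"
  proof (rule l_equiv.add[OF bb qf(2) t(1) r'(1)])
    show "quasi_iso bar \<epsilon> Z (quasi_sum bar \<epsilon> Z b a') t"
      by (rule quasi_iso_trans[OF pre_quasi_sum[OF pre(3,2)] pre_quasi_sum[OF pre(2,3)]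
            quasi_formation_pre[OF t(1)] quasi_iso_swap[OF pre(3,2)] t(2)])
    show "quasi_iso bar \<epsilon> Z (quasi_sum bar \<epsilon> Z b' a') r'"
      by (rule quasi_iso_trans[OF pre_quasi_sum[OF pre(4,2)] pre_quasi_sum[OF pre(2,4)]
            quasi_formation_pre[OF r'(1)] quasi_iso_swap[OF pre(4,2)] r'(2)])
  qed
  ultimately show ?thesis by (rule l_equiv.trans)
qed

text \<open>
  The product is a union over all pairs of representatives; they all give the same class.
\<close>

lemma l_monoid_mult_eqI:
  assumes a: "quasi_formation bar \<epsilon> Z a" "l_class bar \<epsilon> Z u = {y. l_equiv bar \<epsilon> Z a y}"
    and b: "quasi_formation bar \<epsilon> Z b" "l_class bar \<epsilon> Z v = {y. l_equiv bar \<epsilon> Z b y}"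
    and r: "quasi_formation bar \<epsilon> Z r" "quasi_iso bar \<epsilon> Z (quasi_sum bar \<epsilon> Z a b) r"
  shows "l_class bar \<epsilon> Z u \<otimes>\<^bsub>l_monoid bar \<epsilon> Z\<^esub> l_class bar \<epsilon> Z v = {y. l_equiv bar \<epsilon> Z r y}"
proof -
  have refl: "l_equiv bar \<epsilon> Z x x" if "quasi_formation bar \<epsilon> Z x" for x
    by (rule l_equiv_iso[OF that that quasi_iso_refl[OF quasi_formation_pre[OF that]]])
  have "l_class bar \<epsilon> Z (quasi_sum bar \<epsilon> Z a' b') = {y. l_equiv bar \<epsilon> Z r y}"
    if a': "l_equiv bar \<epsilon> Z a a'" and b': "l_equiv bar \<epsilon> Z b b'" for a' b'
  proof -
    have qf: "quasi_formation bar \<epsilon> Z (quasi_sum bar \<epsilon> Z a' b')"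
      using quasi_formation_sum l_equiv_quasi_formation[OF a'] l_equiv_quasi_formation[OF b'] by blast
    obtain r' :: "('a, nat \<Rightarrow> 'a) quasi"
      where r': "quasi_formation bar \<epsilon> Z r'" "quasi_iso bar \<epsilon> Z (quasi_sum bar \<epsilon> Z a' b') r'"
      using representative_exists[OF qf] .
    have "l_equiv bar \<epsilon> Z r r'" by (rule l_equiv_sum[OF a' b' r r'])
    then have "l_equiv bar \<epsilon> Z r' y \<longleftrightarrow> l_equiv bar \<epsilon> Z r y" for y
      using l_equiv.trans l_equiv.sym by metis
    then show ?thesis unfolding l_class_eq[OF qf r'] by (rule Collect_cong)
  qed
  moreover have "a \<in> l_class bar \<epsilon> Z u" "b \<in> l_class bar \<epsilon> Z v"
    using a b refl by auto
  ultimately show ?thesis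
    unfolding l_monoid_def monoid.simps a(2) b(2) by blast
qed

end

section \<open>Isometries act trivially\<close>

theorem lemma14:
  fixes bar :: "'a::ring_1 \<Rightarrow> 'a"
    and q :: nat
    and \<epsilon> :: 'a
    and Z :: "'a smat set set set"
    and F :: "('a, 'm::ab_group_add) based"
    and W :: "('a, 'm \<times> ('m \<Rightarrow> 'a)) based"
    and \<alpha> :: "'m \<times> ('m \<Rightarrow> 'a) \<Rightarrow> 'm \<times> ('m \<Rightarrow> 'a)"
    and x z :: "('a, 'm \<times> ('m \<Rightarrow> 'a)) quasi"
  assumes "1 \<le> q" and "\<epsilon> = (- 1) ^ q"
    and "ring_involution bar"
    and "weakly_finite TYPE('a)"
    and "subgroup Z K1_tilde"
    and "adjoint_invariant bar Z"
    and "based_module Z F"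
    and "x = \<lparr>qmod = hyp_mod bar Z F, qform = hyp_form bar \<epsilon> Z F,
               qlag = hyp_lag bar Z F, qsub = W\<rparr>"
    and "quasi_formation bar \<epsilon> Z x"
    and "\<alpha> \<in> Aut_form bar \<epsilon> Z (hyp_mod bar Z F) (hyp_form bar \<epsilon> Z F)"
    and "restricts_to_isometry bar \<epsilon> Z (hyp_form bar \<epsilon> Z F) \<alpha> W"
    and "z = \<lparr>qmod = hyp_mod bar Z F, qform = hyp_form bar \<epsilon> Z F, qlag = hyp_lag bar Z F,
               qsub = based_image (hyp_mod bar Z F) \<alpha> (hyp_lag bar Z F)\<rparr>"
  shows "l_class bar \<epsilon> Z z \<in> Ls_group bar \<epsilon> Z \<and>
    l_class bar \<epsilon> Z z \<otimes>\<^bsub>l_monoid bar \<epsilon> Z\<^esub> l_class bar \<epsilon> Z x = l_class bar \<epsilon> Z x"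
proof -
  interpret form_setting Z bar \<epsilon>
  proof (intro form_setting.intro torsion_subgroup.intro form_setting_axioms.intro)
    show "\<epsilon> = 1 \<or> \<epsilon> = - 1"
      unfolding \<open>\<epsilon> = (- 1) ^ q\<close> minus_one_power_iff by auto
  qed (fact assms(5) assms(3) assms(4) assms(6))+
  let ?H = "hyp_mod bar Z F" and ?\<psi> = "hyp_form bar \<epsilon> Z F"
  let ?F = "hyp_lag bar Z F"
  let ?G = "based_image ?H \<alpha> ?F"
  have simps: "qmod x = ?H" "qform x = ?\<psi>" "qlag x = ?F" "qsub x = W"
    "qmod z = ?H" "qform z = ?\<psi>" "qlag z = ?F" "qsub z = ?G"
    using assms(8,12) by simp_all
  note x = \<open>quasi_formation bar \<epsilon> Z x\<close>
  note X = quasi_formationD[OF x, unfolded simps] and P = pre_quasiD[OF quasi_formation_pre[OF x], unfolded simps]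
  note \<alpha> = \<open>\<alpha> \<in> Aut_form bar \<epsilon> Z ?H ?\<psi>\<close>
  have \<alpha>s: "\<alpha> \<in> simple_iso Z ?H ?H" using \<alpha> by (simp add: isometry_def)
  have \<alpha>W: "\<alpha> \<in> simple_iso Z W W"
    using \<open>restricts_to_isometry bar \<epsilon> Z ?\<psi> \<alpha> W\<close> by (simp add: restricts_to_isometry_def isometry_def)
  note \<alpha>i = simple_isoD(1)[OF P(1) P(1) \<alpha>s]
  have FH: "carrier ?F \<subseteq> carrier ?H" using submoduleD(2)[OF P(5)] by auto
  have \<alpha>F: "\<alpha> \<in> mod_hom ?F ?H" "inj_on \<alpha> (carrier ?F)"
    using submodule_hom[OF P(5) mod_isoD(1)[OF \<alpha>i]] inj_on_subset[OF bij_betw_imp_inj_on[OF mod_isoD(2)[OF \<alpha>i]] FH] by auto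
  note G = based_module_image(3)[OF P(2) \<alpha>F lagrangianD(1)[OF X(3)]] and \<alpha>G = based_module_image(2)[OF P(2) \<alpha>F]
  have Gsub: "submodule ?G ?H" by (rule image_submodule[OF weakly_basedD(1)[OF P(2)] \<alpha>F])
  have Glag: "simple_lagrangian bar \<epsilon> Z ?H ?\<psi> ?G"
    by (rule simple_lagrangian_iso[OF P(1) P(1) P(4) \<alpha> G Gsub \<alpha>G X(2)])
  have z: "simple_formation bar \<epsilon> Z z"
    unfolding assms(12) by (rule simple_formationI[OF X(1,2) Glag])
  then have zq: "quasi_formation bar \<epsilon> Z z" by (simp add: simple_formation_def)
  \<comment> \<open>The isometry \<open>\<alpha>\<close> is an isomorphism from \<open>x\<close> to \<open>y\<close>.\<close>
  define y where "y = \<lparr>qmod = ?H, qform = ?\<psi>, qlag = ?G, qsub = W\<rparr>"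
  have ysimps: "qmod y = ?H" "qform y = ?\<psi>" "qlag y = ?G" "qsub y = W" by (simp_all add: y_def)
  have yq: "quasi_formation bar \<epsilon> Z y"
    using X Glag by (simp add: quasi_formation_def ysimps)
  have xy: "quasi_iso bar \<epsilon> Z x y"
    by (rule quasi_isoI[OF quasi_formation_pre[OF x] quasi_formation_pre[OF yq]])
       (use \<alpha> \<alpha>G \<alpha>W in \<open>simp_all add: simps ysimps\<close>)
  \<comment> \<open>One embedding is used for all three, so that the representatives share their forms and Lagrangians.\<close>
  obtain e n where e: "e \<in> mod_hom ?H (free_mod n :: ('a, nat \<Rightarrow> 'a) lmod)" "inj_on e (carrier ?H)"
    using embedding_exists[OF P(1)] .
  let ?N = "free_mod n :: ('a, nat \<Rightarrow> 'a) lmod"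
  define x' where "x' = transport_quasi bar \<epsilon> ?N e x"
  define y' where "y' = transport_quasi bar \<epsilon> ?N e y"
  define z' where "z' = transport_quasi bar \<epsilon> ?N e z"
  note Tx = quasi_formation_transport[OF x, unfolded simps, OF e, folded x'_def]
  note Ty = quasi_formation_transport[OF yq, unfolded ysimps, OF e, folded y'_def]
  note Tz = quasi_formation_transport[OF zq, unfolded simps, OF e, folded z'_def]
  have z': "simple_formation bar \<epsilon> Z z'" by (rule Tz(3)[OF z])
  note pre = quasi_formation_pre[OF x] quasi_formation_pre[OF yq]
    quasi_formation_pre[OF Tx(2)] quasi_formation_pre[OF Ty(2)] quasi_formation_pre[OF Tz(2)]
  have xy': "quasi_iso bar \<epsilon> Z x' y'"
    by (rule quasi_iso_trans[OF pre(3,2,4) quasi_iso_trans[OF pre(3,1,2) quasi_iso_sym[OF pre(1,3) Tx(1)] xy] Ty(1)])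
  obtain r :: "('a, nat \<Rightarrow> 'a) quasi"
    where r: "quasi_formation bar \<epsilon> Z r" "quasi_iso bar \<epsilon> Z (quasi_sum bar \<epsilon> Z z' y') r"
    using representative_exists[OF quasi_formation_sum[OF Tz(2) Ty(2)]] .
  have zx: "quasi_iso bar \<epsilon> Z (quasi_sum bar \<epsilon> Z z' x') r"
    by (rule quasi_iso_trans[OF pre_quasi_sum[OF pre(5,3)] pre_quasi_sum[OF pre(5,4)] quasi_formation_pre[OF r(1)]
          quasi_iso_sum[OF pre(5,5,3,4) quasi_iso_refl[OF pre(5)] xy'] r(2)])
  \<comment> \<open>The defining relation for the images of \<open>F\<close> and \<open>\<alpha>(F)\<close>: the sum of \<open>z'\<close> and \<open>y'\<close> represents the class of \<open>x'\<close>.\<close>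
  have "l_equiv bar \<epsilon> Z r x'"
  proof -
    have eqs: "z' = \<lparr>qmod = qmod x', qform = qform x', qlag = qlag x', qsub = qlag y'\<rparr>"
      "y' = \<lparr>qmod = qmod x', qform = qform x', qlag = qlag y', qsub = qsub x'\<rparr>"
      "x' = \<lparr>qmod = qmod x', qform = qform x', qlag = qlag x', qsub = qsub x'\<rparr>"
      by (simp_all add: x'_def y'_def z'_def transport_quasi_def simps ysimps)
    have "l_equiv bar \<epsilon> Z r \<lparr>qmod = qmod x', qform = qform x', qlag = qlag x', qsub = qsub x'\<rparr>"
    proof (rule l_equiv.compose)
      show "simple_form bar \<epsilon> Z (qmod x') (qform x')"
        "simple_lagrangian bar \<epsilon> Z (qmod x') (qform x') (qlag x')"
        using quasi_formationD(1,2)[OF Tx(2)] by auto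
      show "simple_lagrangian bar \<epsilon> Z (qmod x') (qform x') (qlag y')"
        using quasi_formationD(2)[OF Ty(2)] eqs(2) by (metis quasi.select_convs(1,2))
      show "quasi_formation bar \<epsilon> Z \<lparr>qmod = qmod x', qform = qform x', qlag = qlag y', qsub = qsub x'\<rparr>"
        using Ty(2) eqs(2) by metis
      show "quasi_iso bar \<epsilon> Z (quasi_sum bar \<epsilon> Z
          \<lparr>qmod = qmod x', qform = qform x', qlag = qlag x', qsub = qlag y'\<rparr>
          \<lparr>qmod = qmod x', qform = qform x', qlag = qlag y', qsub = qsub x'\<rparr>) r"
        using r(2) eqs(1,2) by metis
    qed (rule r(1))
    then show ?thesis using eqs(3) by metis
  qed
  then have rx: "l_equiv bar \<epsilon> Z r u \<longleftrightarrow> l_equiv bar \<epsilon> Z x' u" for u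
    using l_equiv.trans l_equiv.sym by metis
  note cx = l_class_eq[OF x Tx(2,1)] and cz = l_class_eq[OF zq Tz(2,1)]
  have "l_class bar \<epsilon> Z z = l_class bar \<epsilon> Z z'"
    unfolding cz by (rule l_class_eq[OF Tz(2) Tz(2) quasi_iso_refl[OF pre(5)], symmetric])
  then have "l_class bar \<epsilon> Z z \<in> Ls_group bar \<epsilon> Z"
    unfolding Ls_group_def using z' by blast
  moreover have "l_class bar \<epsilon> Z z \<otimes>\<^bsub>l_monoid bar \<epsilon> Z\<^esub> l_class bar \<epsilon> Z x = l_class bar \<epsilon> Z x"
    using l_monoid_mult_eqI[OF Tz(2) cz Tx(2) cx r(1) zx] cx rx by simp
  ultimately show ?thesis by blast
qed

end
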